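(* Let $\mathbb{K}$ be a field. For $i=1,2$ let $G_i$ be a Cohen–Macaulay bipartite graph with a leaf $u_i$, let $N_{G_i}(u_i)=\{v_i\}$, and let $G=(G_1,u_1)*(G_2,u_2)$. Then $$\operatorname{depth}(S_G/I_G)=\operatorname{depth}(S_{G_1}/I_{G_1})+\operatorname{depth}(S_{G_2}/I_{G_2})-1.$$
   Context: Graphs are finite and simple; the graphs $G_1,G_2$ are assumed to have no isolated vertices. For a graph $H$ with vertex set $V(H)$ and edge set $E(H)$, $S_H=\mathbb{K}[V(H)]$ is the standard graded polynomial ring over $\mathbb{K}$ whose variables are the vertices of $H$, and $I_H=(uv \mid \{u,v\}\in E(H))\subset S_H$ is the edge ideal. $H$ is called Cohen–Macaulay if $S_H/I_H$ is a Cohen–Macaulay ring. $N_H(v)=\{u \mid \{u,v\}\in E(H)\}$, $\deg_H(v)=|N_H(v)|$, and $v$ is a leaf if $\deg_H(v)=1$. The $*$ operation: let $G_1,G_2$ be graphs on disjoint vertex sets and $u_i$ a leaf of $G_i$. Then $(G_1,u_1)*(G_2,u_2)$ is the graph obtained from $G_1$ and $G_2$ by identifying the vertices $u_1$ and $u_2$. *)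

theory Defs
  imports
    "HOL-Algebra.QuotRing"
    "HOL-Library.Poly_Mapping"
    "HOL-Library.Extended_Nat"
    "HOL-Library.Extended_Real"
begin

section \<open>Finite simple graphs\<close>

record 'v ugraph =
  verts :: "'v set"
  edges :: "'v set set"

definition simple_graph :: "'v ugraph \<Rightarrow> bool" where
  "simple_graph H \<longleftrightarrow> finite (verts H) \<and> (\<forall>e\<in>edges H. e \<subseteq> verts H \<and> card e = 2)"

definition neighborhood :: "'v ugraph \<Rightarrow> 'v \<Rightarrow> 'v set" where
  "neighborhood H v = {u. {u, v} \<in> edges H}"

definition degree :: "'v ugraph \<Rightarrow> 'v \<Rightarrow> nat" where
  "degree H v = card (neighborhood H v)"

definition leaf :: "'v ugraph \<Rightarrow> 'v \<Rightarrow> bool" where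
  "leaf H v \<longleftrightarrow> v \<in> verts H \<and> degree H v = 1"

definition no_isolated_vertices :: "'v ugraph \<Rightarrow> bool" where
  "no_isolated_vertices H \<longleftrightarrow> (\<forall>v\<in>verts H. neighborhood H v \<noteq> {})"

definition bipartite :: "'v ugraph \<Rightarrow> bool" where
  "bipartite H \<longleftrightarrow> (\<exists>X Y. X \<union> Y = verts H \<and> X \<inter> Y = {} \<and>
     (\<forall>e\<in>edges H. \<exists>x\<in>X. \<exists>y\<in>Y. e = {x, y}))"

text \<open>The vertices \<open>u1\<close> and \<open>u2\<close> are identified by mapping \<open>u2\<close> to \<open>u1\<close>; this is the intended
  construction when the vertex sets of the two graphs are disjoint.\<close>

definition star_graph :: "'v ugraph \<Rightarrow> 'v \<Rightarrow> 'v ugraph \<Rightarrow> 'v \<Rightarrow> 'v ugraph" where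
  "star_graph G1 u1 G2 u2 =
    (let identify = id(u2 := u1)
     in \<lparr>verts = identify ` (verts G1 \<union> verts G2),
         edges = (`) identify ` (edges G1 \<union> edges G2)\<rparr>)"


section \<open>Edge ideals and edge rings\<close>

text \<open>A polynomial with coefficients in \<open>'k\<close> maps monomials, i.e. exponent vectors
  \<open>'v \<Rightarrow>\<^sub>0 nat\<close>, to coefficients. The ring \<open>\<bbbK>[V]\<close> consists of those polynomials in which only
  variables from \<open>V\<close> occur.\<close>

type_synonym ('v, 'k) mpoly = "('v \<Rightarrow>\<^sub>0 nat) \<Rightarrow>\<^sub>0 'k"

definition var :: "'v \<Rightarrow> ('v, 'k::field) mpoly" where
  "var v = Poly_Mapping.single (Poly_Mapping.single v 1) 1"

definition poly_ring :: "'v set \<Rightarrow> ('v, 'k::field) mpoly ring" where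
  "poly_ring V =
    \<lparr>carrier = {p. \<forall>m\<in>Poly_Mapping.keys p. Poly_Mapping.keys m \<subseteq> V},
     monoid.mult = (*), one = 1, zero = 0, add = (+)\<rparr>"

definition edge_ideal :: "'v ugraph \<Rightarrow> ('v, 'k::field) mpoly set" where
  "edge_ideal H = Idl\<^bsub>poly_ring (verts H)\<^esub> {var u * var v | u v. {u, v} \<in> edges H}"

definition edge_ring :: "'v ugraph \<Rightarrow> ('v, 'k::field) mpoly set ring" where
  "edge_ring H = poly_ring (verts H) Quot edge_ideal H"

text \<open>The graded maximal ideal of \<open>S\<^sub>H/I\<^sub>H\<close>, generated by the residue classes of the variables.\<close>

definition irrelevant_ideal :: "'v ugraph \<Rightarrow> ('v, 'k::field) mpoly set set" where
  "irrelevant_ideal H =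
    Idl\<^bsub>edge_ring H\<^esub> ((\<lambda>v. edge_ideal H +>\<^bsub>poly_ring (verts H)\<^esub> var v) ` verts H)"


section \<open>Depth, Krull dimension and Cohen--Macaulayness\<close>

text \<open>Each \<open>x\<^sub>i\<close> is a nonzerodivisor on \<open>R/(x\<^sub>0,\<dots>,x\<^sub>i\<^sub>-\<^sub>1)\<close>, and \<open>R/(x\<^sub>0,\<dots>,x\<^sub>n\<^sub>-\<^sub>1) \<noteq> 0\<close>.\<close>

definition regular_sequence :: "('a, 'b) ring_scheme \<Rightarrow> 'a list \<Rightarrow> bool" where
  "regular_sequence R xs \<longleftrightarrow>
     set xs \<subseteq> carrier R \<and>
     (\<forall>i<length xs. \<forall>r\<in>carrier R.
        xs ! i \<otimes>\<^bsub>R\<^esub> r \<in> Idl\<^bsub>R\<^esub> (set (take i xs)) \<longrightarrow> r \<in> Idl\<^bsub>R\<^esub> (set (take i xs))) \<and>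
     Idl\<^bsub>R\<^esub> (set xs) \<noteq> carrier R"

definition grade :: "('a, 'b) ring_scheme \<Rightarrow> 'a set \<Rightarrow> enat" where
  "grade R J = (SUP xs\<in>{xs. set xs \<subseteq> J \<and> regular_sequence R xs}. enat (length xs))"

definition krull_dim :: "('a, 'b) ring_scheme \<Rightarrow> enat" where
  "krull_dim R =
    (SUP n\<in>{n. \<exists>P. (\<forall>i\<le>n. primeideal (P i) R) \<and> (\<forall>i<n. P i \<subset> P (Suc i))}. enat n)"

text \<open>As usual for a standard graded algebra, depth is taken with respect to the graded maximal
  ideal, and the algebra is Cohen--Macaulay if its depth equals its Krull dimension. The coefficient
  field is passed as a type argument.\<close>

definition edge_ring_depth :: "'k::field itself \<Rightarrow> 'v ugraph \<Rightarrow> enat" where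
  "edge_ring_depth _ H = grade (edge_ring H :: ('v, 'k) mpoly set ring) (irrelevant_ideal H)"

definition cohen_macaulay :: "'k::field itself \<Rightarrow> 'v ugraph \<Rightarrow> bool" where
  "cohen_macaulay K H \<longleftrightarrow>
     edge_ring_depth K H = krull_dim (edge_ring H :: ('v, 'k) mpoly set ring)"


section \<open>Well-formedness\<close>

lemma cring_poly_ring: "cring (poly_ring V :: ('v, 'k::field) mpoly ring)"
proof -
  let ?R = "poly_ring V :: ('v, 'k) mpoly ring"
  define C where "C = {p :: ('v, 'k) mpoly. \<forall>m\<in>Poly_Mapping.keys p. Poly_Mapping.keys m \<subseteq> V}"
  have R: "carrier ?R = C" "zero ?R = 0" "one ?R = 1" "add ?R = (+)" "monoid.mult ?R = (*)"
    by (simp_all add: poly_ring_def C_def)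
  have zero: "0 \<in> C" and one: "1 \<in> C"
    by (simp_all add: C_def)
  have add: "p + q \<in> C" if "p \<in> C" "q \<in> C" for p q
    using that Poly_Mapping.keys_add[of p q] unfolding C_def by blast
  have neg: "- p \<in> C" if "p \<in> C" for p
    using that by (simp add: C_def)
  have mult: "p * q \<in> C" if p: "p \<in> C" and q: "q \<in> C" for p q
    unfolding C_def
  proof (rule CollectI, rule ballI)
    fix m assume "m \<in> Poly_Mapping.keys (p * q)"
    then obtain a b where "m = a + b" "a \<in> Poly_Mapping.keys p" "b \<in> Poly_Mapping.keys q"
      using keys_mult[of p q] by blast
    then show "Poly_Mapping.keys m \<subseteq> V"
      using p q Poly_Mapping.keys_add[of a b] unfolding C_def by blast
  qed
  have "abelian_group ?R"
  proof (rule abelian_groupI, unfold R)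
    fix x assume "x \<in> C"
    then show "\<exists>y\<in>C. y + x = 0"
      using neg by (intro bexI[of _ "- x"]) simp_all
  qed (simp_all add: zero add add.assoc add.commute)
  moreover have "comm_monoid ?R"
    by (rule comm_monoidI, unfold R) (simp_all add: one mult mult.assoc mult.commute)
  ultimately show ?thesis
    by (rule cringI) (simp add: R distrib_right)
qed

lemma var_in_poly_ring: "v \<in> V \<Longrightarrow> var v \<in> carrier (poly_ring V)"
  by (simp add: poly_ring_def var_def)

lemma ideal_edge_ideal:
  assumes "simple_graph H"
  shows "ideal (edge_ideal H :: ('v, 'k::field) mpoly set) (poly_ring (verts H))"
proof -
  interpret cring "poly_ring (verts H) :: ('v, 'k) mpoly ring" by (rule cring_poly_ring)
  have "var u * var v \<in> carrier (poly_ring (verts H) :: ('v, 'k) mpoly ring)"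
    if "{u, v} \<in> edges H" for u v
  proof -
    have "u \<in> verts H" "v \<in> verts H"
      using assms that by (auto simp: simple_graph_def)
    then show ?thesis
      using m_closed[OF var_in_poly_ring var_in_poly_ring, of u v] by (simp add: poly_ring_def)
  qed
  then show ?thesis
    unfolding edge_ideal_def by (intro genideal_ideal) auto
qed

lemma cring_edge_ring:
  assumes "simple_graph H"
  shows "cring (edge_ring H :: ('v, 'k::field) mpoly set ring)"
  unfolding edge_ring_def
  by (intro ideal.quotient_is_cring ideal_edge_ideal assms cring_poly_ring)

end

theory Submission
  imports Defs
begin

text \<open>Write \<open>n\<^sub>i\<close> for the depth of \<open>S/I\<close> of \<open>G\<^sub>i\<close>. The vertices outside a maximal independent set \<open>F\<close>
generate an associated prime of the edge ideal, with residue ring a polynomial ring in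
\<open>card F\<close> variables; hence \<open>card F\<close> bounds the depth from above and the Krull dimension from below.
In a Cohen--Macaulay graph all maximal independent sets therefore have the same size, the depth.
Gluing such a set through \<open>u1\<close> to one through \<open>u2\<close> gives a maximal independent set of size
\<open>n\<^sub>1 + n\<^sub>2 - 1\<close> in the joined graph, so its depth is at most that number.

For the reverse inequality a regular sequence of that length is written down. By Herzog and Hibi
(\<open>cohen_macaulay_bipartite_structure\<close>), the vertices of \<open>G\<^sub>i\<close> come in \<open>n\<^sub>i\<close> adjacent pairs \<open>x, p x\<close>, and
reading an edge from \<open>x\<close> to \<open>p y\<close> as a relation between \<open>x\<close> and \<open>y\<close> gives a partial order. A leaf
is paired with its neighbour. The sequence consists of the differences \<open>x - p x\<close> for all pairs of both
graphs other than the two leaf pairs, followed by the single linear form \<open>u + v1 + v2\<close> for the glued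
leaf \<open>u\<close> (\<open>depth_ge_pairs_and_star\<close>). Dividing by differences of variables identifies variables, so every
intermediate ring is again a quotient by a monomial ideal, where a linear form is a nonzerodivisor as soon as
no standard monomial is annihilated by all its variables (\<open>linear_form_nonzerodivisor\<close>). Transitivity and antisymmetry of
the order give this for the differences, and for the last form it holds because \<open>v1\<close> and \<open>v2\<close> are the only
neighbours of \<open>u\<close>.

The substance is in extracting the partial order from the Cohen--Macaulay property. Equal sizes of the maximal
independent sets give the pairing, by Hall's theorem, and transitivity. Antisymmetry is finer: two
equivalent elements would make the link of some independent set \<open>F\<close> of size at most \<open>n - 2\<close>
disconnected, and then the depth is at most \<open>card F + 1\<close>
(\<open>depth_le_of_disconnected_link\<close>). Both upper bounds for the depth are obtained from Koszul cohomology. A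
regular sequence of length \<open>d\<close> in the graded maximal ideal forces the Koszul cohomology of all the variables to vanish
below degree \<open>d\<close>; each variable that is then left out costs one degree, by a graded Nakayama argument
(\<open>koszul_vanishes_drop_variable\<close>). With only the variables outside \<open>F\<close> left, vanishing in degrees 0 and 1 can be
refuted by explicit classes. This works for arbitrary, not necessarily homogeneous, regular sequences.\<close>

section \<open>Koszul cohomology of a list of ring elements\<close>

text \<open>The differential is defined by recursion on the list, as an iterated mapping cone. A cochain is a function on
bit lists, where a bit list as long as \<open>xs\<close> stands for the set of positions of its \<open>True\<close> entries. The signs come out of
the recursion.\<close>

fun koszul :: "'r::comm_ring_1 list \<Rightarrow> (bool list \<Rightarrow> 'r) \<Rightarrow> bool list \<Rightarrow> 'r" where
  "koszul (x # xs) c (False # bs) = koszul xs (\<lambda>t. c (False # t)) bs"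
| "koszul (x # xs) c (True # bs) = x * c (False # bs) - koszul xs (\<lambda>t. c (True # t)) bs"
| "koszul [] c bs = 0"
| "koszul (x # xs) c [] = 0"

text \<open>The degree is an integer so that degree \<open>-1\<close> contains only the zero cochain.\<close>

definition cochain :: "'r::comm_ring_1 set \<Rightarrow> nat \<Rightarrow> int \<Rightarrow> (bool list \<Rightarrow> 'r) \<Rightarrow> bool" where
  "cochain C n k c \<longleftrightarrow>
     (\<forall>bs. c bs \<in> C \<and> (c bs \<noteq> 0 \<longrightarrow> length bs = n \<and> int (count_list bs True) = k))"

text \<open>The cohomology of \<open>C / J\<close> in degree \<open>k\<close> is zero. Everything is phrased modulo \<open>J\<close> with
representatives in \<open>C\<close>, so that no quotient modules have to be formed.\<close>

definition koszul_vanishes :: "'r::comm_ring_1 set \<Rightarrow> 'r set \<Rightarrow> 'r list \<Rightarrow> int \<Rightarrow> bool" where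
  "koszul_vanishes C J xs k \<longleftrightarrow>
     (\<forall>c. cochain C (length xs) k c \<and> (\<forall>bs. koszul xs c bs \<in> J) \<longrightarrow>
       (\<exists>b. cochain C (length xs) (k - 1) b \<and> (\<forall>bs. c bs - koszul xs b bs \<in> J)))"

text \<open>\<open>C\<close> is a subring of the ambient type and \<open>J\<close> is an ideal of \<open>C\<close>. The typical case is a polynomial
ring in finitely many of the variables of the type.\<close>

locale rel_ideal =
  fixes C J :: "'r::comm_ring_1 set"
  assumes one_C: "1 \<in> C" and add_C: "a \<in> C \<Longrightarrow> b \<in> C \<Longrightarrow> a + b \<in> C"
    and mult_C: "a \<in> C \<Longrightarrow> b \<in> C \<Longrightarrow> a * b \<in> C" and uminus_C: "a \<in> C \<Longrightarrow> - a \<in> C"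
    and J_sub: "J \<subseteq> C" and zero_J: "0 \<in> J" and add_J: "a \<in> J \<Longrightarrow> b \<in> J \<Longrightarrow> a + b \<in> J"
    and mult_J: "a \<in> C \<Longrightarrow> b \<in> J \<Longrightarrow> a * b \<in> J"
begin

lemma zero_C: "0 \<in> C"
  using J_sub zero_J by auto

lemma diff_C: "a \<in> C \<Longrightarrow> b \<in> C \<Longrightarrow> a - b \<in> C"
  using add_C[of a "- b"] uminus_C by simp

lemma uminus_J: "a \<in> J \<Longrightarrow> - a \<in> J"
  using mult_J[of "- 1" a] one_C uminus_C by simp

lemma diff_J: "a \<in> J \<Longrightarrow> b \<in> J \<Longrightarrow> a - b \<in> J"
  using add_J[of a "- b"] uminus_J by simp

lemma sum_J: "(\<And>x. x \<in> A \<Longrightarrow> f x \<in> J) \<Longrightarrow> sum f A \<in> J"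
  by (induction A rule: infinite_finite_induct) (auto simp: zero_J add_J)

end

lemma koszul_zero: "koszul xs (\<lambda>_. 0) bs = 0"
  by (induction xs "\<lambda>_::bool list. 0::'a" bs rule: koszul.induct) auto

lemma koszul_add: "koszul xs (\<lambda>t. c t + c' t) bs = koszul xs c bs + koszul xs c' bs"
  by (induction xs c bs arbitrary: c' rule: koszul.induct) (simp_all add: distrib_left add_diff_add)

lemma koszul_scale: "koszul xs (\<lambda>t. r * c t) bs = r * koszul xs c bs"
  by (induction xs c bs rule: koszul.induct) (auto simp: algebra_simps)

lemma koszul_uminus: "koszul xs (\<lambda>t. - c t) bs = - koszul xs c bs"
  using koszul_scale[of xs "-1" c bs] by simp

lemma koszul_diff: "koszul xs (\<lambda>t. c t - c' t) bs = koszul xs c bs - koszul xs c' bs"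
  using koszul_add[of xs c "\<lambda>t. - c' t" bs] by (simp add: koszul_uminus)

lemma koszul_sum: "koszul xs (\<lambda>t. \<Sum>e\<in>A. c e t) bs = (\<Sum>e\<in>A. koszul xs (c e) bs)"
  by (induction A rule: infinite_finite_induct) (simp_all add: koszul_zero koszul_add)

lemma koszul_koszul: "koszul xs (koszul xs c) bs = 0"
  by (induction xs c bs rule: koszul.induct)
    (auto simp: koszul_diff koszul_scale)

lemma (in rel_ideal) koszul_in_ideal:
  "(\<And>bs. c bs \<in> J) \<Longrightarrow> set xs \<subseteq> C \<Longrightarrow> koszul xs c bs \<in> J"
  by (induction xs c bs rule: koszul.induct) (auto simp: zero_J diff_J mult_J)

lemma cochain_Cons:
  assumes "0 \<in> C"
  shows "cochain C (Suc n) k c \<longleftrightarrow>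
    c [] = 0 \<and> cochain C n k (\<lambda>t. c (False # t)) \<and> cochain C n (k - 1) (\<lambda>t. c (True # t))"
    (is "?l \<longleftrightarrow> ?r")
proof
  show "?l \<Longrightarrow> ?r" unfolding cochain_def by fastforce
next
  assume r: ?r
  show ?l unfolding cochain_def
  proof
    fix bs show "c bs \<in> C \<and> (c bs \<noteq> 0 \<longrightarrow> length bs = Suc n \<and> int (count_list bs True) = k)"
    proof (cases bs)
      case Nil then show ?thesis using r assms by simp
    next
      case (Cons b t) then show ?thesis using r
        by (cases b) (auto simp: cochain_def)
    qed
  qed
qed

lemma cochain_zero: "0 \<in> C \<Longrightarrow> cochain C n k (\<lambda>_. 0)"
  by (auto simp: cochain_def)

context rel_ideal
begin

lemma cochain_add: "cochain C n k c \<Longrightarrow> cochain C n k c' \<Longrightarrow> cochain C n k (\<lambda>t. c t + c' t)"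
  unfolding cochain_def by (metis add_C add.right_neutral)

lemma cochain_diff: "cochain C n k c \<Longrightarrow> cochain C n k c' \<Longrightarrow> cochain C n k (\<lambda>t. c t - c' t)"
  unfolding cochain_def by (metis diff_C diff_zero)

lemma cochain_scale: "r \<in> C \<Longrightarrow> cochain C n k c \<Longrightarrow> cochain C n k (\<lambda>t. r * c t)"
  unfolding cochain_def by (metis mult_C mult_zero_right)

lemma cochain_sum:
  "(\<And>e. e \<in> A \<Longrightarrow> cochain C n k (c e)) \<Longrightarrow> cochain C n k (\<lambda>t. \<Sum>e\<in>A. c e t)"
  by (induction A rule: infinite_finite_induct) (simp_all add: cochain_zero zero_C cochain_add)

lemma cochain_koszul:
  "set xs \<subseteq> C \<Longrightarrow> cochain C (length xs) k c \<Longrightarrow> cochain C (length xs) (k + 1) (koszul xs c)"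
proof (induction xs arbitrary: c k)
  case Nil
  then show ?case by (auto simp: cochain_def zero_C)
next
  case (Cons x xs)
  from Cons.prems have c: "cochain C (length xs) k (\<lambda>t. c (False # t))"
    "cochain C (length xs) (k - 1) (\<lambda>t. c (True # t))"
    by (auto simp: cochain_Cons zero_C)
  show ?case
    using Cons.IH[OF _ c(1)] Cons.IH[OF _ c(2)] Cons.prems(1) cochain_scale[OF _ c(1), of x]
    by (auto simp: cochain_Cons zero_C intro: cochain_diff)
qed

end

text \<open>Contraction with the \<open>p\<close>-th basis vector, the null-homotopy of multiplication by the \<open>p\<close>-th list entry.\<close>

fun contract :: "nat \<Rightarrow> (bool list \<Rightarrow> 'r::comm_ring_1) \<Rightarrow> bool list \<Rightarrow> 'r" where
  "contract 0 c (False # bs) = c (True # bs)"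
| "contract (Suc p) c (False # bs) = contract p (\<lambda>t. c (False # t)) bs"
| "contract (Suc p) c (True # bs) = - contract p (\<lambda>t. c (True # t)) bs"
| "contract _ c _ = 0"

lemma contract_zero: "contract p (\<lambda>_. 0) bs = 0"
  by (induction p "\<lambda>_::bool list. 0::'a" bs rule: contract.induct) auto

lemma contract_add: "contract p (\<lambda>t. c t + c' t) bs = contract p c bs + contract p c' bs"
  by (induction p c bs arbitrary: c' rule: contract.induct) simp_all

lemma contract_scale: "contract p (\<lambda>t. r * c t) bs = r * contract p c bs"
  by (induction p c bs rule: contract.induct) (auto simp: algebra_simps)

lemma contract_diff: "contract p (\<lambda>t. c t - c' t) bs = contract p c bs - contract p c' bs"
  using contract_add[of p c "\<lambda>t. (-1) * c' t" bs] contract_scale[of p "-1" c' bs] by simp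

lemma koszul_homotopy:
  "p < length xs \<Longrightarrow> length bs = length xs \<Longrightarrow>
    koszul xs (contract p c) bs + contract p (koszul xs c) bs = xs ! p * c bs"
proof (induction xs arbitrary: p c bs)
  case Nil then show ?case by simp
next
  case (Cons x xs)
  obtain b t where bs: "bs = b # t" "length t = length xs" using Cons.prems by (cases bs) auto
  show ?case
  proof (cases p)
    case 0 then show ?thesis using bs by (cases b) (auto simp: koszul_zero)
  next
    case (Suc q)
    then have "koszul xs (contract q c) t + contract q (koszul xs c) t = xs ! q * c t" for c
      using Cons bs by auto
    from this[of "\<lambda>t. c (b # t)"] show ?thesis using bs Suc
      by (cases b) (auto simp: contract_diff contract_scale koszul_uminus algebra_simps)
  qed
qed

context rel_ideal
begin

lemma contract_in: "(\<And>bs. c bs \<in> J) \<Longrightarrow> contract p c bs \<in> J"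
  by (induction p c bs rule: contract.induct) (auto simp: zero_J uminus_J)

lemma cochain_contract: "cochain C n k c \<Longrightarrow> cochain C n (k - 1) (contract p c)"
proof (induction p arbitrary: n k c)
  case 0
  show ?case
  proof (cases n)
    case 0
    then have "contract 0 c bs = 0" for bs 
      using \<open>cochain C n k c\<close> by (cases "(0::nat, c, bs)" rule: contract.cases) (auto simp: cochain_def)
    then show ?thesis by (simp add: cochain_def zero_C)
  next
    case (Suc m) then show ?thesis using 0 by (simp add: cochain_Cons zero_C cochain_zero)
  qed
next
  case (Suc p)
  show ?case
  proof (cases n)
    case 0
    then have "c bs = 0" if "bs \<noteq> []" for bs
      using Suc.prems that by (auto simp: cochain_def)
    then have "contract (Suc p) c bs = 0" for bs
      by (cases "(Suc p, c, bs)" rule: contract.cases) (auto simp: contract_zero)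
    then show ?thesis by (simp add: cochain_def zero_C)
  next
    case (Suc m)
    then show ?thesis using Suc.prems Suc.IH[of m k "\<lambda>t. c (False # t)"] Suc.IH[of m "k - 1" "\<lambda>t. c (True # t)"]
      cochain_scale[of "-1" m "k - 2" "contract p (\<lambda>t. c (True # t))"]
      by (auto simp: cochain_Cons zero_C one_C uminus_C)
  qed
qed

text \<open>Multiplication by \<open>a\<close> is zero on the cohomology of \<open>C / J\<close> in degree \<open>k\<close>.\<close>

definition kills :: "'r list \<Rightarrow> int \<Rightarrow> 'r \<Rightarrow> bool" where
  "kills xs k a \<longleftrightarrow> (\<forall>c. cochain C (length xs) k c \<and> (\<forall>bs. koszul xs c bs \<in> J) \<longrightarrow>
     (\<exists>b. cochain C (length xs) (k - 1) b \<and> (\<forall>bs. a * c bs - koszul xs b bs \<in> J)))"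

lemma kills_member:
  assumes "a \<in> set xs" "set xs \<subseteq> C"
  shows "kills xs k a"
  unfolding kills_def
proof (intro allI impI, elim conjE)
  fix c assume c: "cochain C (length xs) k c" and z: "\<forall>bs. koszul xs c bs \<in> J"
  obtain p where p: "p < length xs" "xs ! p = a" using assms(1) by (meson in_set_conv_nth)
  have "a * c bs - koszul xs (contract p c) bs \<in> J" for bs
  proof (cases "length bs = length xs")
    case True
    from koszul_homotopy[OF p(1) True, of c] p(2)
    have "a * c bs - koszul xs (contract p c) bs = contract p (koszul xs c) bs"
      by (simp add: algebra_simps)
    then show ?thesis using z contract_in by auto
  next
    case False
    then have "c bs = 0" "koszul xs (contract p c) bs = 0"
      using c cochain_koszul[OF assms(2) cochain_contract[OF c, of p]] unfolding cochain_def by blast+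
    then show ?thesis by (simp add: zero_J)
  qed
  with cochain_contract[OF c] show "\<exists>b. cochain C (length xs) (k - 1) b \<and>
      (\<forall>bs. a * c bs - koszul xs b bs \<in> J)" by blast
qed

lemma kills_ideal_member: "a \<in> J \<Longrightarrow> kills xs k a"
  unfolding kills_def
  by (auto intro!: exI[of _ "\<lambda>_. 0"] cochain_zero zero_C simp: koszul_zero cochain_def)
     (metis mult_J mult.commute)

lemma kills_add:
  assumes "kills xs k a" "kills xs k a'" 
  shows "kills xs k (a + a')"
  unfolding kills_def
proof (intro allI impI)
  fix c assume c: "cochain C (length xs) k c \<and> (\<forall>bs. koszul xs c bs \<in> J)"
  obtain b where b: "cochain C (length xs) (k - 1) b" "\<And>bs. a * c bs - koszul xs b bs \<in> J"
    using assms(1) c unfolding kills_def by blast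
  obtain b' where b': "cochain C (length xs) (k - 1) b'" "\<And>bs. a' * c bs - koszul xs b' bs \<in> J"
    using assms(2) c unfolding kills_def by blast
  have "(a + a') * c bs - koszul xs (\<lambda>t. b t + b' t) bs \<in> J" for bs
    using add_J[OF b(2) b'(2), of bs bs] by (simp add: koszul_add algebra_simps)
  then show "\<exists>b. cochain C (length xs) (k - 1) b \<and> (\<forall>bs. (a + a') * c bs - koszul xs b bs \<in> J)"
    using cochain_add[OF b(1) b'(1)] by blast
qed

lemma kills_mult:
  assumes "kills xs k a" "r \<in> C"
  shows "kills xs k (r * a)"
  unfolding kills_def
proof (intro allI impI)
  fix c assume c: "cochain C (length xs) k c \<and> (\<forall>bs. koszul xs c bs \<in> J)"
  obtain b where b: "cochain C (length xs) (k - 1) b" "\<And>bs. a * c bs - koszul xs b bs \<in> J"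
    using assms(1) c unfolding kills_def by blast
  have "(r * a) * c bs - koszul xs (\<lambda>t. r * b t) bs \<in> J" for bs
    using mult_J[OF assms(2) b(2)[of bs]] by (simp add: koszul_scale algebra_simps)
  then show "\<exists>b. cochain C (length xs) (k - 1) b \<and> (\<forall>bs. (r * a) * c bs - koszul xs b bs \<in> J)"
    using cochain_scale[OF assms(2) b(1)] by blast
qed

text \<open>The long exact sequence of multiplication by \<open>a\<close>: if \<open>a\<close> is regular on \<open>C / J\<close>, and \<open>K\<close> is the ideal
\<open>J + a C\<close>, then vanishing for \<open>C / K\<close> one degree lower makes \<open>a\<close> injective on the cohomology of \<open>C / J\<close>; as
\<open>a\<close> also acts as zero there, that cohomology vanishes.\<close>

lemma koszul_vanishes_of_regular:
  assumes xs: "set xs \<subseteq> C" and "kills xs k a" and a: "a \<in> C"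
    and reg: "\<And>r. r \<in> C \<Longrightarrow> a * r \<in> J \<Longrightarrow> r \<in> J"
    and K: "\<And>f. f \<in> K \<Longrightarrow> \<exists>j\<in>J. \<exists>r\<in>C. f = j + a * r" "J \<subseteq> K" "\<And>f. f \<in> C \<Longrightarrow> a * f \<in> K"
    and van: "koszul_vanishes C K xs (k - 1)" and KI: "rel_ideal C K"
  shows "koszul_vanishes C J xs k"
  unfolding koszul_vanishes_def
proof (intro allI impI, elim conjE)
  fix c assume c: "cochain C (length xs) k c" and z: "\<forall>bs. koszul xs c bs \<in> J"
  from assms(2) c z obtain b where b: "cochain C (length xs) (k - 1) b"
    "\<And>bs. a * c bs - koszul xs b bs \<in> J" unfolding kills_def by blast
  have "koszul xs b bs \<in> K" for bs
  proof -
    have "a * c bs \<in> K" using K(3) c by (simp add: cochain_def)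
    moreover have "a * c bs - koszul xs b bs \<in> K" using b(2) K(2) by auto
    ultimately show ?thesis using rel_ideal.diff_J[OF KI, of "a * c bs" "a * c bs - koszul xs b bs"] by simp
  qed
  with b(1) van obtain e where e: "cochain C (length xs) (k - 1 - 1) e"
    "\<And>bs. b bs - koszul xs e bs \<in> K" unfolding koszul_vanishes_def by blast
  have "\<exists>j r. j \<in> J \<and> r \<in> C \<and> b bs - koszul xs e bs = j + a * r \<and>
      (b bs - koszul xs e bs = 0 \<longrightarrow> j = 0 \<and> r = 0)" for bs
  proof (cases "b bs - koszul xs e bs = 0")
    case True then show ?thesis using zero_J zero_C by (intro exI[of _ 0]) simp
  next
    case False then show ?thesis using K(1)[OF e(2)[of bs]] by metis
  qed
  then obtain j g where jg: "\<And>bs. j bs \<in> J" "\<And>bs. g bs \<in> C"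
    "\<And>bs. b bs - koszul xs e bs = j bs + a * g bs"
    "\<And>bs. b bs - koszul xs e bs = 0 \<Longrightarrow> g bs = 0" by metis
  have be: "cochain C (length xs) (k - 1) (\<lambda>t. b t - koszul xs e t)"
    using cochain_diff[OF b(1)] cochain_koszul[OF xs e(1)] by simp
  have g: "cochain C (length xs) (k - 1) g"
    using be jg(2,4) unfolding cochain_def by blast
  have "c bs - koszul xs g bs \<in> J" for bs
  proof (rule reg)
    show "c bs - koszul xs g bs \<in> C"
      using c cochain_koszul[OF xs g] by (auto simp: cochain_def intro: diff_C)
    have "koszul xs (\<lambda>t. b t - koszul xs e t) bs = koszul xs (\<lambda>t. j t + a * g t) bs"
      using jg(3) by simp
    then have "koszul xs b bs = koszul xs j bs + a * koszul xs g bs"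
      by (simp add: koszul_diff koszul_koszul koszul_add koszul_scale)
    then have "a * (c bs - koszul xs g bs) = (a * c bs - koszul xs b bs) + koszul xs j bs"
      by (simp add: algebra_simps)
    then show "a * (c bs - koszul xs g bs) \<in> J"
      using b(2) koszul_in_ideal[OF jg(1) xs] add_J by simp
  qed
  with g show "\<exists>b. cochain C (length xs) (k - 1) b \<and> (\<forall>bs. c bs - koszul xs b bs \<in> J)" by blast
qed

lemma koszul_vanishes_negative: "k < 0 \<Longrightarrow> koszul_vanishes C J xs k"
  unfolding koszul_vanishes_def
proof (intro allI impI, elim conjE)
  fix c assume "k < 0" and c: "cochain C (length xs) k c"
  then have "c bs = 0" for bs unfolding cochain_def by (metis of_nat_0_le_iff not_less)
  then show "\<exists>b. cochain C (length xs) (k - 1) b \<and> (\<forall>bs. c bs - koszul xs b bs \<in> J)"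
    by (intro exI[of _ "\<lambda>_. 0"]) (simp add: koszul_zero cochain_zero zero_C zero_J)
qed

text \<open>The long exact sequence of the mapping cone of \<open>x\<close>: the class of \<open>c\<close> is sent to a class in degree
\<open>k + 1\<close>, and if that one vanishes then \<open>c\<close> is \<open>x\<close> times the class of \<open>b0\<close>.\<close>

lemma koszul_surj_of_vanishes_Cons:
  assumes van: "koszul_vanishes C J (x # xs) (k + 1)"
    and c: "cochain C (length xs) k c" and z: "\<And>bs. koszul xs c bs \<in> J"
  obtains b0 b1 where "cochain C (length xs) k b0" "cochain C (length xs) (k - 1) b1"
    "\<And>bs. koszul xs b0 bs \<in> J" "\<And>bs. c bs - (x * b0 bs - koszul xs b1 bs) \<in> J"
proof -
  \<comment> \<open>\<open>c\<close> placed in the shifted copy inside the mapping cone.\<close>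
  define c' where "c' bs = (case bs of True # t \<Rightarrow> c t | _ \<Rightarrow> 0)" for bs
  have c'_simps: "c' [] = 0" "c' (False # t) = 0" "c' (True # t) = c t" for t
    by (auto simp: c'_def)
  have 1: "cochain C (length (x # xs)) (k + 1) c'"
    using c by (simp add: cochain_Cons zero_C cochain_zero c'_simps)
  have "koszul (x # xs) c' bs \<in> J" for bs
    by (cases "(x # xs, c', bs)" rule: koszul.cases)
      (auto simp: c'_simps koszul_zero zero_J z uminus_J)
  with 1 van obtain b where b: "cochain C (Suc (length xs)) k b"
    "\<And>bs. c' bs - koszul (x # xs) b bs \<in> J" unfolding koszul_vanishes_def by fastforce
  show ?thesis
  proof (rule that[of "\<lambda>t. b (False # t)" "\<lambda>t. b (True # t)"])
    show "koszul xs (\<lambda>t. b (False # t)) bs \<in> J" for bs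
      using uminus_J[OF b(2)[of "False # bs"]] by (simp add: c'_simps)
    show "c bs - (x * b (False # bs) - koszul xs (\<lambda>t. b (True # t)) bs) \<in> J" for bs
      using b(2)[of "True # bs"] by (simp add: c'_simps)
  qed (use b(1) in \<open>auto simp: cochain_Cons zero_C\<close>)
qed

end

text \<open>The basis element in degree zero. Its multiples are all the cochains of degree zero.\<close>

definition unit_cochain :: "nat \<Rightarrow> bool list \<Rightarrow> 'r::comm_ring_1" where
  "unit_cochain n bs = (if bs = replicate n False then 1 else 0)"

text \<open>The cochain of degree one whose value at the bit list selecting \<open>x\<close> is \<open>\<phi> x\<close>.\<close>

fun deg_one :: "'r::comm_ring_1 list \<Rightarrow> ('r \<Rightarrow> 'r) \<Rightarrow> bool list \<Rightarrow> 'r" where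
  "deg_one (x # xs) \<phi> (False # bs) = deg_one xs \<phi> bs"
| "deg_one (x # xs) \<phi> (True # bs) = \<phi> x * unit_cochain (length xs) bs"
| "deg_one _ _ _ = 0"

lemma koszul_unit_cochain: "koszul xs (unit_cochain (length xs)) bs = deg_one xs (\<lambda>x. x) bs"
proof (induction xs arbitrary: bs)
  case Nil then show ?case by simp
next
  case (Cons x xs)
  have "(\<lambda>t. unit_cochain (Suc (length xs)) (False # t)) = (unit_cochain (length xs) :: _ \<Rightarrow> 'a)"
    "(\<lambda>t. unit_cochain (Suc (length xs)) (True # t)) = (\<lambda>_. 0 :: 'a)"
    by (auto simp: unit_cochain_def)
  then show ?case using Cons[of "tl bs"]
    by (cases "(x # xs, unit_cochain (Suc (length xs)) :: _ \<Rightarrow> 'a, bs)" rule: koszul.cases)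
      (auto simp: koszul_zero unit_cochain_def)
qed

lemma deg_one_scale: "r * deg_one xs \<phi> bs = deg_one xs (\<lambda>x. r * \<phi> x) bs"
  by (induction xs \<phi> bs rule: deg_one.induct) auto

lemma deg_one_diff: "deg_one xs \<phi> bs - deg_one xs \<psi> bs = deg_one xs (\<lambda>x. \<phi> x - \<psi> x) bs"
  by (induction xs \<phi> bs rule: deg_one.induct) (auto simp: left_diff_distrib)

context rel_ideal
begin

lemma cochain_unit: "cochain C n 0 (unit_cochain n)"
  by (auto simp: cochain_def unit_cochain_def one_C zero_C)

lemma cochain_deg_one:
  "(\<And>x. x \<in> set xs \<Longrightarrow> \<phi> x \<in> C) \<Longrightarrow> cochain C (length xs) 1 (deg_one xs \<phi>)"
proof (induction xs)
  case Nil then show ?case by (simp add: cochain_def zero_C)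
next
  case (Cons x xs) then show ?case
    by (auto simp: cochain_Cons zero_C intro!: cochain_scale cochain_unit)
qed

lemma deg_one_in: "(\<And>x. x \<in> set xs \<Longrightarrow> \<phi> x \<in> J) \<Longrightarrow> deg_one xs \<phi> bs \<in> J"
  by (induction xs \<phi> bs rule: deg_one.induct) (auto simp: unit_cochain_def zero_J)

lemma deg_one_inD:
  "(\<And>bs. deg_one xs \<phi> bs \<in> J) \<Longrightarrow> x \<in> set xs \<Longrightarrow> \<phi> x \<in> J"
proof (induction xs)
  case Nil then show ?case by simp
next
  case (Cons y xs)
  show ?case
  proof (cases "x = y")
    case True then show ?thesis
      using Cons.prems(1)[of "True # replicate (length xs) False"] by (simp add: unit_cochain_def)
  next
    case False
    have "deg_one xs \<phi> bs \<in> J" for bs using Cons.prems(1)[of "False # bs"] by simp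
    then show ?thesis using Cons.IH Cons.prems(2) False by simp
  qed
qed

text \<open>The cohomology in degree zero is the annihilator of \<open>xs\<close> in \<open>C / J\<close>.\<close>

lemma koszul_vanishes_0D:
  assumes van: "koszul_vanishes C J xs 0" and z: "z \<in> C" and kill: "\<And>x. x \<in> set xs \<Longrightarrow> x * z \<in> J"
  shows "z \<in> J"
proof -
  let ?c = "\<lambda>t. z * unit_cochain (length xs) t"
  have "koszul xs ?c bs \<in> J" for bs
    unfolding koszul_scale koszul_unit_cochain deg_one_scale
    using kill by (intro deg_one_in) (simp add: mult.commute)
  with van cochain_scale[OF z cochain_unit] obtain b where
    b: "cochain C (length xs) (- 1) b" "\<And>bs. ?c bs - koszul xs b bs \<in> J"
    unfolding koszul_vanishes_def by fastforce
  have "b = (\<lambda>_. 0)" using b(1) by (auto simp: cochain_def)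
  with b(2)[of "replicate (length xs) False"] show ?thesis
    by (simp add: koszul_zero unit_cochain_def)
qed

text \<open>Compatibility of \<open>\<phi>\<close> with the Koszul relations makes the cochain of degree one with values \<open>\<phi>\<close> a cocycle, and
the coboundaries in degree one are the multiplications by a fixed element.\<close>

lemma koszul_vanishes_1D:
  assumes van: "koszul_vanishes C J xs 1" and xs: "set xs \<subseteq> C"
    and \<phi>: "\<And>x. x \<in> set xs \<Longrightarrow> \<phi> x \<in> C"
    and comp: "\<And>x y. x \<in> set xs \<Longrightarrow> y \<in> set xs \<Longrightarrow> x * \<phi> y - y * \<phi> x \<in> J"
  obtains g where "g \<in> C" "\<And>x. x \<in> set xs \<Longrightarrow> \<phi> x - x * g \<in> J"
proof -
  have "koszul xs (deg_one xs \<phi>) bs \<in> J" for bs using comp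
  proof (induction xs arbitrary: bs)
    case Nil then show ?case by (simp add: zero_J)
  next
    case (Cons x xs)
    have "x * deg_one xs \<phi> t - \<phi> x * deg_one xs (\<lambda>x. x) t \<in> J" for t
      unfolding deg_one_scale deg_one_diff
      using Cons.prems[of x] by (intro deg_one_in) (simp add: mult.commute)
    moreover have "koszul xs (deg_one xs \<phi>) t \<in> J" for t
      using Cons by simp
    ultimately show ?case
      by (cases "(x # xs, deg_one (x # xs) \<phi>, bs)" rule: koszul.cases)
        (auto simp: koszul_scale koszul_unit_cochain zero_J)
  qed
  with van cochain_deg_one[of xs \<phi>, OF \<phi>] obtain b where
    b: "cochain C (length xs) 0 b" "\<And>bs. deg_one xs \<phi> bs - koszul xs b bs \<in> J"
    unfolding koszul_vanishes_def by fastforce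
  define g where "g = b (replicate (length xs) False)"
  have "b bs = g * unit_cochain (length xs) bs" for bs
  proof (cases "bs = replicate (length xs) False")
    case False
    have "length bs = n \<Longrightarrow> count_list bs True = 0 \<Longrightarrow> bs = replicate n False" for n
      by (induction bs arbitrary: n) (auto split: if_splits)
    then have "b bs = 0" using b(1) False by (fastforce simp: cochain_def)
    then show ?thesis using False by (simp add: unit_cochain_def)
  qed (simp add: g_def unit_cochain_def)
  then have "b = (\<lambda>t. g * unit_cochain (length xs) t)" by blast
  then have "koszul xs b bs = deg_one xs (\<lambda>x. g * x) bs" for bs
    by (simp add: koszul_scale koszul_unit_cochain deg_one_scale)
  then have "deg_one xs (\<lambda>x. \<phi> x - g * x) bs \<in> J" for bs
    using b(2)[of bs] by (simp add: deg_one_diff)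
  then have "\<phi> x - x * g \<in> J" if "x \<in> set xs" for x
    using deg_one_inD[of xs "\<lambda>x. \<phi> x - g * x", OF _ that] by (simp add: mult.commute)
  moreover have "g \<in> C" using b(1) by (simp add: g_def cochain_def)
  ultimately show ?thesis using that by blast
qed

end

section \<open>Ideals of quotients\<close>

text \<open>Membership in ideals of a quotient ring is pulled back to the ring itself, where all computations take place.\<close>

lemma (in cring) rcos_mem_genideal_iff:
  assumes I: "ideal I R" and A: "A \<subseteq> carrier R" and f: "f \<in> carrier R"
  shows "I +> f \<in> Idl\<^bsub>R Quot I\<^esub> ((+>) I ` A) \<longleftrightarrow> f \<in> Idl (I \<union> A)"
proof -
  let ?Q = "R Quot I" and ?q = "(+>) I"
  interpret I: ideal I R by fact
  interpret Q: cring ?Q by (rule I.quotient_is_cring) (rule is_cring)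
  interpret h: ring_hom_ring R ?Q ?q by (rule I.rcos_ring_hom_ring)
  have sub: "I \<union> A \<subseteq> carrier R" using A I.a_subset by blast
  have qA: "?q ` A \<subseteq> carrier ?Q" using A by auto
  show ?thesis
  proof
    assume "f \<in> Idl (I \<union> A)"
    moreover have "Idl (I \<union> A) \<subseteq> {r \<in> carrier R. ?q r \<in> Idl\<^bsub>?Q\<^esub> (?q ` A)}"
    proof (rule genideal_minimal)
      show "ideal {r \<in> carrier R. ?q r \<in> Idl\<^bsub>?Q\<^esub> (?q ` A)} R"
        by (intro h.ideal_vimage Q.genideal_ideal qA)
      have "?q i \<in> Idl\<^bsub>?Q\<^esub> (?q ` A)" if "i \<in> I" for i
      proof -
        have "?q i = \<zero>\<^bsub>?Q\<^esub>" unfolding FactRing_def by (simp only: I.a_rcos_const[OF that] ring.simps)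
        then show ?thesis
          using additive_subgroup.zero_closed[OF ideal.axioms(1)[OF Q.genideal_ideal[OF qA]]] by simp
      qed
      then show "I \<union> A \<subseteq> {r \<in> carrier R. ?q r \<in> Idl\<^bsub>?Q\<^esub> (?q ` A)}"
        using sub Q.genideal_self[OF qA] by auto
    qed
    ultimately show "?q f \<in> Idl\<^bsub>?Q\<^esub> (?q ` A)" by blast
  next
    assume mem: "?q f \<in> Idl\<^bsub>?Q\<^esub> (?q ` A)"
    let ?K = "Idl (I \<union> A)"
    interpret K: ideal ?K R by (rule genideal_ideal[OF sub])
    have "Idl\<^bsub>?Q\<^esub> (?q ` A) \<subseteq> ?q ` ?K"
      using genideal_self[OF sub] by (intro Q.genideal_minimal ring_ideal_imp_quot_ideal I K.ideal_axioms) auto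
    then obtain k where k: "k \<in> ?K" "?q f = ?q k" using mem by blast
    have kc: "k \<in> carrier R" using k(1) K.a_subset by blast
    from k(2) have "f \<ominus> k \<in> I"
      using quotient_eq_iff_same_a_r_cos[OF I f kc] by simp
    then have "f \<ominus> k \<in> ?K" using genideal_self[OF sub] by blast
    then have "(f \<ominus> k) \<oplus> k \<in> ?K" using k(1) by blast
    moreover have "(f \<ominus> k) \<oplus> k = f" using f kc by algebra
    ultimately show "f \<in> ?K" by simp
  qed
qed

lemma (in cring) quot_carrier: "carrier (R Quot I) = (+>) I ` carrier R"
  by (auto simp: FactRing_def A_RCOSETS_def')

lemma (in cring) regular_sequence_quot_iff:
  assumes I: "ideal I R" and fs: "set fs \<subseteq> carrier R"
  shows "regular_sequence (R Quot I) (map ((+>) I) fs) \<longleftrightarrow>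
    (\<forall>i<length fs. \<forall>r\<in>carrier R. fs ! i \<otimes> r \<in> Idl (I \<union> set (take i fs)) \<longrightarrow>
        r \<in> Idl (I \<union> set (take i fs))) \<and> Idl (I \<union> set fs) \<noteq> carrier R"
proof -
  let ?Q = "R Quot I" and ?q = "(+>) I"
  interpret I: ideal I R by fact
  interpret Q: cring ?Q by (rule I.quotient_is_cring) (rule is_cring)
  interpret h: ring_hom_ring R ?Q ?q by (rule I.rcos_ring_hom_ring)
  have t: "set (take i fs) \<subseteq> carrier R" for i using fs set_take_subset[of i fs] by blast
  have "Idl\<^bsub>?Q\<^esub> (?q ` set fs) \<noteq> carrier ?Q \<longleftrightarrow> Idl (I \<union> set fs) \<noteq> carrier R"
  proof -
    have sub: "I \<union> set fs \<subseteq> carrier R" using fs I.a_subset by blast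
    have "?q ` set fs \<subseteq> carrier ?Q" using fs by auto
    from Q.genideal_ideal[OF this] have "Idl\<^bsub>?Q\<^esub> (?q ` set fs) = carrier ?Q \<longleftrightarrow> \<one>\<^bsub>?Q\<^esub> \<in> Idl\<^bsub>?Q\<^esub> (?q ` set fs)"
      using ideal.one_imp_carrier by fastforce
    also have "\<dots> \<longleftrightarrow> \<one> \<in> Idl (I \<union> set fs)"
      using rcos_mem_genideal_iff[OF I fs one_closed] h.hom_one by simp
    also have "\<dots> \<longleftrightarrow> Idl (I \<union> set fs) = carrier R"
      using ideal.one_imp_carrier[OF genideal_ideal[OF sub]] by fastforce
    finally show ?thesis by simp
  qed
  moreover have "(\<forall>r\<in>carrier ?Q. map ?q fs ! i \<otimes>\<^bsub>?Q\<^esub> r \<in> Idl\<^bsub>?Q\<^esub> (set (take i (map ?q fs))) \<longrightarrow>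
        r \<in> Idl\<^bsub>?Q\<^esub> (set (take i (map ?q fs)))) \<longleftrightarrow>
     (\<forall>r\<in>carrier R. fs ! i \<otimes> r \<in> Idl (I \<union> set (take i fs)) \<longrightarrow>
        r \<in> Idl (I \<union> set (take i fs)))" if "i < length fs" for i
  proof -
    have fi: "fs ! i \<in> carrier R" using that fs by auto
    have "map ?q fs ! i \<otimes>\<^bsub>?Q\<^esub> ?q r \<in> Idl\<^bsub>?Q\<^esub> (set (take i (map ?q fs))) \<longleftrightarrow>
        fs ! i \<otimes> r \<in> Idl (I \<union> set (take i fs))" if r: "r \<in> carrier R" for r
      using rcos_mem_genideal_iff[OF I t[of i], of "fs ! i \<otimes> r"] fi r \<open>i < length fs\<close>
      by (simp add: take_map)
    moreover have "?q r \<in> Idl\<^bsub>?Q\<^esub> (set (take i (map ?q fs))) \<longleftrightarrow> r \<in> Idl (I \<union> set (take i fs))"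
      if r: "r \<in> carrier R" for r
      using rcos_mem_genideal_iff[OF I t[of i] r] by (simp add: take_map)
    ultimately show ?thesis unfolding quot_carrier by auto
  qed
  ultimately show ?thesis unfolding regular_sequence_def using fs by (auto simp: quot_carrier)
qed

section \<open>Polynomials and monomial ideals\<close>

abbreviation keys :: "('a \<Rightarrow>\<^sub>0 'b::zero) \<Rightarrow> 'a set" where
  "keys \<equiv> Poly_Mapping.keys"

abbreviation lookup :: "('a \<Rightarrow>\<^sub>0 'b::zero) \<Rightarrow> 'a \<Rightarrow> 'b" where
  "lookup \<equiv> Poly_Mapping.lookup"

abbreviation polys :: "'v set \<Rightarrow> ('v, 'k::field) mpoly set" where
  "polys V \<equiv> carrier (poly_ring V)"

lemma polys_iff: "f \<in> polys V \<longleftrightarrow> (\<forall>m\<in>keys f. keys m \<subseteq> V)"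
  by (simp add: poly_ring_def)

lemma poly_ring_simps [simp]:
  "x \<otimes>\<^bsub>poly_ring V\<^esub> y = x * y" "x \<oplus>\<^bsub>poly_ring V\<^esub> y = x + y" "\<one>\<^bsub>poly_ring V\<^esub> = 1" "\<zero>\<^bsub>poly_ring V\<^esub> = 0"
  by (simp_all add: poly_ring_def)

lemma polys_closed:
  fixes f g :: "('v, 'k::field) mpoly"
  shows "f \<in> polys V \<Longrightarrow> g \<in> polys V \<Longrightarrow> f + g \<in> polys V"
    and "f \<in> polys V \<Longrightarrow> g \<in> polys V \<Longrightarrow> f * g \<in> polys V"
    and "(1 :: ('v, 'k::field) mpoly) \<in> polys V" and "(0 :: ('v, 'k::field) mpoly) \<in> polys V"
    and "f \<in> polys V \<Longrightarrow> - f \<in> polys V"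
proof -
  interpret cring "poly_ring V :: ('v, 'k) mpoly ring" by (rule cring_poly_ring)
  show "f \<in> polys V \<Longrightarrow> g \<in> polys V \<Longrightarrow> f + g \<in> polys V" using a_closed[of f g] by simp
  show "f \<in> polys V \<Longrightarrow> g \<in> polys V \<Longrightarrow> f * g \<in> polys V" using m_closed[of f g] by simp
  show "(1 :: ('v, 'k::field) mpoly) \<in> polys V" using one_closed by simp
  show "(0 :: ('v, 'k::field) mpoly) \<in> polys V" using zero_closed by simp
  show "f \<in> polys V \<Longrightarrow> - f \<in> polys V" by (simp add: polys_iff)
qed

lemma a_inv_poly_ring:
  fixes f :: "('v, 'k::field) mpoly"
  assumes "f \<in> polys V" shows "\<ominus>\<^bsub>poly_ring V\<^esub> f = - f"
proof -
  interpret cring "poly_ring V :: ('v, 'k) mpoly ring" by (rule cring_poly_ring)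
  show ?thesis using minus_equality[of "- f" f] polys_closed(5)[OF assms] assms by simp
qed

lemma ideal_imp_rel_ideal:
  fixes J :: "('v, 'k::field) mpoly set"
  assumes "ideal J (poly_ring V)"
  shows "rel_ideal (polys V) J"
proof -
  interpret ideal J "poly_ring V" by fact
  show ?thesis
    using polys_closed(1-3) polys_closed(5) a_subset I_l_closed
      additive_subgroup.zero_closed[OF ideal.axioms(1)[OF assms]]
      additive_subgroup.a_closed[OF ideal.axioms(1)[OF assms]]
    by unfold_locales auto
qed

lemma rel_ideal_imp_ideal:
  fixes J :: "('v, 'k::field) mpoly set"
  assumes "rel_ideal (polys V) J"
  shows "ideal J (poly_ring V)"
proof -
  interpret rel_ideal "polys V" J by fact
  interpret R: cring "poly_ring V :: ('v, 'k) mpoly ring" by (rule cring_poly_ring)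
  show ?thesis
  proof (rule idealI)
    show "subgroup J (add_monoid (poly_ring V))"
    proof (rule subgroup.intro)
      fix a assume "a \<in> J"
      then show "inv\<^bsub>add_monoid (poly_ring V)\<^esub> a \<in> J"
        using a_inv_poly_ring[of a V] J_sub uminus_J by (auto simp: a_inv_def)
    qed (use J_sub zero_J add_J in auto)
    fix a x :: "('v, 'k) mpoly" assume "a \<in> J" "x \<in> carrier (poly_ring V)"
    then have "x * a \<in> J" by (rule mult_J[rotated])
    then show "x \<otimes>\<^bsub>poly_ring V\<^esub> a \<in> J" "a \<otimes>\<^bsub>poly_ring V\<^esub> x \<in> J"
      by (simp_all add: mult.commute)
  qed (rule R.ring_axioms)
qed

lemma rel_ideal_genideal:
  fixes A :: "('v, 'k::field) mpoly set"
  assumes "A \<subseteq> polys V"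
  shows "rel_ideal (polys V) (Idl\<^bsub>poly_ring V\<^esub> A)"
proof -
  interpret cring "poly_ring V :: ('v, 'k) mpoly ring" by (rule cring_poly_ring)
  show ?thesis by (intro ideal_imp_rel_ideal genideal_ideal assms)
qed

lemma genideal_subset_rel_ideal:
  fixes A :: "('v, 'k::field) mpoly set"
  assumes "rel_ideal (polys V) J" "A \<subseteq> J"
  shows "Idl\<^bsub>poly_ring V\<^esub> A \<subseteq> J"
proof -
  interpret cring "poly_ring V :: ('v, 'k) mpoly ring" by (rule cring_poly_ring)
  show ?thesis by (intro genideal_minimal rel_ideal_imp_ideal assms)
qed

lemma subset_genideal:
  fixes A :: "('v, 'k::field) mpoly set"
  assumes "A \<subseteq> polys V"
  shows "A \<subseteq> Idl\<^bsub>poly_ring V\<^esub> A"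
proof -
  interpret cring "poly_ring V :: ('v, 'k) mpoly ring" by (rule cring_poly_ring)
  show ?thesis by (intro genideal_self assms)
qed

lemma genideal_insert_decomp:
  fixes A :: "('v, 'k::field) mpoly set"
  assumes A: "A \<subseteq> polys V" and a: "a \<in> polys V" and f: "f \<in> Idl\<^bsub>poly_ring V\<^esub> (insert a A)"
  shows "\<exists>j\<in>Idl\<^bsub>poly_ring V\<^esub> A. \<exists>r\<in>polys V. f = j + a * r"
proof -
  let ?J = "Idl\<^bsub>poly_ring V\<^esub> A"
  interpret J: rel_ideal "polys V" ?J by (rule rel_ideal_genideal[OF A])
  let ?S = "{f. \<exists>j\<in>?J. \<exists>r\<in>polys V. f = j + a * r}"
  have "rel_ideal (polys V) ?S"
  proof
    show "?S \<subseteq> polys V" using J.J_sub a polys_closed by blast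
    show "0 \<in> ?S" using J.zero_J J.zero_C by force
    fix x y assume x: "x \<in> ?S" and y: "y \<in> ?S"
    then obtain j r j' r' where "x = j + a * r" "y = j' + a * r'" "j \<in> ?J" "j' \<in> ?J" "r \<in> polys V" "r' \<in> polys V"
      by blast
    then have "x + y = (j + j') + a * (r + r')" "j + j' \<in> ?J" "r + r' \<in> polys V"
      by (auto simp: algebra_simps J.add_J J.add_C)
    then show "x + y \<in> ?S" by blast
  next
    fix x y :: "('v, 'k) mpoly" assume x: "x \<in> polys V" and y: "y \<in> ?S"
    then obtain j r where "y = j + a * r" "j \<in> ?J" "r \<in> polys V" by blast
    then have "x * y = x * j + a * (x * r)" "x * j \<in> ?J" "x * r \<in> polys V"
      using J.mult_J[OF x] J.mult_C[OF x] by (auto simp: algebra_simps)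
    then show "x * y \<in> ?S" by blast
  qed (use J.one_C J.add_C J.mult_C J.uminus_C in auto)
  moreover have "insert a A \<subseteq> ?S"
  proof -
    have "a = 0 + a * 1" by simp
    then have "a \<in> ?S" using J.zero_J J.one_C by blast
    moreover have "x = x + a * 0" for x by simp
    then have "A \<subseteq> ?S" using subset_genideal[OF A] J.zero_C by blast
    ultimately show ?thesis by blast
  qed
  ultimately show ?thesis using genideal_subset_rel_ideal f by blast
qed

subsection \<open>Coefficients\<close>

lemma lookup_single_mult_add:
  fixes f :: "('v, 'k::field) mpoly"
  shows "lookup (Poly_Mapping.single a c * f) (a + m) = c * lookup f m"
proof -
  have "lookup (Poly_Mapping.single a c * f) (a + m) =
    (\<Sum>l. (c when a = l) * (\<Sum>q. lookup f q when a + m = l + q))"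
    by (simp add: lookup_mult lookup_single)
  also have "\<dots> = (\<Sum>l. (c * (\<Sum>q. lookup f q when a + m = l + q)) when a = l)"
    by (simp add: when_mult)
  also have "\<dots> = c * (\<Sum>q. lookup f q when m = q)" by simp
  finally show ?thesis by simp
qed

lemma lookup_single_mult_eq_0:
  fixes f :: "('v, 'k::field) mpoly"
  assumes "\<And>m. b \<noteq> a + m"
  shows "lookup (Poly_Mapping.single a c * f) b = 0"
proof (rule ccontr)
  assume "\<not> ?thesis"
  then have "b \<in> keys (Poly_Mapping.single a c * f)" by (simp add: in_keys_iff)
  then obtain x y where "b = x + y" "x \<in> keys (Poly_Mapping.single a c)" 
    using keys_mult[of "Poly_Mapping.single a c" f] by blast
  then show False using assms by (auto split: if_splits)
qed

lemma poly_eq_sum_single: "f = (\<Sum>m\<in>keys f. Poly_Mapping.single m (lookup f m))"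
proof (rule poly_mapping_eqI)
  fix k
  have "lookup (\<Sum>m\<in>keys f. Poly_Mapping.single m (lookup f m)) k = (\<Sum>m\<in>keys f. if m = k then lookup f m else 0)"
    by (auto simp: lookup_sum lookup_single when_def)
  then show "lookup f k = lookup (\<Sum>m\<in>keys f. Poly_Mapping.single m (lookup f m)) k"
    by (simp add: in_keys_iff)
qed

lemma monomial_split:
  fixes m :: "'v \<Rightarrow>\<^sub>0 nat"
  assumes "v \<in> keys m" shows "m = Poly_Mapping.single v 1 + (m - Poly_Mapping.single v 1)"
  using assms by (intro poly_mapping_eqI) (auto simp: lookup_add lookup_minus lookup_single when_def in_keys_iff)

lemma keys_monomial_add: "keys (m + m') = keys m \<union> keys (m' :: 'v \<Rightarrow>\<^sub>0 nat)"
  by (auto simp: in_keys_iff lookup_add)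

lemma finite_monomial_induct [case_names zero add]:
  fixes m :: "'v \<Rightarrow>\<^sub>0 nat"
  assumes "P 0" "\<And>v m. P m \<Longrightarrow> P (Poly_Mapping.single v 1 + m)"
  shows "P m"
proof (induction "\<Sum>v\<in>keys m. lookup m v" arbitrary: m rule: less_induct)
  case less
  show ?case
  proof (cases "m = 0")
    case False
    then obtain v where v: "v \<in> keys m" by (metis keys_eq_empty ex_in_conv poly_mapping_eqI lookup_zero in_keys_iff)
    let ?m' = "m - Poly_Mapping.single v 1"
    have sub: "keys ?m' \<subseteq> keys m" by (auto simp: in_keys_iff lookup_minus)
    have "(\<Sum>v\<in>keys ?m'. lookup ?m' v) = (\<Sum>v\<in>keys m. lookup ?m' v)"
      by (rule sum.mono_neutral_left) (use sub in \<open>auto simp: in_keys_iff\<close>)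
    also have "\<dots> < (\<Sum>v\<in>keys m. lookup m v)"
      using v by (intro sum_strict_mono_ex1) (auto simp: lookup_minus lookup_single in_keys_iff intro!: bexI[of _ v])
    finally show ?thesis using less assms(2)[of ?m' v] monomial_split[OF v] by simp
  qed (use assms(1) in simp)
qed

lemma poly_induct [consumes 1, case_names const var add mult]:
  fixes f :: "('v, 'k::field) mpoly"
  assumes f: "f \<in> polys V"
    and const: "\<And>c. P (Poly_Mapping.single 0 c)" and var: "\<And>v. v \<in> V \<Longrightarrow> P (var v)"
    and add: "\<And>f g. P f \<Longrightarrow> P g \<Longrightarrow> P (f + g)" and mult: "\<And>f g. P f \<Longrightarrow> P g \<Longrightarrow> P (f * g)"
  shows "P f"
proof -
  have single: "keys m \<subseteq> V \<Longrightarrow> P (Poly_Mapping.single m c)" for m c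
  proof (induction m rule: finite_monomial_induct)
    case zero show ?case by (rule const)
  next
    case (add v m)
    have "Poly_Mapping.single (Poly_Mapping.single v 1 + m) c = var v * Poly_Mapping.single m c"
      by (simp add: var_def mult_single)
    moreover have "v \<in> V" "keys m \<subseteq> V" using add.prems by (auto simp: keys_monomial_add)
    ultimately show ?case using add.IH var mult by simp
  qed
  have "finite A \<Longrightarrow> A \<subseteq> keys f \<Longrightarrow> P (\<Sum>m\<in>A. Poly_Mapping.single m (lookup f m))" for A
  proof (induction A rule: finite_induct)
    case empty then show ?case using const[of 0] by simp
  next
    case (insert m A) then show ?case using f by (auto intro!: add single simp: polys_iff)
  qed
  from this[of "keys f"] show ?thesis using poly_eq_sum_single[of f] by simp
qed

subsection \<open>Monomial ideals\<close>

text \<open>A monomial ideal is given by a predicate \<open>D\<close> on monomials that is stable under multiplication; membership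
of a polynomial is decided monomial by monomial.\<close>

definition upward_closed :: "(('v \<Rightarrow>\<^sub>0 nat) \<Rightarrow> bool) \<Rightarrow> bool" where
  "upward_closed D \<longleftrightarrow> (\<forall>m n. D m \<longrightarrow> D (n + m))"

definition monomial_ideal :: "'v set \<Rightarrow> (('v \<Rightarrow>\<^sub>0 nat) \<Rightarrow> bool) \<Rightarrow> ('v, 'k::field) mpoly set" where
  "monomial_ideal V D = {f \<in> polys V. \<forall>m\<in>keys f. D m}"

lemma rel_ideal_monomial_ideal:
  assumes "upward_closed D"
  shows "rel_ideal (polys V) (monomial_ideal V D :: ('v, 'k::field) mpoly set)"
proof
  fix a b :: "('v, 'k) mpoly" assume "a \<in> polys V" and b: "b \<in> monomial_ideal V D"
  moreover have "D m" if "m \<in> keys (a * b)" for m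
    using keys_mult[of a b] that b assms by (fastforce simp: monomial_ideal_def upward_closed_def)
  ultimately show "a * b \<in> monomial_ideal V D" by (simp add: monomial_ideal_def polys_closed)
next
  fix a b :: "('v, 'k) mpoly" assume "a \<in> monomial_ideal V D" "b \<in> monomial_ideal V D"
  then show "a + b \<in> monomial_ideal V D"
    using Poly_Mapping.keys_add[of a b] by (auto simp: monomial_ideal_def polys_closed)
qed (auto simp: monomial_ideal_def polys_closed)

lemma monomial_ideal_subset:
  fixes J :: "('v, 'k::field) mpoly set"
  assumes J: "rel_ideal (polys V) J"
    and gen: "\<And>m. keys m \<subseteq> V \<Longrightarrow> D m \<Longrightarrow>
      \<exists>a b. m = a + b \<and> Poly_Mapping.single b 1 \<in> J"
  shows "monomial_ideal V D \<subseteq> J"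
proof
  interpret rel_ideal "polys V" J by fact
  fix f :: "('v, 'k) mpoly" assume f: "f \<in> monomial_ideal V D"
  have "Poly_Mapping.single m c \<in> J" if m: "m \<in> keys f" for m c
  proof -
    from f m have "keys m \<subseteq> V" "D m" by (auto simp: monomial_ideal_def polys_iff)
    with gen obtain a b where ab: "m = a + b" "Poly_Mapping.single b 1 \<in> J" by metis
    have "Poly_Mapping.single m c = Poly_Mapping.single a c * Poly_Mapping.single b 1"
      by (simp add: mult_single ab)
    moreover have "Poly_Mapping.single a c \<in> polys V"
      using \<open>keys m \<subseteq> V\<close> ab(1) by (auto simp: polys_iff keys_monomial_add split: if_splits)
    ultimately show ?thesis using mult_J ab(2) by simp
  qed
  then have "(\<Sum>m\<in>keys f. Poly_Mapping.single m (lookup f m)) \<in> J" by (intro sum_J)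
  then show "f \<in> J" using poly_eq_sum_single[of f] by simp
qed

lemma var_mult_eq_single:
  "var u * var v = Poly_Mapping.single (Poly_Mapping.single u 1 + Poly_Mapping.single v 1) 1"
  by (simp add: var_def mult_single)

definition edge_monomial :: "'v ugraph \<Rightarrow> ('v \<Rightarrow>\<^sub>0 nat) \<Rightarrow> bool" where
  "edge_monomial H m \<longleftrightarrow> (\<exists>u v. {u, v} \<in> edges H \<and> u \<in> keys m \<and> v \<in> keys m)"

lemma upward_closed_edge_monomial: "upward_closed (edge_monomial H)"
  by (auto simp: upward_closed_def edge_monomial_def keys_monomial_add)

lemma simple_graphD:
  assumes "simple_graph H" "{u, v} \<in> edges H"
  shows "u \<noteq> v" "u \<in> verts H" "v \<in> verts H" "{v, u} \<in> edges H"
proof -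
  have "card {u, v} = 2" "{u, v} \<subseteq> verts H" using assms by (auto simp: simple_graph_def)
  then show "u \<noteq> v" "u \<in> verts H" "v \<in> verts H" by (auto simp: card_insert_if split: if_splits)
  show "{v, u} \<in> edges H" using assms(2) by (simp add: insert_commute)
qed

lemma edge_generators_in_polys:
  assumes "simple_graph H"
  shows "{var u * var v | u v. {u, v} \<in> edges H} \<subseteq> (polys (verts H) :: ('v, 'k::field) mpoly set)"
  using simple_graphD[OF assms] by (auto intro!: polys_closed var_in_poly_ring)

lemma edge_ideal_eq:
  assumes "simple_graph H"
  shows "(edge_ideal H :: ('v, 'k::field) mpoly set) = monomial_ideal (verts H) (edge_monomial H)"
proof
  let ?G = "{var u * var v | u v. {u, v} \<in> edges H} :: ('v, 'k) mpoly set"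
  have G: "?G \<subseteq> polys (verts H)" by (rule edge_generators_in_polys[OF assms])
  show "(edge_ideal H :: ('v, 'k::field) mpoly set) \<subseteq> monomial_ideal (verts H) (edge_monomial H)"
    unfolding edge_ideal_def
  proof (rule genideal_subset_rel_ideal[OF rel_ideal_monomial_ideal[OF upward_closed_edge_monomial]])
    show "?G \<subseteq> monomial_ideal (verts H) (edge_monomial H)"
    proof
      fix f :: "('v, 'k) mpoly" assume "f \<in> ?G"
      then obtain u v where uv: "f = var u * var v" "{u, v} \<in> edges H" and "f \<in> polys (verts H)"
        using G by blast
      then have "keys f = {Poly_Mapping.single u 1 + Poly_Mapping.single v 1}"
        by (simp add: var_mult_eq_single)
      moreover have "edge_monomial H (Poly_Mapping.single u 1 + Poly_Mapping.single v 1)"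
        unfolding edge_monomial_def using uv(2)
        by (intro exI[of _ u] exI[of _ v]) (simp add: keys_monomial_add)
      ultimately show "f \<in> monomial_ideal (verts H) (edge_monomial H)"
        using \<open>f \<in> polys (verts H)\<close> by (simp add: monomial_ideal_def)
    qed
  qed
  show "monomial_ideal (verts H) (edge_monomial H) \<subseteq> (edge_ideal H :: ('v, 'k) mpoly set)"
    unfolding edge_ideal_def
  proof (rule monomial_ideal_subset[OF rel_ideal_genideal[OF G]])
    fix m assume "edge_monomial H m"
    then obtain u v where uv: "{u, v} \<in> edges H" "u \<in> keys m" "v \<in> keys m"
      unfolding edge_monomial_def by blast
    let ?b = "Poly_Mapping.single u 1 + Poly_Mapping.single v (1 :: nat)"
    have "m = (m - ?b) + ?b"
      using uv simple_graphD(1)[OF assms uv(1)]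
      by (intro poly_mapping_eqI) (auto simp: lookup_add lookup_minus lookup_single when_def in_keys_iff)
    moreover have "Poly_Mapping.single ?b 1 \<in> Idl\<^bsub>poly_ring (verts H)\<^esub> ?G"
      unfolding var_mult_eq_single[symmetric] using subset_genideal[OF G] uv(1) by blast
    ultimately show "\<exists>a b. m = a + b \<and> Poly_Mapping.single b 1 \<in> Idl\<^bsub>poly_ring (verts H)\<^esub> ?G" by blast
  qed
qed

lemma monomial_mem_edge_ideal_iff:
  assumes "simple_graph H"
  shows "Poly_Mapping.single m 1 \<in> (edge_ideal H :: ('v, 'k::field) mpoly set) \<longleftrightarrow>
    keys m \<subseteq> verts H \<and> edge_monomial H m"
  by (simp add: edge_ideal_eq[OF assms] monomial_ideal_def polys_iff)

lemma genideal_vars: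
  assumes "W \<subseteq> V"
  shows "Idl\<^bsub>poly_ring V\<^esub> (var ` W) =
    (monomial_ideal V (\<lambda>m. keys m \<inter> W \<noteq> {}) :: ('v, 'k::field) mpoly set)"
proof
  have W: "var ` W \<subseteq> (polys V :: ('v, 'k::field) mpoly set)" using assms by (auto intro: var_in_poly_ring)
  have up: "upward_closed (\<lambda>m. keys m \<inter> W \<noteq> {})" by (auto simp: upward_closed_def keys_monomial_add)
  show "Idl\<^bsub>poly_ring V\<^esub> (var ` W) \<subseteq> (monomial_ideal V (\<lambda>m. keys m \<inter> W \<noteq> {}) :: ('v, 'k::field) mpoly set)"
    by (rule genideal_subset_rel_ideal[OF rel_ideal_monomial_ideal[OF up]])
      (use W in \<open>auto simp: monomial_ideal_def var_def\<close>)
  show "monomial_ideal V (\<lambda>m. keys m \<inter> W \<noteq> {}) \<subseteq> (Idl\<^bsub>poly_ring V\<^esub> (var ` W) :: ('v, 'k::field) mpoly set)"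
  proof (rule monomial_ideal_subset[OF rel_ideal_genideal[OF W]])
    fix m :: "'v \<Rightarrow>\<^sub>0 nat" assume "keys m \<inter> W \<noteq> {}"
    then obtain v where v: "v \<in> keys m" "v \<in> W" by blast
    then have "m = (m - Poly_Mapping.single v 1) + Poly_Mapping.single v 1"
      using monomial_split[OF v(1)] by (simp add: add.commute)
    moreover have "Poly_Mapping.single (Poly_Mapping.single v 1) 1 \<in> (Idl\<^bsub>poly_ring V\<^esub> (var ` W) :: ('v, 'k::field) mpoly set)"
      using subset_genideal[OF W] v(2) by (force simp: var_def)
    ultimately show "\<exists>a b. m = a + b \<and> Poly_Mapping.single b 1 \<in> (Idl\<^bsub>poly_ring V\<^esub> (var ` W) :: ('v, 'k::field) mpoly set)"
      by blast
  qed
qed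

section \<open>Upper bounds for the depth\<close>

text \<open>The sum of the terms of \<open>f\<close> in which \<open>x\<close> has exponent \<open>e\<close>, that is, a homogeneous component for the grading by
the exponent of \<open>x\<close>. The graded Nakayama argument below uses it for the variable that is being dropped.\<close>

definition exponent_part :: "'v \<Rightarrow> nat \<Rightarrow> ('v, 'k::field) mpoly \<Rightarrow> ('v, 'k) mpoly" where
  "exponent_part x e f = (\<Sum>m\<in>{m \<in> keys f. lookup m x = e}. Poly_Mapping.single m (lookup f m))"

lemma lookup_exponent_part: "lookup (exponent_part x e f) m = (if lookup m x = e then lookup f m else 0)"
proof -
  have "lookup (exponent_part x e f) m =
      (\<Sum>m'\<in>{m \<in> keys f. lookup m x = e}. if m' = m then lookup f m' else 0)"
    by (auto simp: exponent_part_def lookup_sum lookup_single when_def)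
  then show ?thesis by (auto simp: in_keys_iff)
qed

lemma exponent_part_diff: "exponent_part x e (f - g) = exponent_part x e f - exponent_part x e g"
  by (rule poly_mapping_eqI) (simp add: lookup_exponent_part lookup_minus)

lemma exponent_part_add: "exponent_part x e (f + g) = exponent_part x e f + exponent_part x e g"
  by (rule poly_mapping_eqI) (simp add: lookup_exponent_part lookup_add)

lemma exponent_part_zero [simp]: "exponent_part x e 0 = 0"
  by (rule poly_mapping_eqI) (simp add: lookup_exponent_part)

lemma lookup_monomial_add: "lookup (Poly_Mapping.single y 1 + m) x = (if x = y then 1 else 0) + lookup m x"
  by (simp add: lookup_add lookup_single when_def)

lemma exponent_part_var_mult:
  "exponent_part x e (var y * f) =
    (if x \<noteq> y then var y * exponent_part x e f
     else if e = 0 then 0 else var y * exponent_part x (e - 1) f)"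
proof (rule poly_mapping_eqI)
  fix b
  show "lookup (exponent_part x e (var y * f)) b = lookup (if x \<noteq> y then var y * exponent_part x e f
     else if e = 0 then 0 else var y * exponent_part x (e - 1) f) b"
  proof (cases "\<exists>m. b = Poly_Mapping.single y 1 + m")
    case True
    then obtain m where b: "b = Poly_Mapping.single y 1 + m" by blast
    show ?thesis
      by (cases e) (auto simp: b var_def lookup_exponent_part lookup_single_mult_add lookup_monomial_add
        simp del: One_nat_def)
  next
    case False
    then show ?thesis
      by (auto simp: var_def lookup_exponent_part lookup_single_mult_eq_0)
  qed
qed

lemma keys_exponent_part: "keys (exponent_part x e f) \<subseteq> keys f"
  by (auto simp: in_keys_iff lookup_exponent_part split: if_splits)

lemma exponent_part_in_polys: "f \<in> polys V \<Longrightarrow> exponent_part x e f \<in> polys V"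
  using keys_exponent_part[of x e f] by (auto simp: polys_iff)

lemma exponent_part_in_monomial_ideal:
  "f \<in> monomial_ideal V D \<Longrightarrow> exponent_part x e f \<in> monomial_ideal V D"
  using keys_exponent_part[of x e f] exponent_part_in_polys[of f V x e] by (auto simp: monomial_ideal_def)

lemma sum_exponent_part:
  assumes "\<And>m. m \<in> keys f \<Longrightarrow> lookup m x \<le> N"
  shows "(\<Sum>e\<le>N. exponent_part x e f) = f"
proof (rule poly_mapping_eqI)
  fix m
  have "lookup (\<Sum>e\<le>N. exponent_part x e f) m = (\<Sum>e\<le>N. if lookup m x = e then lookup f m else 0)"
    by (simp add: lookup_sum lookup_exponent_part)
  also have "\<dots> = lookup f m" using assms[of m] by (auto simp: in_keys_iff)
  finally show "lookup (\<Sum>e\<le>N. exponent_part x e f) m = lookup f m" .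
qed

lemma koszul_exponent_part:
  assumes "x \<notin> set ws"
  shows "koszul (map var ws) (\<lambda>t. exponent_part x e (c t)) bs = exponent_part x e (koszul (map var ws) c bs)"
  using assms
proof (induction "map var ws :: ('a, 'b) mpoly list" c bs arbitrary: ws rule: koszul.induct)
  case (1 y ys c bs)
  then show ?case by (auto simp: Cons_eq_map_conv)
next
  case (2 y ys c bs)
  then show ?case by (auto simp: Cons_eq_map_conv exponent_part_diff exponent_part_var_mult)
next
  case (3 c bs) then show ?case by simp
next
  case (4 y ys c) then show ?case by (auto simp: Cons_eq_map_conv)
qed

text \<open>Vanishing in degree \<open>k + 1\<close> makes \<open>x\<close> surjective on the cohomology of \<open>ws\<close> in degree \<open>k\<close>. This cohomology
is graded by the exponent of \<open>x\<close>, because the ideal is monomial and \<open>x\<close> is not in \<open>ws\<close>, and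
multiplication by \<open>x\<close> raises this exponent by one. So a component of exponent 0 is zero and, inductively, all
components are zero.\<close>

lemma koszul_vanishes_drop_variable:
  fixes V :: "'v set" and D :: "('v \<Rightarrow>\<^sub>0 nat) \<Rightarrow> bool"
  defines "I \<equiv> monomial_ideal V D :: ('v, 'k::field) mpoly set"
  assumes D: "upward_closed D" and x: "x \<notin> set ws" and V: "x \<in> V" "set ws \<subseteq> V"
    and van: "koszul_vanishes (polys V) I (map var (x # ws)) (k + 1)"
  shows "koszul_vanishes (polys V) I (map var ws) k"
proof -
  let ?C = "polys V :: ('v, 'k) mpoly set" and ?xs = "map var ws :: ('v, 'k) mpoly list"
  interpret rel_ideal ?C I unfolding I_def by (rule rel_ideal_monomial_ideal[OF D])
  have xs: "set ?xs \<subseteq> ?C" using V by (auto intro: var_in_poly_ring)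
  have x_in: "var x \<in> ?C" using V by (auto intro: var_in_poly_ring)
  have van': "koszul_vanishes ?C I (var x # ?xs) (k + 1)" using van by simp
  define coboundary where "coboundary c \<longleftrightarrow> (\<exists>b. cochain ?C (length ?xs) (k - 1) b \<and>
      (\<forall>bs. c bs - koszul ?xs b bs \<in> I))" for c
  have part_cochain: "cochain ?C n l (\<lambda>t. exponent_part x e (c t))" if "cochain ?C n l c" for n l e c
    using that unfolding cochain_def by (metis exponent_part_in_polys exponent_part_zero)
  have part: "exponent_part x e f \<in> I" if "f \<in> I" for e f
    using that unfolding I_def by (rule exponent_part_in_monomial_ideal)
  have main: "coboundary (\<lambda>t. exponent_part x e (c t))"
    if "cochain ?C (length ?xs) k c" "\<And>bs. koszul ?xs c bs \<in> I" for e c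
    using that
  proof (induction e arbitrary: c)
    case 0
    obtain b0 b1 where b: "cochain ?C (length ?xs) (k - 1) b1"
      "\<And>bs. c bs - (var x * b0 bs - koszul ?xs b1 bs) \<in> I"
      by (rule koszul_surj_of_vanishes_Cons[OF van' 0]) blast
    have "exponent_part x 0 (c bs) - koszul ?xs (\<lambda>t. - exponent_part x 0 (b1 t)) bs \<in> I" for bs
      using part[OF b(2)[of bs], of 0]
      by (simp add: exponent_part_diff exponent_part_var_mult koszul_uminus koszul_exponent_part[OF x])
    moreover have "cochain ?C (length ?xs) (k - 1) (\<lambda>t. - exponent_part x 0 (b1 t))"
      using cochain_diff[OF cochain_zero[OF zero_C] part_cochain[OF b(1)]] by simp
    ultimately show ?case unfolding coboundary_def by blast
  next
    case (Suc e)
    obtain b0 b1 where b: "cochain ?C (length ?xs) k b0" "cochain ?C (length ?xs) (k - 1) b1"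
      "\<And>bs. koszul ?xs b0 bs \<in> I" "\<And>bs. c bs - (var x * b0 bs - koszul ?xs b1 bs) \<in> I"
      by (rule koszul_surj_of_vanishes_Cons[OF van' Suc.prems]) blast
    from Suc.IH[OF b(1,3)] obtain b2 where b2: "cochain ?C (length ?xs) (k - 1) b2"
      "\<And>bs. exponent_part x e (b0 bs) - koszul ?xs b2 bs \<in> I" unfolding coboundary_def by blast
    let ?b = "\<lambda>t. var x * b2 t - exponent_part x (Suc e) (b1 t)"
    have "exponent_part x (Suc e) (c bs) - koszul ?xs ?b bs \<in> I" for bs
    proof -
      have "exponent_part x (Suc e) (c bs) - koszul ?xs ?b bs =
          exponent_part x (Suc e) (c bs - (var x * b0 bs - koszul ?xs b1 bs))
          + var x * (exponent_part x e (b0 bs) - koszul ?xs b2 bs)"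
        by (simp add: exponent_part_diff exponent_part_add exponent_part_var_mult koszul_diff koszul_scale
            koszul_exponent_part[OF x] algebra_simps)
      then show ?thesis using part[OF b(4)] mult_J[OF x_in b2(2)] add_J by simp
    qed
    moreover have "cochain ?C (length ?xs) (k - 1) ?b"
      by (intro cochain_diff cochain_scale x_in b2(1) part_cochain b(2))
    ultimately show ?case unfolding coboundary_def by blast
  qed
  show ?thesis unfolding koszul_vanishes_def
  proof (intro allI impI, elim conjE)
    fix c assume c: "cochain ?C (length ?xs) k c" and z: "\<forall>bs. koszul ?xs c bs \<in> I"
    let ?E = "\<Union>bs\<in>{bs. length bs = length ?xs}. (\<lambda>m. lookup m x) ` keys (c bs)"
    have "finite {bs :: bool list. length bs = length ?xs}"
      using finite_lists_length_eq[of "UNIV :: bool set" "length ?xs"] by simp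
    then have fin: "finite ?E" by auto
    have N: "lookup m x \<le> Max ?E" if "m \<in> keys (c bs)" for m bs
    proof -
      have "c bs \<noteq> 0" using that by auto
      then have "length bs = length ?xs" using c by (auto simp: cochain_def)
      then show ?thesis using that fin by (intro Max_ge) auto
    qed
    have "\<exists>b. cochain ?C (length ?xs) (k - 1) b \<and>
        (\<forall>bs. exponent_part x e (c bs) - koszul ?xs b bs \<in> I)" for e
      using main[OF c, of e] z unfolding coboundary_def by blast
    then obtain b where b: "\<And>e. cochain ?C (length ?xs) (k - 1) (b e)"
      "\<And>e bs. exponent_part x e (c bs) - koszul ?xs (b e) bs \<in> I" by metis
    let ?b = "\<lambda>t. \<Sum>e\<le>Max ?E. b e t"
    have "c bs - koszul ?xs ?b bs = (\<Sum>e\<le>Max ?E. exponent_part x e (c bs) - koszul ?xs (b e) bs)" for bs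
      using sum_exponent_part[of "c bs" x "Max ?E"] N[of _ bs] by (simp add: sum_subtractf koszul_sum)
    then have "c bs - koszul ?xs ?b bs \<in> I" for bs using sum_J[OF b(2)] by simp
    moreover have "cochain ?C (length ?xs) (k - 1) ?b" using b(1) by (intro cochain_sum)
    ultimately show "\<exists>b. cochain ?C (length ?xs) (k - 1) b \<and> (\<forall>bs. c bs - koszul ?xs b bs \<in> I)" by blast
  qed
qed

lemma koszul_vanishes_drop_variables:
  fixes V :: "'v set" and D :: "('v \<Rightarrow>\<^sub>0 nat) \<Rightarrow> bool"
  defines "I \<equiv> monomial_ideal V D :: ('v, 'k::field) mpoly set"
  assumes D: "upward_closed D" and "distinct (fs @ ws)" "set (fs @ ws) \<subseteq> V"
    and "koszul_vanishes (polys V) I (map var (fs @ ws)) (k + int (length fs))"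
  shows "koszul_vanishes (polys V) I (map var ws) k"
  using assms(3-)
proof (induction fs)
  case Nil then show ?case by simp
next
  case (Cons f fs)
  have "koszul_vanishes (polys V) I (map var (fs @ ws)) (k + int (length fs))"
    unfolding I_def
    by (rule koszul_vanishes_drop_variable[OF D, of f])
      (use Cons.prems in \<open>auto simp: I_def algebra_simps\<close>)
  then show ?case using Cons by simp
qed

text \<open>The elements that act as zero on cohomology form an ideal, which contains the variables in the list.\<close>

lemma kills_maximal_ideal:
  fixes J I :: "('v, 'k::field) mpoly set"
  assumes J: "rel_ideal (polys V) J" and I: "I \<subseteq> J" and xs: "set xs = var ` V"
    and a: "a \<in> Idl\<^bsub>poly_ring V\<^esub> (I \<union> var ` V)"
  shows "rel_ideal.kills (polys V) J xs k a"
proof -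
  interpret rel_ideal "polys V" J by fact
  have xsC: "set xs \<subseteq> polys V" using xs by (auto intro: var_in_poly_ring)
  let ?S = "{a \<in> polys V. kills xs k a}"
  have "rel_ideal (polys V) ?S"
  proof (rule rel_ideal.intro)
    show "0 \<in> ?S" using kills_ideal_member[OF zero_J] zero_C by blast
    show "a + b \<in> ?S" if "a \<in> ?S" "b \<in> ?S" for a b using that kills_add add_C by blast
    show "a * b \<in> ?S" if "a \<in> polys V" "b \<in> ?S" for a b using that kills_mult mult_C by blast
  qed (blast intro: one_C add_C mult_C uminus_C)+
  moreover have "I \<union> var ` V \<subseteq> ?S"
    using I J_sub kills_ideal_member kills_member[OF _ xsC] xs xsC by auto
  ultimately show ?thesis using genideal_subset_rel_ideal a by blast
qed

text \<open>Induction on the number \<open>j\<close> of elements of the sequence that have not yet been divided out.\<close>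

lemma koszul_vanishes_of_regular_sequence:
  fixes I :: "('v, 'k::field) mpoly set"
  assumes I: "rel_ideal (polys V) I" and xs: "set xs = var ` V"
    and fs: "set fs \<subseteq> Idl\<^bsub>poly_ring V\<^esub> (I \<union> var ` V)"
    and reg: "\<And>i r. i < length fs \<Longrightarrow> r \<in> polys V \<Longrightarrow>
      fs ! i * r \<in> Idl\<^bsub>poly_ring V\<^esub> (I \<union> set (take i fs)) \<Longrightarrow> r \<in> Idl\<^bsub>poly_ring V\<^esub> (I \<union> set (take i fs))"
    and k: "k < int (length fs)"
  shows "koszul_vanishes (polys V) I xs k"
proof -
  interpret I: rel_ideal "polys V" I by fact
  have xsC: "set xs \<subseteq> polys V" using xs by (auto intro: var_in_poly_ring)
  have mC: "I \<union> var ` V \<subseteq> polys V" using I.J_sub by (auto intro: var_in_poly_ring)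
  have fsC: "set fs \<subseteq> polys V" using fs rel_ideal.J_sub[OF rel_ideal_genideal[OF mC]] by blast
  let ?J = "\<lambda>i. Idl\<^bsub>poly_ring V\<^esub> (I \<union> set (take i fs))"
  have sub: "I \<union> set (take i fs) \<subseteq> polys V" for i using I.J_sub fsC set_take_subset[of i fs] by blast
  have "koszul_vanishes (polys V) (?J (length fs - j)) xs k" if "j \<le> length fs" "k < int j" for j k
    using that
  proof (induction j arbitrary: k)
    case 0
    show ?case
      by (rule rel_ideal.koszul_vanishes_negative[OF rel_ideal_genideal[OF sub]]) (use 0 in simp)
  next
    case (Suc j)
    define i where "i = length fs - Suc j"
    have i: "i < length fs" "Suc i = length fs - j" using Suc.prems by (auto simp: i_def)
    have take: "I \<union> set (take (Suc i) fs) = insert (fs ! i) (I \<union> set (take i fs))"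
      using i(1) by (simp add: take_Suc_conv_app_nth)
    have fi: "fs ! i \<in> polys V" using i fsC by auto
    interpret Ji: rel_ideal "polys V" "?J i" by (rule rel_ideal_genideal[OF sub])
    have K: "rel_ideal (polys V) (?J (Suc i))" by (rule rel_ideal_genideal[OF sub])
    have subK: "I \<union> set (take (Suc i) fs) \<subseteq> ?J (Suc i)" by (rule subset_genideal[OF sub])
    have "koszul_vanishes (polys V) (?J i) xs k"
    proof (rule Ji.koszul_vanishes_of_regular[OF xsC _ fi, of k "?J (Suc i)"])
      show "Ji.kills xs k (fs ! i)"
        using fs i(1) subset_genideal[OF sub, of i]
        by (intro kills_maximal_ideal[OF Ji.rel_ideal_axioms _ xs, of I]) auto
      show "r \<in> ?J i" if "r \<in> polys V" "fs ! i * r \<in> ?J i" for r using reg i(1) that by blast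
      show "\<exists>j\<in>?J i. \<exists>r\<in>polys V. f = j + fs ! i * r" if "f \<in> ?J (Suc i)" for f
        using that unfolding take by (rule genideal_insert_decomp[OF sub fi])
      show "?J i \<subseteq> ?J (Suc i)"
        using subK take by (intro genideal_subset_rel_ideal[OF K]) auto
      show "fs ! i * f \<in> ?J (Suc i)" if "f \<in> polys V" for f
        using rel_ideal.mult_J[OF K that] subK take by (subst mult.commute) auto
      show "koszul_vanishes (polys V) (?J (Suc i)) xs (k - 1)"
        using Suc.IH[of "k - 1"] Suc.prems i(2) by simp
    qed (rule K)
    then show ?case by (simp add: i_def)
  qed
  from this[of "length fs"] have "koszul_vanishes (polys V) (Idl\<^bsub>poly_ring V\<^esub> I) xs k" using k by simp
  moreover have "Idl\<^bsub>poly_ring V\<^esub> I = I"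
    using genideal_subset_rel_ideal[OF I order_refl] subset_genideal[OF I.J_sub] by blast
  ultimately show ?thesis by simp
qed

text \<open>The form in which the two preceding arguments are used: start with all variables and drop those outside \<open>W\<close>, at
the price of one degree each.\<close>

lemma koszul_vanishes_edge_ideal:
  fixes xs :: "('v, 'k::field) mpoly set list"
  assumes H: "simple_graph H" and xs: "set xs \<subseteq> irrelevant_ideal H" "regular_sequence (edge_ring H) xs"
    and W: "W \<subseteq> verts H" "distinct ws" "set ws = W"
    and k: "k + int (card (verts H - W)) < int (length xs)"
  shows "koszul_vanishes (polys (verts H)) (edge_ideal H :: ('v, 'k) mpoly set) (map var ws) k"
proof -
  let ?V = "verts H" and ?I = "edge_ideal H :: ('v, 'k) mpoly set"
  interpret R: cring "poly_ring ?V :: ('v, 'k) mpoly ring" by (rule cring_poly_ring)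
  have I: "ideal ?I (poly_ring ?V)" by (rule ideal_edge_ideal[OF H])
  let ?q = "(+>\<^bsub>poly_ring ?V\<^esub>) ?I"
  have vars: "var ` ?V \<subseteq> (polys ?V :: ('v, 'k) mpoly set)" by (auto intro: var_in_poly_ring)
  have "set xs \<subseteq> carrier (edge_ring H)" using xs(2) by (simp add: regular_sequence_def)
  then have "set xs \<subseteq> ?q ` polys ?V" unfolding edge_ring_def R.quot_carrier .
  then have "\<forall>x\<in>set xs. \<exists>f. f \<in> polys ?V \<and> ?q f = x" by blast
  then obtain h where h: "\<forall>x\<in>set xs. h x \<in> polys ?V \<and> ?q (h x) = x" by (rule bchoice[THEN exE])
  define fs where "fs = map h xs"
  have fs: "xs = map ?q fs" "set fs \<subseteq> polys ?V"
    using h by (auto simp: fs_def map_idI)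
  have irr: "irrelevant_ideal H = Idl\<^bsub>poly_ring ?V Quot ?I\<^esub> (?q ` (var ` ?V))"
    by (simp add: irrelevant_ideal_def edge_ring_def image_image)
  have m: "f \<in> Idl\<^bsub>poly_ring ?V\<^esub> (?I \<union> var ` ?V)" if "f \<in> set fs" for f
  proof -
    have "?q f \<in> irrelevant_ideal H" using that xs(1) fs(1) by auto
    then show ?thesis unfolding irr using R.rcos_mem_genideal_iff[OF I vars] fs(2) that by blast
  qed
  have reg: "\<forall>i<length fs. \<forall>r\<in>polys ?V. fs ! i * r \<in> Idl\<^bsub>poly_ring ?V\<^esub> (?I \<union> set (take i fs)) \<longrightarrow>
      r \<in> Idl\<^bsub>poly_ring ?V\<^esub> (?I \<union> set (take i fs))"
    using R.regular_sequence_quot_iff[OF I fs(2)] xs(2) fs(1) by (simp add: edge_ring_def)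
  obtain us where us: "distinct us" "set us = ?V - W"
    using finite_distinct_list[of "?V - W"] H by (auto simp: simple_graph_def)
  have "koszul_vanishes (polys ?V) ?I (map var (us @ ws)) (k + int (length us))"
  proof (rule koszul_vanishes_of_regular_sequence)
    show "rel_ideal (polys ?V) ?I" by (rule ideal_imp_rel_ideal[OF I])
    show "set (map var (us @ ws)) = var ` ?V" using us W by auto
    show "set fs \<subseteq> Idl\<^bsub>poly_ring ?V\<^esub> (?I \<union> var ` ?V)" using m by blast
    show "k + int (length us) < int (length fs)"
      using k us distinct_card[OF us(1)] fs(1) by simp
  qed (use reg in blast)
  moreover have "distinct (us @ ws)" "set (us @ ws) \<subseteq> ?V" using us W by auto
  ultimately show ?thesis
    unfolding edge_ideal_eq[OF H] by (rule koszul_vanishes_drop_variables[OF upward_closed_edge_monomial, rotated 2])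
qed

definition independent :: "'v ugraph \<Rightarrow> 'v set \<Rightarrow> bool" where
  "independent H F \<longleftrightarrow> F \<subseteq> verts H \<and> (\<forall>u\<in>F. \<forall>v\<in>F. {u, v} \<notin> edges H)"

definition set_monomial :: "'v set \<Rightarrow> ('v \<Rightarrow>\<^sub>0 nat)" where
  "set_monomial F = (\<Sum>v\<in>F. Poly_Mapping.single v 1)"

lemma lookup_set_monomial: "finite F \<Longrightarrow> lookup (set_monomial F) v = (if v \<in> F then 1 else 0)"
  by (simp add: set_monomial_def lookup_sum lookup_single when_def)

lemma keys_set_monomial: "finite F \<Longrightarrow> keys (set_monomial F) = F"
  by (auto simp: in_keys_iff lookup_set_monomial split: if_splits)

lemma independent_finite: "simple_graph H \<Longrightarrow> independent H F \<Longrightarrow> finite F"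
  unfolding independent_def simple_graph_def using finite_subset by blast

lemma edge_ring_depth_leI:
  fixes H :: "'v ugraph"
  assumes "\<And>xs :: ('v, 'k::field) mpoly set list.
    set xs \<subseteq> irrelevant_ideal H \<Longrightarrow> regular_sequence (edge_ring H) xs \<Longrightarrow> length xs \<le> n"
  shows "edge_ring_depth TYPE('k) H \<le> enat n"
  unfolding edge_ring_depth_def grade_def using assms by (intro SUP_least) auto

text \<open>The product of the variables in \<open>F\<close> is nonzero modulo the edge ideal, but all variables outside \<open>F\<close>
annihilate it. It is therefore a nonzero Koszul class in degree 0 for the variables outside \<open>F\<close>.\<close>

lemma depth_le_card_maximal_independent:
  fixes H :: "'v ugraph"
  assumes H: "simple_graph H" and F: "independent H F"
    and max: "\<And>w. w \<in> verts H - F \<Longrightarrow> \<exists>u\<in>F. {w, u} \<in> edges H"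
  shows "edge_ring_depth TYPE('k::field) H \<le> enat (card F)"
proof (rule edge_ring_depth_leI, rule ccontr)
  fix xs :: "('v, 'k) mpoly set list"
  assume xs: "set xs \<subseteq> irrelevant_ideal H" "regular_sequence (edge_ring H) xs" and len: "\<not> length xs \<le> card F"
  let ?I = "edge_ideal H :: ('v, 'k) mpoly set"
  have FV: "F \<subseteq> verts H" "finite F" using F independent_finite[OF H F] by (auto simp: independent_def)
  obtain ws where ws: "distinct ws" "set ws = verts H - F"
    using finite_distinct_list[of "verts H - F"] H by (auto simp: simple_graph_def)
  have "verts H - (verts H - F) = F" using FV by blast
  then have van: "koszul_vanishes (polys (verts H)) ?I (map var ws) 0"
    using len by (intro koszul_vanishes_edge_ideal[OF H xs _ ws]) auto
  interpret rel_ideal "polys (verts H)" ?I by (rule ideal_imp_rel_ideal[OF ideal_edge_ideal[OF H]])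
  have "Poly_Mapping.single (set_monomial F) 1 \<in> ?I"
  proof (rule koszul_vanishes_0D[OF van])
    show "Poly_Mapping.single (set_monomial F) 1 \<in> polys (verts H)"
      using FV by (simp add: polys_iff keys_set_monomial)
    fix x :: "('v, 'k) mpoly" assume "x \<in> set (map var ws)"
    then obtain w where w: "x = var w" "w \<in> verts H - F" using ws by auto
    then obtain u where u: "u \<in> F" "{w, u} \<in> edges H" using max by blast
    have "x * Poly_Mapping.single (set_monomial F) 1 =
        Poly_Mapping.single (Poly_Mapping.single w 1 + set_monomial F) 1"
      by (simp add: w var_def mult_single)
    moreover have "edge_monomial H (Poly_Mapping.single w 1 + set_monomial F)"
      unfolding edge_monomial_def using u FV by (intro exI[of _ w] exI[of _ u]) (simp add: keys_monomial_add keys_set_monomial)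
    ultimately show "x * Poly_Mapping.single (set_monomial F) 1 \<in> ?I"
      using w FV by (simp add: monomial_mem_edge_ideal_iff[OF H] keys_monomial_add keys_set_monomial)
  qed
  then have "edge_monomial H (set_monomial F)" by (simp add: monomial_mem_edge_ideal_iff[OF H])
  then show False using F FV by (auto simp: edge_monomial_def keys_set_monomial independent_def)
qed

text \<open>The link of \<open>F\<close> in the independence complex has vertex set \<open>A \<union> B\<close> and is disconnected, since no vertex of \<open>A\<close>
is compatible with a vertex of \<open>B\<close>. Let \<open>z\<close> be the product of the variables in \<open>F\<close>. Sending \<open>a\<close> to
\<open>a z\<close> for \<open>a \<in> A\<close>, and the other variables outside \<open>F\<close> to 0, is a cocycle in degree 1. It is
not multiplication by some \<open>g\<close>: the coefficient of \<open>z\<close> in \<open>g\<close> would have to be 1 because of \<open>A\<close> and 0 because of \<open>B\<close>.\<close>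

lemma depth_le_of_disconnected_link:
  fixes H :: "'v ugraph"
  assumes H: "simple_graph H"
    and A: "A \<noteq> {}" "\<And>a. a \<in> A \<Longrightarrow> independent H (insert a F)" "A \<inter> F = {}"
    and B: "B \<noteq> {}" "\<And>b. b \<in> B \<Longrightarrow> independent H (insert b F)" "B \<inter> F = {}"
    and AB: "\<And>a b. a \<in> A \<Longrightarrow> b \<in> B \<Longrightarrow> {a, b} \<in> edges H"
    and other: "\<And>w. w \<in> verts H - F - A - B \<Longrightarrow> \<exists>u\<in>F. {w, u} \<in> edges H"
  shows "edge_ring_depth TYPE('k::field) H \<le> enat (card F + 1)"
proof (rule edge_ring_depth_leI, rule ccontr)
  fix xs :: "('v, 'k) mpoly set list"
  assume xs: "set xs \<subseteq> irrelevant_ideal H" "regular_sequence (edge_ring H) xs" and len: "\<not> length xs \<le> card F + 1"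
  let ?V = "verts H" and ?I = "edge_ideal H :: ('v, 'k) mpoly set"
  obtain a b where ab: "a \<in> A" "b \<in> B" using A(1) B(1) by blast
  have ind: "independent H (insert a F)" "independent H (insert b F)"
    using A(2)[OF ab(1)] B(2)[OF ab(2)] by blast+
  have FV: "F \<subseteq> ?V" "finite F" "a \<in> ?V" "b \<in> ?V"
  proof -
    show "finite F" using independent_finite[OF H ind(1)] by simp
    show "F \<subseteq> ?V" "a \<in> ?V" using ind(1) unfolding independent_def by simp_all
    show "b \<in> ?V" using ind(2) unfolding independent_def by simp
  qed
  have AB_disj: "x \<notin> B" if "x \<in> A" for x using simple_graphD(1)[OF H AB[OF that]] by blast
  obtain ws where ws: "distinct ws" "set ws = ?V - F"
    using finite_distinct_list[of "?V - F"] H by (auto simp: simple_graph_def)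
  have "?V - (?V - F) = F" using FV by blast
  then have van: "koszul_vanishes (polys ?V) ?I (map var ws) 1"
    using len by (intro koszul_vanishes_edge_ideal[OF H xs _ ws]) auto
  interpret rel_ideal "polys ?V" ?I by (rule ideal_imp_rel_ideal[OF ideal_edge_ideal[OF H]])
  let ?z = "Poly_Mapping.single (set_monomial F) 1 :: ('v, 'k) mpoly"
  have z: "?z \<in> polys ?V" using FV by (simp add: polys_iff keys_set_monomial)
  have var_z: "var w * ?z = Poly_Mapping.single (Poly_Mapping.single w 1 + set_monomial F) 1" for w
    by (simp add: var_def mult_single)
  have other_z: "var w * ?z \<in> ?I" if w: "w \<in> ?V - F - A - B" for w
  proof -
    obtain u where u: "u \<in> F" "{w, u} \<in> edges H" using other w by blast
    have "edge_monomial H (Poly_Mapping.single w 1 + set_monomial F)"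
      unfolding edge_monomial_def using u FV by (intro exI[of _ w] exI[of _ u]) (simp add: keys_monomial_add keys_set_monomial)
    then show ?thesis unfolding var_z
      using w FV by (simp add: monomial_mem_edge_ideal_iff[OF H] keys_monomial_add keys_set_monomial)
  qed
  have ab_z: "var a' * (var b' * ?z) \<in> ?I" if "a' \<in> A" "b' \<in> B" for a' b'
  proof -
    have e: "{a', b'} \<in> edges H" using AB that by blast
    have "var a' * (var b' * ?z) = ?z * (var a' * var b')" by (simp add: algebra_simps)
    moreover have "var a' * var b' \<in> ?I"
      unfolding edge_ideal_def using subset_genideal[OF edge_generators_in_polys[OF H]] e by blast
    ultimately show ?thesis using mult_J[OF z, of "var a' * var b'"] by (simp only:)
  qed
  have inj: "var v = (var w :: ('v, 'k) mpoly) \<longleftrightarrow> v = w" for v w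
  proof
    assume "var v = (var w :: ('v, 'k) mpoly)"
    then have "keys (var v :: ('v, 'k) mpoly) = keys (var w :: ('v, 'k) mpoly)" by simp
    then have "Poly_Mapping.single v (1::nat) = Poly_Mapping.single w 1" by (simp add: var_def)
    then have "keys (Poly_Mapping.single v (1::nat)) = keys (Poly_Mapping.single w (1 :: nat))" by simp
    then show "v = w" by simp
  qed simp
  define \<phi> where "\<phi> y = (if y \<in> var ` A then y * ?z else 0)" for y
  have \<phi>: "\<phi> (var w) = (if w \<in> A then var w * ?z else 0)" for w by (auto simp: \<phi>_def inj)
  obtain g where g: "g \<in> polys ?V" "\<And>w. w \<in> ?V - F \<Longrightarrow> \<phi> (var w) - var w * g \<in> ?I"
  proof (rule koszul_vanishes_1D[OF van, of \<phi>])
    show "set (map var ws) \<subseteq> polys ?V" using ws by (auto intro: var_in_poly_ring)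
    show "\<phi> x \<in> polys ?V" if "x \<in> set (map var ws)" for x
      using that ws z by (auto simp: \<phi>_def zero_C intro!: mult_C var_in_poly_ring)
    fix x y :: "('v, 'k) mpoly" assume "x \<in> set (map var ws)" "y \<in> set (map var ws)"
    then obtain v w where vw: "x = var v" "y = var w" "v \<in> ?V - F" "w \<in> ?V - F" using ws by auto
    have *: "var v * (var w * ?z) \<in> ?I" if "v \<in> ?V - F - A" "w \<in> A" for v w
    proof (cases "v \<in> B")
      case True then show ?thesis using ab_z[OF that(2) True] by (simp add: algebra_simps)
    next
      case False
      then have "var v * ?z \<in> ?I" using other_z that by blast
      moreover have "w \<in> ?V" using A(2)[OF that(2)] unfolding independent_def by blast
      ultimately show ?thesis using mult_J[OF var_in_poly_ring[of w], of "var v * ?z"] by (simp add: algebra_simps)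
    qed
    show "x * \<phi> y - y * \<phi> x \<in> ?I"
      using *[of v w] uminus_J[OF *[of w v]] vw by (auto simp: \<phi> zero_J algebra_simps)
  qed (use ws in auto)
  have coeff: "lookup f (Poly_Mapping.single w 1 + set_monomial F) = 0"
    if f: "f \<in> ?I" and "independent H (insert w F)" for f w
  proof (rule ccontr)
    assume "lookup f (Poly_Mapping.single w 1 + set_monomial F) \<noteq> 0"
    then have "edge_monomial H (Poly_Mapping.single w 1 + set_monomial F)"
      using f unfolding edge_ideal_eq[OF H] by (auto simp: monomial_ideal_def in_keys_iff)
    then have "\<exists>u\<in>insert w F. \<exists>v\<in>insert w F. {u, v} \<in> edges H"
      using FV unfolding edge_monomial_def by (auto simp: keys_monomial_add keys_set_monomial)
    then show False using that(2) unfolding independent_def by blast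
  qed
  have "var a * ?z - var a * g \<in> ?I" using g(2)[of a] ab(1) A(3) FV(3) by (auto simp: \<phi>)
  from coeff[OF this ind(1)] have "lookup g (set_monomial F) = 1"
    unfolding lookup_minus var_def lookup_single_mult_add by simp
  moreover have "b \<notin> A" "b \<notin> F" using AB_disj ab(2) B(3) by blast+
  then have "0 - var b * g \<in> ?I" using g(2)[of b] FV(4) by (simp add: \<phi>)
  from coeff[OF this ind(2)] have "lookup g (set_monomial F) = 0"
    unfolding lookup_minus var_def lookup_single_mult_add by simp
  ultimately show False by simp
qed

section \<open>A lower bound for the Krull dimension\<close>

text \<open>Exponent vectors have the unique product property: choose monomials of \<open>A\<close> and \<open>B\<close> that are maximal for
one exponent after the other. This replaces a monomial order, for which the variables would have to be ordered.\<close>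

lemma unique_product_on:
  fixes A B :: "('v \<Rightarrow>\<^sub>0 nat) set"
  assumes "finite U" "finite A" "A \<noteq> {}" "finite B" "B \<noteq> {}"
  shows "\<exists>a\<in>A. \<exists>b\<in>B. \<forall>a'\<in>A. \<forall>b'\<in>B. a' + b' = a + b \<longrightarrow> (\<forall>v\<in>U. lookup a' v = lookup a v)"
  using assms
proof (induction U arbitrary: A B rule: finite_induct)
  case empty then show ?case by auto
next
  case (insert u U)
  define p q where "p = Max ((\<lambda>m. lookup m u) ` A)" and "q = Max ((\<lambda>m. lookup m u) ` B)"
  have le: "a \<in> A \<Longrightarrow> lookup a u \<le> p" "b \<in> B \<Longrightarrow> lookup b u \<le> q" for a b
    using insert.prems by (auto simp: p_def q_def)
  have "p \<in> (\<lambda>m. lookup m u) ` A" "q \<in> (\<lambda>m. lookup m u) ` B"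
    unfolding p_def q_def using insert.prems by (auto intro!: Max_in)
  then have ne: "{a \<in> A. lookup a u = p} \<noteq> {}" "{b \<in> B. lookup b u = q} \<noteq> {}" by auto
  have fin: "finite {a \<in> A. lookup a u = p}" "finite {b \<in> B. lookup b u = q}" using insert.prems by auto
  obtain a b where ab0: "a \<in> {a \<in> A. lookup a u = p}" "b \<in> {b \<in> B. lookup b u = q}"
    and uniq: "\<forall>a'\<in>{a \<in> A. lookup a u = p}. \<forall>b'\<in>{b \<in> B. lookup b u = q}.
      a' + b' = a + b \<longrightarrow> (\<forall>v\<in>U. lookup a' v = lookup a v)"
    using insert.IH[OF fin(1) ne(1) fin(2) ne(2)] by blast
  have ab: "a \<in> A" "lookup a u = p" "b \<in> B" "lookup b u = q" using ab0 by auto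
  have "\<forall>v\<in>insert u U. lookup a' v = lookup a v" if "a' \<in> A" "b' \<in> B" "a' + b' = a + b" for a' b'
  proof -
    have "lookup a' u + lookup b' u = p + q" using ab that(3) by (metis lookup_add)
    then have "lookup a' u = p" "lookup b' u = q" using le(1)[OF that(1)] le(2)[OF that(2)] by auto
    then have mem: "a' \<in> {a \<in> A. lookup a u = p}" "b' \<in> {b \<in> B. lookup b u = q}"
      using that(1,2) by auto
    have "\<forall>v\<in>U. lookup a' v = lookup a v"
      by (rule uniq[THEN bspec, OF mem(1), THEN bspec, OF mem(2), THEN mp, OF that(3)])
    then show ?thesis using \<open>lookup a' u = p\<close> ab(2) by simp
  qed
  then show ?case using ab by blast
qed

lemma unique_product:
  fixes A B :: "('v \<Rightarrow>\<^sub>0 nat) set"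
  assumes "finite A" "A \<noteq> {}" "finite B" "B \<noteq> {}"
  shows "\<exists>a\<in>A. \<exists>b\<in>B. \<forall>a'\<in>A. \<forall>b'\<in>B. a' + b' = a + b \<longrightarrow> a' = a"
proof -
  from unique_product_on[of "\<Union>(keys ` A)" A B] assms obtain a b where ab: "a \<in> A" "b \<in> B"
    "\<forall>a'\<in>A. \<forall>b'\<in>B. a' + b' = a + b \<longrightarrow> (\<forall>v\<in>\<Union>(keys ` A). lookup a' v = lookup a v)" by auto
  have "a' = a" if "a' \<in> A" "b' \<in> B" "a' + b' = a + b" for a' b'
  proof (rule poly_mapping_eqI)
    fix v show "lookup a' v = lookup a v"
    proof (cases "v \<in> \<Union>(keys ` A)")
      case True then show ?thesis using ab(3) that by blast
    next
      case False
      then have "v \<notin> keys a'" "v \<notin> keys a" using ab(1) that(1) by auto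
      then show ?thesis by (simp add: in_keys_iff)
    qed
  qed
  then show ?thesis using ab by blast
qed

lemma variable_ideal_prime:
  fixes f g :: "('v, 'k::field) mpoly"
  assumes fg: "f \<in> polys V" "g \<in> polys V" "f * g \<in> monomial_ideal V (\<lambda>m. keys m \<inter> W \<noteq> {})"
  shows "f \<in> monomial_ideal V (\<lambda>m. keys m \<inter> W \<noteq> {}) \<or> g \<in> monomial_ideal V (\<lambda>m. keys m \<inter> W \<noteq> {})"
proof (rule ccontr)
  assume not: "\<not> ?thesis"
  let ?A = "{m \<in> keys f. keys m \<inter> W = {}}" and ?B = "{m \<in> keys g. keys m \<inter> W = {}}"
  have "f \<notin> monomial_ideal V (\<lambda>m. keys m \<inter> W \<noteq> {})" "g \<notin> monomial_ideal V (\<lambda>m. keys m \<inter> W \<noteq> {})"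
    using not by simp_all
  then have ne: "?A \<noteq> {}" "?B \<noteq> {}" using fg(1,2) by (simp_all add: monomial_ideal_def) blast+
  have fin: "finite ?A" "finite ?B" by simp_all
  obtain a b where ab: "a \<in> ?A" "b \<in> ?B"
    and uniq: "\<forall>a'\<in>?A. \<forall>b'\<in>?B. a' + b' = a + b \<longrightarrow> a' = a"
    using unique_product[OF fin(1) ne(1) fin(2) ne(2)] by blast
  let ?s = "Poly_Mapping.single a (lookup f a)"
  have "lookup ((f - ?s) * g) (a + b) = 0"
  proof (rule ccontr)
    assume "\<not> ?thesis"
    then have "a + b \<in> keys ((f - ?s) * g)" by (simp add: in_keys_iff)
    then obtain x y where xy: "a + b = x + y" "x \<in> keys (f - ?s)" "y \<in> keys g"
      using keys_mult[of "f - ?s" g] by blast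
    have "x \<noteq> a" "x \<in> keys f" using xy(2) by (auto simp: in_keys_iff lookup_minus lookup_single when_def split: if_splits)
    have "(keys x \<union> keys y) \<inter> W = {}"
      using ab xy(1) keys_monomial_add[of a b] keys_monomial_add[of x y] by auto
    then have xA: "x \<in> ?A" and yB: "y \<in> ?B" using \<open>x \<in> keys f\<close> xy(3) by auto
    have "x = a" by (rule uniq[THEN bspec, OF xA, THEN bspec, OF yB, THEN mp, OF xy(1)[symmetric]])
    then show False using \<open>x \<noteq> a\<close> by simp
  qed
  then have "lookup (f * g) (a + b) = lookup (?s * g) (a + b)"
    by (simp add: left_diff_distrib lookup_minus)
  also have "\<dots> = lookup f a * lookup g b" by (rule lookup_single_mult_add)
  also have "\<dots> \<noteq> 0" using ab by (simp add: in_keys_iff)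
  finally have "a + b \<in> keys (f * g)" by (simp add: in_keys_iff)
  then have "keys (a + b) \<inter> W \<noteq> {}" using fg(3) by (simp add: monomial_ideal_def)
  then show False using ab by (auto simp: keys_monomial_add)
qed

text \<open>The ideals generated by the variables outside \<open>F\<close> together with the first \<open>i\<close> variables of \<open>F\<close> contain the edge
ideal, because every edge has an end outside \<open>F\<close>. They form a chain of \<open>card F + 1\<close> primes.\<close>

lemma card_independent_le_krull_dim:
  fixes H :: "'v ugraph"
  assumes H: "simple_graph H" and F: "independent H F"
  shows "enat (card F) \<le> krull_dim (edge_ring H :: ('v, 'k::field) mpoly set ring)"
proof -
  let ?V = "verts H" and ?I = "edge_ideal H :: ('v, 'k) mpoly set" and ?Q = "edge_ring H :: ('v, 'k) mpoly set ring"
  interpret R: cring "poly_ring ?V :: ('v, 'k) mpoly ring" by (rule cring_poly_ring)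
  have I: "ideal ?I (poly_ring ?V)" by (rule ideal_edge_ideal[OF H])
  have Ir: "rel_ideal (polys ?V) ?I" by (rule ideal_imp_rel_ideal[OF I])
  interpret Q: cring ?Q by (rule cring_edge_ring[OF H])
  let ?q = "(+>\<^bsub>poly_ring ?V\<^esub>) ?I"
  have Qc: "carrier ?Q = ?q ` polys ?V" unfolding edge_ring_def R.quot_carrier ..
  obtain fs where fs: "distinct fs" "set fs = F" using finite_distinct_list[OF independent_finite[OF H F]] by blast
  have FV: "F \<subseteq> ?V" using F by (simp add: independent_def)
  define W where "W i = (?V - F) \<union> set (take i fs)" for i
  define M where "M i = (monomial_ideal ?V (\<lambda>m. keys m \<inter> W i \<noteq> {}) :: ('v, 'k) mpoly set)" for i
  define P where "P i = Idl\<^bsub>?Q\<^esub> (?q ` (var ` W i))" for i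
  have WV: "W i \<subseteq> ?V" for i using FV fs(2) set_take_subset[of i fs] by (auto simp: W_def)
  have vW: "var ` W i \<subseteq> polys ?V" for i using WV by (auto intro: var_in_poly_ring)
  have IM: "?I \<subseteq> M i" for i
  proof -
    have "keys m \<inter> W i \<noteq> {}" if "keys m \<subseteq> ?V" "edge_monomial H m" for m
    proof -
      obtain u v where uv: "{u, v} \<in> edges H" "u \<in> keys m" "v \<in> keys m"
        using \<open>edge_monomial H m\<close> unfolding edge_monomial_def by blast
      then have "u \<notin> F \<or> v \<notin> F" using F unfolding independent_def by blast
      then show ?thesis using uv that(1) unfolding W_def by blast
    qed
    then show ?thesis unfolding edge_ideal_eq[OF H] M_def by (auto simp: monomial_ideal_def polys_iff)
  qed
  have Mr: "rel_ideal (polys ?V) (M i)" for i unfolding M_def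
    by (rule rel_ideal_monomial_ideal) (auto simp: upward_closed_def keys_monomial_add)
  have sub: "?I \<union> var ` W i \<subseteq> polys ?V" for i using vW rel_ideal.J_sub[OF Ir] by blast
  have Idl: "Idl\<^bsub>poly_ring ?V\<^esub> (?I \<union> var ` W i) = M i" for i
  proof
    have "var ` W i \<subseteq> M i"
      using vW[of i] by (auto simp: M_def monomial_ideal_def var_def)
    then show "Idl\<^bsub>poly_ring ?V\<^esub> (?I \<union> var ` W i) \<subseteq> M i"
      using IM by (intro genideal_subset_rel_ideal[OF Mr]) auto
    show "M i \<subseteq> Idl\<^bsub>poly_ring ?V\<^esub> (?I \<union> var ` W i)"
      unfolding M_def genideal_vars[OF WV, symmetric]
      using subset_genideal[OF sub[of i]]
      by (intro genideal_subset_rel_ideal[OF rel_ideal_genideal[OF sub]]) auto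
  qed
  have mem: "?q f \<in> P i \<longleftrightarrow> f \<in> M i" if "f \<in> polys ?V" for f i
    using R.rcos_mem_genideal_iff[OF I vW that] unfolding P_def edge_ring_def Idl by blast
  have qv: "?q ` (var ` W i) \<subseteq> carrier ?Q" for i using vW Qc by blast
  have Pid: "ideal (P i) ?Q" for i unfolding P_def by (rule Q.genideal_ideal[OF qv])
  have prime: "primeideal (P i) ?Q" for i
  proof (rule primeidealI[OF Pid Q.is_cring])
    have "1 \<notin> M i" by (simp add: M_def monomial_ideal_def)
    then have "?q 1 \<notin> P i" using mem polys_closed(3) by blast
    then show "carrier ?Q \<noteq> P i" using Qc polys_closed(3) by blast
    fix a b assume "a \<in> carrier ?Q" "b \<in> carrier ?Q" and ab: "a \<otimes>\<^bsub>?Q\<^esub> b \<in> P i"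
    then obtain f g where fg: "a = ?q f" "b = ?q g" "f \<in> polys ?V" "g \<in> polys ?V"
      unfolding Qc by (elim imageE) (rule that)
    have "a \<otimes>\<^bsub>?Q\<^esub> b = ?q (f * g)"
      using ring_hom_mult[OF ideal.rcos_ring_hom[OF I] fg(3,4)] fg(1,2) by (simp add: edge_ring_def)
    then have "f * g \<in> M i" using ab mem[OF polys_closed(2)[OF fg(3,4)]] by simp
    then have "f \<in> M i \<or> g \<in> M i" unfolding M_def by (rule variable_ideal_prime[OF fg(3,4)])
    then show "a \<in> P i \<or> b \<in> P i" using mem fg by blast
  qed
  have strict: "P i \<subset> P (Suc i)" if "i < card F" for i
  proof
    have len: "i < length fs" using that distinct_card[OF fs(1)] fs(2) by simp
    have "W i \<subseteq> W (Suc i)" using set_take_subset_set_take[of i "Suc i" fs] by (auto simp: W_def)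
    then have MM: "M i \<subseteq> M (Suc i)" by (auto simp: M_def monomial_ideal_def)
    show "P i \<subseteq> P (Suc i)"
    proof
      fix x assume x: "x \<in> P i"
      then have "x \<in> carrier ?Q" using additive_subgroup.a_subset[OF ideal.axioms(1)[OF Pid]] by blast
      then obtain f where "x = ?q f" "f \<in> polys ?V" unfolding Qc by (rule imageE)
      then show "x \<in> P (Suc i)" using x mem MM by blast
    qed
    have "fs ! i \<notin> W i"
    proof -
      have "fs ! i \<notin> set (take i fs)" using fs(1) len
        by (auto simp: in_set_conv_nth nth_eq_iff_index_eq)
      then show ?thesis using fs(2) len nth_mem[OF len] by (auto simp: W_def)
    qed
    moreover have "fs ! i \<in> W (Suc i)" using len by (auto simp: W_def take_Suc_conv_app_nth)
    ultimately have "var (fs ! i) \<in> M (Suc i)" "var (fs ! i) \<notin> M i"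
      using vW[of "Suc i"] by (auto simp: M_def monomial_ideal_def var_def)
    moreover have "var (fs ! i) \<in> polys ?V" using vW[of "Suc i"] \<open>fs ! i \<in> W (Suc i)\<close> by blast
    ultimately show "P i \<noteq> P (Suc i)" using mem by blast
  qed
  show ?thesis unfolding krull_dim_def
    by (rule SUP_upper) (use prime strict in blast)
qed

section \<open>Cohen--Macaulay bipartite graphs\<close>

text \<open>Hall's theorem, by the induction of Halmos and Vaughan: either some proper nonempty subset has exactly as many
neighbours as elements, and the problem splits, or one edge can be chosen freely.\<close>

lemma hall_marriage:
  fixes N :: "'a \<Rightarrow> 'b set"
  assumes "finite X" "\<And>x. x \<in> X \<Longrightarrow> finite (N x)"
    and "\<And>A. A \<subseteq> X \<Longrightarrow> card A \<le> card (\<Union>(N ` A))"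
  shows "\<exists>f. inj_on f X \<and> (\<forall>x\<in>X. f x \<in> N x)"
  using assms
proof (induction "card X" arbitrary: X N rule: less_induct)
  case less
  have finN: "finite (\<Union>(N ` A))" if "A \<subseteq> X" for A
    using that less.prems(1,2) finite_subset by blast
  show ?case
  proof (cases "X = {}")
    case False
    show ?thesis
    proof (cases "\<exists>A. A \<noteq> {} \<and> A \<subset> X \<and> card (\<Union>(N ` A)) = card A")
      case True
      then obtain A where A: "A \<noteq> {}" "A \<subset> X" "card (\<Union>(N ` A)) = card A" by blast
      let ?M = "\<Union>(N ` A)"
      have finA: "finite A" using A(2) less.prems(1) finite_subset by blast
      have "\<exists>f. inj_on f A \<and> (\<forall>x\<in>A. f x \<in> N x)"
      proof (rule less.hyps)
        show "card A < card X" using A(2) less.prems(1) by (rule psubset_card_mono[rotated])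
        show "finite (N x)" if "x \<in> A" for x using that A(2) less.prems(2) by blast
        show "card B \<le> card (\<Union>(N ` B))" if "B \<subseteq> A" for B using that A(2) less.prems(3)[of B] by blast
      qed (rule finA)
      then obtain f where f: "inj_on f A" "\<And>x. x \<in> A \<Longrightarrow> f x \<in> N x" by blast
      have "\<exists>g. inj_on g (X - A) \<and> (\<forall>x\<in>X - A. g x \<in> N x - ?M)"
      proof (rule less.hyps)
        show "card (X - A) < card X"
          using A less.prems(1) by (intro psubset_card_mono) auto
        show "finite (N x - ?M)" if "x \<in> X - A" for x using that less.prems(2) by auto
        show "card B \<le> card (\<Union>x\<in>B. N x - ?M)" if B: "B \<subseteq> X - A" for B
        proof -
          have finB: "finite B" using B less.prems(1) finite_subset by blast
          have "card A + card B = card (A \<union> B)"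
            using B finA finB by (intro card_Un_disjoint[symmetric]) auto
          also have "\<dots> \<le> card (\<Union>(N ` (A \<union> B)))" using B A(2) by (intro less.prems(3)) auto
          also have "\<Union>(N ` (A \<union> B)) = ?M \<union> (\<Union>x\<in>B. N x - ?M)" by auto
          also have "card \<dots> \<le> card ?M + card (\<Union>x\<in>B. N x - ?M)" by (rule card_Un_le)
          finally show ?thesis using A(3) by simp
        qed
      qed (use less.prems(1) in simp)
      then obtain g where g: "inj_on g (X - A)" "\<And>x. x \<in> X - A \<Longrightarrow> g x \<in> N x - ?M" by blast
      let ?h = "\<lambda>x. if x \<in> A then f x else g x"
      have "inj_on ?h X"
      proof (rule inj_onI)
        fix x y assume xy: "x \<in> X" "y \<in> X" "?h x = ?h y"
        have ne: "f x \<noteq> g y" if "x \<in> A" "y \<in> X - A" for x y using f(2)[OF that(1)] g(2)[OF that(2)] that(1) by auto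
        show "x = y" using xy ne[of x y] ne[of y x] f(1) g(1) by (auto simp: inj_on_def split: if_splits)
      qed
      moreover have "\<forall>x\<in>X. ?h x \<in> N x" using f(2) g(2) by auto
      ultimately show ?thesis by blast
    next
      case False
      obtain x where x: "x \<in> X" using \<open>X \<noteq> {}\<close> by blast
      have "N x \<noteq> {}" using less.prems(3)[of "{x}"] x by auto
      then obtain y where y: "y \<in> N x" by blast
      have "\<exists>g. inj_on g (X - {x}) \<and> (\<forall>z\<in>X - {x}. g z \<in> N z - {y})"
      proof (rule less.hyps)
        show "card (X - {x}) < card X" using x less.prems(1) by (intro psubset_card_mono) auto
        show "finite (N z - {y})" if "z \<in> X - {x}" for z using that less.prems(2) by auto
        show "card B \<le> card (\<Union>z\<in>B. N z - {y})" if B: "B \<subseteq> X - {x}" for B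
        proof (cases "B = {}")
          case False
          have BX: "B \<subset> X" using B x by blast
          then have "card B \<noteq> card (\<Union>(N ` B))" using \<open>\<not> (\<exists>A. _ A)\<close> False by metis
          then have "card B < card (\<Union>(N ` B))" using less.prems(3)[of B] BX by force
          moreover have "(\<Union>z\<in>B. N z - {y}) = \<Union>(N ` B) - {y}" by auto
          moreover have "card (\<Union>(N ` B)) - 1 \<le> card (\<Union>(N ` B) - {y})"
            by (simp add: card_Diff_singleton_if)
          ultimately show ?thesis by simp
        qed simp
      qed (use less.prems(1) in simp)
      then obtain g where g: "inj_on g (X - {x})" "\<And>z. z \<in> X - {x} \<Longrightarrow> g z \<in> N z - {y}" by blast
      have "inj_on (g(x := y)) X"
      proof (rule inj_onI)
        fix a b assume "a \<in> X" "b \<in> X" "(g(x := y)) a = (g(x := y)) b"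
        then show "a = b" using g by (cases "a = x"; cases "b = x") (auto simp: inj_on_def)
      qed
      moreover have "\<forall>z\<in>X. (g(x := y)) z \<in> N z" using g(2) y by auto
      ultimately show ?thesis by blast
    qed
  qed simp
qed

definition maximal_independent :: "'v ugraph \<Rightarrow> 'v set \<Rightarrow> bool" where
  "maximal_independent H F \<longleftrightarrow> independent H F \<and> (\<forall>w\<in>verts H - F. \<exists>u\<in>F. {w, u} \<in> edges H)"

lemma independent_extend:
  assumes H: "simple_graph H" and F0: "independent H F0"
  obtains F where "F0 \<subseteq> F" "maximal_independent H F"
proof -
  let ?S = "{F. F0 \<subseteq> F \<and> independent H F}"
  have "finite ?S"
    by (rule finite_subset[of _ "Pow (verts H)"]) (use H in \<open>auto simp: independent_def simple_graph_def\<close>)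
  moreover have "F0 \<in> ?S" using F0 by simp
  ultimately obtain F where F: "F \<in> ?S" "\<And>F'. F' \<in> ?S \<Longrightarrow> F \<subseteq> F' \<Longrightarrow> F = F'"
    using finite_has_maximal[of ?S] by (metis (no_types, lifting) empty_iff)
  have "\<exists>u\<in>F. {w, u} \<in> edges H" if w: "w \<in> verts H - F" for w
  proof (rule ccontr)
    assume no: "\<not> ?thesis"
    then have "{u, w} \<notin> edges H" if "u \<in> F" for u using that by (simp add: insert_commute)
    moreover have "{w, w} \<notin> edges H" using simple_graphD(1)[OF H, of w w] by blast
    ultimately have "independent H (insert w F)" using F(1) w no by (auto simp: independent_def)
    then show False using F(1) F(2)[of "insert w F"] w by auto
  qed
  then show ?thesis using that F(1) by (auto simp: maximal_independent_def)
qed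

lemma depth_eq_card_maximal_independent:
  assumes H: "simple_graph H" and CM: "cohen_macaulay TYPE('k::field) H" and F: "maximal_independent H F"
  shows "edge_ring_depth TYPE('k) H = enat (card F)"
proof (rule antisym)
  show "edge_ring_depth TYPE('k) H \<le> enat (card F)"
    using F depth_le_card_maximal_independent[OF H] by (auto simp: maximal_independent_def)
  show "enat (card F) \<le> edge_ring_depth TYPE('k) H"
    using CM F card_independent_le_krull_dim[OF H, where 'k = 'k]
    by (simp add: cohen_macaulay_def maximal_independent_def)
qed

text \<open>The structure of a Cohen--Macaulay bipartite graph, stated symmetrically in the two sides. The involution \<open>p\<close> is
a perfect matching between \<open>X\<close> and the other side. For \<open>i, j \<in> X\<close> let \<open>i \<le> j\<close> mean that \<open>i\<close> is adjacent to \<open>p j\<close>;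
the last two conditions are transitivity and antisymmetry of this relation.\<close>

definition herzog_hibi :: "'v ugraph \<Rightarrow> 'v set \<Rightarrow> ('v \<Rightarrow> 'v) \<Rightarrow> bool" where
  "herzog_hibi H X p \<longleftrightarrow>
     X \<union> p ` X = verts H \<and> X \<inter> p ` X = {} \<and>
     (\<forall>v\<in>verts H. p v \<in> verts H \<and> p (p v) = v \<and> {v, p v} \<in> edges H) \<and>
     (\<forall>v\<in>verts H. \<forall>w w'. {v, w} \<in> edges H \<and> {p v, w'} \<in> edges H \<longrightarrow> {w, w'} \<in> edges H) \<and>
     (\<forall>v\<in>verts H. \<forall>w. {v, w} \<in> edges H \<and> {p v, p w} \<in> edges H \<longrightarrow> w = p v)"

text \<open>All maximal independent sets have the size \<open>n\<close> of \<open>X\<close>, hence of \<open>Y\<close>. Hall's condition holds for \<open>A \<subseteq> X\<close>, since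
\<open>A\<close> together with its non-neighbours in \<open>Y\<close> is independent and so has at most \<open>n\<close> elements. This gives the
matching \<open>f\<close>, and an independent set meets each of the \<open>n\<close> pairs at most once. If transitivity failed for
\<open>i, j, k\<close>, then a maximal independent set through \<open>i\<close> and \<open>f k\<close> would miss the pair of \<open>j\<close>. For antisymmetry,
take the class of \<open>i\<close> in the preorder: the vertices strictly above it, with the partners of the vertices not
above it, form an independent set, the link of which is a complete bipartite graph on the class.\<close>

lemma cohen_macaulay_bipartite_structure:
  fixes H :: "'v ugraph"
  assumes H: "simple_graph H" and iso: "no_isolated_vertices H" and bip: "bipartite H"
    and CM: "cohen_macaulay TYPE('k::field) H"
  obtains X p where "herzog_hibi H X p" "edge_ring_depth TYPE('k) H = enat (card X)"
proof -
  let ?E = "edges H" and ?V = "verts H"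
  obtain X Y where XY: "X \<union> Y = ?V" "X \<inter> Y = {}" "\<forall>e\<in>?E. \<exists>x\<in>X. \<exists>y\<in>Y. e = {x, y}"
    using bip unfolding bipartite_def by blast
  have fin: "finite X" "finite Y" using H XY(1) unfolding simple_graph_def by (metis finite_Un)+
  have edge: "a \<in> X \<and> b \<in> Y \<or> a \<in> Y \<and> b \<in> X" if e: "{a, b} \<in> ?E" for a b
  proof -
    obtain x y where "x \<in> X" "y \<in> Y" "{a, b} = {x, y}" using XY(3)[THEN bspec, OF e] by blast
    then show ?thesis unfolding doubleton_eq_iff by blast
  qed
  have edge_X: "b \<in> Y" if "{a, b} \<in> ?E" "a \<in> X" for a b using edge[OF that(1)] that(2) XY(2) by blast
  have edge_Y: "b \<in> X" if "{a, b} \<in> ?E" "a \<in> Y" for a b using edge[OF that(1)] that(2) XY(2) by blast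
  have sym: "{a, b} \<in> ?E \<longleftrightarrow> {b, a} \<in> ?E" for a b by (simp add: insert_commute)
  have nbr: "\<exists>u. {v, u} \<in> ?E" if "v \<in> ?V" for v
    using iso that sym unfolding no_isolated_vertices_def neighborhood_def by blast
  have indX: "independent H A" if "A \<subseteq> X" for A
    unfolding independent_def using that XY(1,2) edge_X by blast
  have indY: "independent H A" if "A \<subseteq> Y" for A
    unfolding independent_def using that XY(1,2) edge_Y by blast
  have maxX: "maximal_independent H X"
    unfolding maximal_independent_def using indX nbr edge_Y XY(1) by blast
  have maxY: "maximal_independent H Y"
    unfolding maximal_independent_def using indY nbr edge_X XY(1) by blast
  have depth: "edge_ring_depth TYPE('k) H = enat (card X)"
    by (rule depth_eq_card_maximal_independent[OF H CM maxX])
  have unmixed: "card F = card X" if "maximal_independent H F" for F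
    using depth_eq_card_maximal_independent[OF H CM that] depth by simp
  have cardY: "card Y = card X" by (rule unmixed[OF maxY])
  have ind_mixed: "independent H (A \<union> B)"
    if "A \<subseteq> X" "B \<subseteq> Y" "\<And>a b. a \<in> A \<Longrightarrow> b \<in> B \<Longrightarrow> {a, b} \<notin> ?E" for A B
    using indX[OF that(1)] indY[OF that(2)] that(3) sym unfolding independent_def by blast
  let ?N = "\<lambda>x. {y. {x, y} \<in> ?E}"
  have NY: "?N x \<subseteq> Y" if "x \<in> X" for x using edge_X that by blast
  have "\<exists>f. inj_on f X \<and> (\<forall>x\<in>X. f x \<in> ?N x)"
  proof (rule hall_marriage[OF fin(1)])
    show "finite (?N x)" if "x \<in> X" for x using NY[OF that] fin(2) finite_subset by blast
    show "card A \<le> card (\<Union>(?N ` A))" if A: "A \<subseteq> X" for A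
    proof -
      let ?M = "\<Union>(?N ` A)"
      have MY: "?M \<subseteq> Y" using A NY by blast
      have "independent H (A \<union> (Y - ?M))" using A by (intro ind_mixed) auto
      then obtain F where F: "A \<union> (Y - ?M) \<subseteq> F" "maximal_independent H F" by (rule independent_extend[OF H])
      then have finF: "finite F" using independent_finite[OF H] by (simp add: maximal_independent_def)
      have "card A + (card Y - card ?M) = card A + card (Y - ?M)"
        using MY fin(2) by (simp add: card_Diff_subset finite_subset)
      also have "\<dots> = card (A \<union> (Y - ?M))"
        using A XY(2) fin finite_subset[OF A fin(1)] by (intro card_Un_disjoint[symmetric]) auto
      also have "\<dots> \<le> card F" by (rule card_mono[OF finF F(1)])
      also have "\<dots> = card Y" using unmixed[OF F(2)] cardY by simp
      finally show ?thesis using card_mono[OF fin(2) MY] by linarith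
    qed
  qed
  then obtain f where f: "inj_on f X" "\<And>x. x \<in> X \<Longrightarrow> {x, f x} \<in> ?E" by blast
  have fY: "f ` X = Y"
  proof (rule card_subset_eq[OF fin(2)])
    show "f ` X \<subseteq> Y" using f(2) edge_X by blast
    show "card (f ` X) = card Y" using card_image[OF f(1)] cardY by simp
  qed
  have f_in: "f x \<in> Y" if "x \<in> X" for x using fY that by blast
  have f_inj: "x = y" if "f x = f y" "x \<in> X" "y \<in> X" for x y using f(1) that by (auto simp: inj_on_def)
  define r where "r i j \<longleftrightarrow> {i, f j} \<in> ?E" for i j
  have r_refl: "r i i" if "i \<in> X" for i using f(2) that by (simp add: r_def)
  have r_trans: "r i k" if ijk: "i \<in> X" "j \<in> X" "k \<in> X" "r i j" "r j k" for i j k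
  proof (rule ccontr)
    assume "\<not> r i k"
    then have "independent H ({i} \<union> {f k})" using ijk f_in by (intro ind_mixed) (auto simp: r_def)
    then obtain F where F: "{i} \<union> {f k} \<subseteq> F" "maximal_independent H F" by (rule independent_extend[OF H])
    then have indF: "independent H F" by (simp add: maximal_independent_def)
    have noE: "{u, v} \<notin> ?E" if "u \<in> F" "v \<in> F" for u v using indF that unfolding independent_def by blast
    \<comment> \<open>\<open>g\<close> sends a vertex to the representative in \<open>X\<close> of its pair.\<close>
    define g where "g v = (if v \<in> X then v else inv_into X f v)" for v
    have g: "g v \<in> X" "v = g v \<or> v = f (g v)" if "v \<in> F" for v
    proof -
      have "v \<in> X \<or> v \<in> f ` X" using that indF XY(1) fY unfolding independent_def by blast
      then show "g v \<in> X" "v = g v \<or> v = f (g v)"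
        by (auto simp: g_def inv_into_into f_inv_into_f)
    qed
    have "inj_on g F"
    proof (rule inj_onI)
      fix u v assume uv: "u \<in> F" "v \<in> F" "g u = g v"
      have "{g u, f (g u)} \<in> ?E" using f(2) g(1)[OF uv(1)] by blast
      then show "u = v" using g(2)[OF uv(1)] g(2)[OF uv(2)] uv noE sym by metis
    qed
    moreover have "g v \<noteq> j" if "v \<in> F" for v
    proof
      assume "g v = j"
      then have "v = j \<or> v = f j" using g(2)[OF that] by simp
      then show False using noE[of i v] noE[of v "f k"] F(1) that ijk(4,5) by (auto simp: r_def)
    qed
    ultimately have "card F \<le> card (X - {j})"
      using g(1) fin(1) by (intro card_inj_on_le[of g]) auto
    also have "\<dots> < card X" using ijk(2) fin(1) by (intro psubset_card_mono) auto
    finally show False using unmixed[OF F(2)] by simp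
  qed
  have r_antisym: "i = j" if ij: "i \<in> X" "j \<in> X" "r i j" "r j i" for i j
  proof (rule ccontr)
    assume "i \<noteq> j"
    let ?U = "{k \<in> X. r i k \<and> \<not> r k i}" and ?D = "{k \<in> X. \<not> r i k}" and ?A = "{k \<in> X. r i k \<and> r k i}"
    \<comment> \<open>\<open>?U\<close> is the part strictly above the class \<open>?A\<close> of \<open>i\<close>, and \<open>?D\<close> the part that is not above \<open>i\<close>.\<close>
    let ?F = "?U \<union> f ` ?D"
    have iA: "i \<in> ?A" "j \<in> ?A" using ij r_refl by auto
    have fD: "f ` ?D \<subseteq> Y" and fA: "f ` ?A \<subseteq> Y" using f_in by auto
    have le: "edge_ring_depth TYPE('k) H \<le> enat (card ?F + 1)"
    proof (rule depth_le_of_disconnected_link[OF H, where A = ?A and B = "f ` ?A"])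
      show "?A \<noteq> {}" "f ` ?A \<noteq> {}" using iA by auto
      show "?A \<inter> ?F = {}" using fD XY(2) by auto
      show "f ` ?A \<inter> ?F = {}" using fA XY(2) f_inj by auto
      show "independent H (insert a ?F)" if "a \<in> ?A" for a
      proof -
        have "independent H (insert a ?U \<union> f ` ?D)"
        proof (rule ind_mixed)
          fix x y assume x: "x \<in> insert a ?U" and "y \<in> f ` ?D"
          then obtain k where k: "y = f k" "k \<in> X" "\<not> r i k" by blast
          have "x \<in> X" "r i x" using x that by auto
          then have "\<not> r x k" using r_trans[OF ij(1) _ k(2)] k(3) by blast
          then show "{x, y} \<notin> ?E" by (simp add: r_def k(1))
        qed (use that fD in auto)
        then show ?thesis by simp
      qed
      show "independent H (insert b ?F)" if b: "b \<in> f ` ?A" for b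
      proof -
        obtain c where c: "b = f c" "c \<in> X" "r i c" "r c i" using b by blast
        have "independent H (?U \<union> insert b (f ` ?D))"
        proof (rule ind_mixed)
          fix x y assume x: "x \<in> ?U" and "y \<in> insert b (f ` ?D)"
          then consider "y = f c" | k where "y = f k" "k \<in> X" "\<not> r i k" using c(1) by blast
          then show "{x, y} \<notin> ?E"
          proof cases
            case 1
            have "\<not> r x c" using r_trans[OF _ c(2) ij(1) _ c(4), of x] x by blast
            then show ?thesis by (simp add: r_def 1)
          next
            case 2
            then have "\<not> r x k" using r_trans[OF ij(1) _ 2(2), of x] x by blast
            then show ?thesis by (simp add: r_def 2)
          qed
        qed (use c fA fD f_in in auto)
        then show ?thesis by simp
      qed
      show "{a, b} \<in> ?E" if a: "a \<in> ?A" and b: "b \<in> f ` ?A" for a b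
      proof -
        obtain c where c: "b = f c" "c \<in> X" "r i c" using b by blast
        have "r a c" using r_trans[OF _ ij(1) c(2) _ c(3), of a] a by blast
        then show ?thesis by (simp add: r_def c)
      qed
      show "\<exists>u\<in>?F. {w, u} \<in> ?E" if w: "w \<in> ?V - ?F - ?A - f ` ?A" for w
      proof (cases "w \<in> X")
        case True
        then have "w \<in> ?D" using w by blast
        then show ?thesis using f(2)[OF True] by blast
      next
        case False
        then obtain k where k: "w = f k" "k \<in> X" using w XY(1) fY by blast
        then have "k \<in> ?U" using w by blast
        moreover have "{w, k} \<in> ?E" using f(2)[OF k(2)] k(1) sym by simp
        ultimately show ?thesis by blast
      qed
    qed
    have "card ?F \<le> card ?U + card (f ` ?D)" by (rule card_Un_le)
    also have "\<dots> \<le> card ?U + card ?D" using fin(1) by (simp add: card_image_le)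
    finally have 1: "card ?F \<le> card ?U + card ?D" .
    have "card X = card (?A \<union> ?U \<union> ?D)" by (rule arg_cong[of _ _ card]) auto
    also have "\<dots> = card (?A \<union> ?U) + card ?D" using fin(1) by (intro card_Un_disjoint) auto
    also have "card (?A \<union> ?U) = card ?A + card ?U" using fin(1) by (intro card_Un_disjoint) auto
    finally have 2: "card X = card ?A + card ?U + card ?D" .
    have "card {i, j} \<le> card ?A" using iA fin(1) by (intro card_mono) auto
    then have "2 \<le> card ?A" using \<open>i \<noteq> j\<close> by simp
    then show False using le depth 1 2 by simp
  qed
  define p where "p v = (if v \<in> X then f v else inv_into X f v)" for v
  have pX: "p x = f x" if "x \<in> X" for x using that by (simp add: p_def)
  have pf: "p (f x) = x" if "x \<in> X" for x
    using that f_in[OF that] XY(2) f(1) by (auto simp: p_def inv_into_f_f)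
  have cases_V: "v \<in> X \<or> (\<exists>i\<in>X. v = f i)" if "v \<in> ?V" for v using that XY(1) fY by blast
  have "herzog_hibi H X p" unfolding herzog_hibi_def
  proof (intro conjI ballI allI impI)
    have pX_img: "p ` X = Y" using fY pX by (metis image_cong)
    show "X \<union> p ` X = ?V" "X \<inter> p ` X = {}" using XY pX_img by auto
    fix v assume v: "v \<in> ?V"
    show "p v \<in> ?V" using cases_V[OF v] pX pf f_in XY(1) by auto
    show "p (p v) = v" using cases_V[OF v] pX pf by auto
    show "{v, p v} \<in> ?E" using cases_V[OF v] pX pf f(2) sym by auto
    { fix w w' assume e: "{v, w} \<in> ?E \<and> {p v, w'} \<in> ?E"
      show "{w, w'} \<in> ?E"
        using cases_V[OF v]
      proof
        assume vX: "v \<in> X"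
        obtain j where j: "j \<in> X" "w = f j" using edge_X e vX fY by blast
        have k: "w' \<in> X" using edge_Y[of "p v" w'] e pX[OF vX] f_in[OF vX] by simp
        have "r v j" "r w' v" using e j pX[OF vX] sym by (auto simp: r_def)
        then have "r w' j" using r_trans[OF k vX j(1)] by blast
        then show ?thesis using j sym by (simp add: r_def)
      next
        assume "\<exists>i\<in>X. v = f i"
        then obtain i where i: "i \<in> X" "v = f i" by blast
        obtain j where j: "j \<in> X" "w' = f j" using edge_X[of i w'] e i pf fY by auto
        have k: "w \<in> X" using edge_Y[of v w] e i f_in by simp
        have "r w i" "r i j" using e i j pf sym by (auto simp: r_def)
        then have "r w j" using r_trans[OF k i(1) j(1)] by blast
        then show ?thesis using j by (simp add: r_def)
      qed }
    { fix w assume e: "{v, w} \<in> ?E \<and> {p v, p w} \<in> ?E"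
      show "w = p v"
        using cases_V[OF v]
      proof
        assume vX: "v \<in> X"
        obtain j where j: "j \<in> X" "w = f j" using edge_X e vX fY by blast
        have "r v j" "r j v" using e j pf[OF j(1)] pX[OF vX] sym by (auto simp: r_def)
        then have "v = j" by (rule r_antisym[OF vX j(1)])
        then show ?thesis using j pX[OF vX] by simp
      next
        assume "\<exists>i\<in>X. v = f i"
        then obtain i where i: "i \<in> X" "v = f i" by blast
        have k: "w \<in> X" using edge_Y[of v w] e i f_in by simp
        have "r w i" "r i w" using e i k pf pX sym by (auto simp: r_def)
        then have "w = i" by (rule r_antisym[OF k i(1)])
        then show ?thesis using i pf by simp
      qed }
  qed
  then show ?thesis using that depth by blast
qed

section \<open>Linear nonzerodivisors modulo monomial ideals\<close>

text \<open>If some power of each variable in \<open>T\<close> multiplies \<open>m\<close> into the ideal, then a maximal multiple of \<open>m\<close>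
outside it is multiplied into it by the variables themselves.\<close>

lemma maximal_standard_multiple:
  fixes m :: "'v \<Rightarrow>\<^sub>0 nat"
  assumes D: "upward_closed D" and "finite T" "\<not> D m"
    "\<And>t. t \<in> T \<Longrightarrow> \<exists>k. D (Poly_Mapping.single t k + m)"
  shows "\<exists>n. \<not> D (n + m) \<and> (\<forall>t\<in>T. D (Poly_Mapping.single t 1 + (n + m)))"
  using assms(2-)
proof (induction T rule: finite_induct)
  case empty
  then show ?case by (intro exI[of _ 0]) simp
next
  case (insert t T)
  have up: "D a \<Longrightarrow> D (b + a)" for a b using D by (simp add: upward_closed_def)
  obtain n where n: "\<not> D (n + m)" "\<forall>t\<in>T. D (Poly_Mapping.single t 1 + (n + m))"
    using insert.IH insert.prems by blast
  obtain k0 where "D (Poly_Mapping.single t k0 + m)" using insert.prems by blast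
  from up[OF this, of n] have "D (Poly_Mapping.single t k0 + (n + m))" by (simp add: algebra_simps)
  then have ex: "\<exists>k. D (Poly_Mapping.single t k + (n + m))" by blast
  define k where "k = (LEAST k. D (Poly_Mapping.single t k + (n + m)))"
  have k: "D (Poly_Mapping.single t k + (n + m))" unfolding k_def by (rule LeastI_ex[OF ex])
  have "k \<noteq> 0" using k n(1) by (cases "k = 0") auto
  then have not: "\<not> D (Poly_Mapping.single t (k - 1) + (n + m))"
    unfolding k_def by (intro not_less_Least) simp
  have eq: "Poly_Mapping.single t k = Poly_Mapping.single t 1 + Poly_Mapping.single t (k - 1)"
    using \<open>k \<noteq> 0\<close> by (simp add: single_add[symmetric])
  show ?case
  proof (intro exI[of _ "Poly_Mapping.single t (k - 1) + n"] conjI ballI)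
    show "\<not> D (Poly_Mapping.single t (k - 1) + n + m)" using not by (simp add: add.assoc)
    fix s assume "s \<in> insert t T"
    then show "D (Poly_Mapping.single s 1 + (Poly_Mapping.single t (k - 1) + n + m))"
    proof
      assume "s = t" then show ?thesis using k unfolding eq by (simp only: add.assoc)
    next
      assume "s \<in> T"
      with n(2) have "D (Poly_Mapping.single s 1 + (n + m))" by blast
      from up[OF this, of "Poly_Mapping.single t (k - 1)"] show ?thesis by (simp only: ac_simps)
    qed
  qed
qed

text \<open>The zerodivisors modulo a monomial ideal are the elements of its associated primes, which are generated by
variables. So a linear form is a nonzerodivisor unless some monomial outside the ideal is multiplied into
it by all variables of the form. The proof is direct. Some variable \<open>t\<close> of the form has all powers times \<open>m0\<close>
outside the ideal; after saturation with respect to \<open>t\<close>, a term of \<open>f\<close> outside the ideal with maximal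
exponent of \<open>t\<close> contributes a term to the product that nothing can cancel.\<close>

lemma linear_form_nonzerodivisor:
  fixes f :: "('v, 'k::field) mpoly"
  assumes D: "upward_closed D" and T: "finite T" "\<And>t. t \<in> T \<Longrightarrow> c t \<noteq> 0"
    and step: "\<And>m. \<not> D m \<Longrightarrow> \<exists>t\<in>T. \<not> D (Poly_Mapping.single t 1 + m)"
    and prod: "\<And>m. m \<in> keys ((\<Sum>t\<in>T. Poly_Mapping.single (Poly_Mapping.single t 1) (c t)) * f) \<Longrightarrow> D m"
    and m0: "m0 \<in> keys f"
  shows "D m0"
proof (rule ccontr)
  assume "\<not> D m0"
  have up: "D a \<Longrightarrow> D (b + a)" for a b using D by (simp add: upward_closed_def)
  have "\<exists>t\<in>T. \<forall>k. \<not> D (Poly_Mapping.single t k + m0)"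
  proof (rule ccontr)
    assume "\<not> ?thesis"
    then obtain n where "\<not> D (n + m0)" "\<forall>t\<in>T. D (Poly_Mapping.single t 1 + (n + m0))"
      using maximal_standard_multiple[OF D T(1) \<open>\<not> D m0\<close>] by blast
    then show False using step[of "n + m0"] by blast
  qed
  then obtain t where t: "t \<in> T" "\<And>k. \<not> D (Poly_Mapping.single t k + m0)" by blast
  \<comment> \<open>The saturation of the ideal with respect to \<open>t\<close>.\<close>
  define D' where "D' m \<longleftrightarrow> (\<exists>k. D (Poly_Mapping.single t k + m))" for m
  have D'_up: "D' (b + a)" if a: "D' a" for a b
  proof -
    obtain k where "D (Poly_Mapping.single t k + a)" using a by (auto simp: D'_def)
    from up[OF this, of b] show ?thesis by (auto simp: D'_def ac_simps)
  qed
  have D'_t: "D' m" if m: "D' (Poly_Mapping.single t 1 + m)" for m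
  proof -
    obtain k where "D (Poly_Mapping.single t k + (Poly_Mapping.single t 1 + m))" using m by (auto simp: D'_def)
    then have "D (Poly_Mapping.single t (k + 1) + m)" by (simp only: single_add add.assoc)
    then show ?thesis by (auto simp: D'_def)
  qed
  let ?S = "{m \<in> keys f. \<not> D' m}"
  let ?e = "\<lambda>m. lookup m t"
  have finS: "finite (?e ` ?S)" by simp
  have "m0 \<in> ?S" using t m0 by (simp add: D'_def)
  then have "Max (?e ` ?S) \<in> ?e ` ?S" using finS by (intro Max_in) auto
  then obtain m where m: "m \<in> ?S" "?e m = Max (?e ` ?S)" by auto
  have max: "?e m' \<le> ?e m" if "m' \<in> ?S" for m' using that finS m(2) by simp
  let ?b = "Poly_Mapping.single t 1 + m"
  let ?q = "\<lambda>s. Poly_Mapping.single (Poly_Mapping.single s 1) (c s) * f"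
  have zero: "lookup (?q s) ?b = 0" if s: "s \<noteq> t" for s
  proof (cases "\<exists>m'. ?b = Poly_Mapping.single s 1 + m'")
    case False then show ?thesis by (intro lookup_single_mult_eq_0) blast
  next
    case True
    then obtain m' where m': "?b = Poly_Mapping.single s 1 + m'" by blast
    have "?e ?b = ?e m + 1" by (simp add: lookup_add)
    moreover have "?e ?b = ?e m'" unfolding m' using s by (simp add: lookup_add lookup_single_not_eq)
    ultimately have "m' \<notin> ?S" using max[of m'] by auto
    moreover have "\<not> D' m'"
    proof
      assume "D' m'"
      then have "D' ?b" unfolding m' by (rule D'_up)
      then show False using D'_t m(1) by blast
    qed
    ultimately have "lookup f m' = 0" by (simp add: in_keys_iff)
    then show ?thesis unfolding m' by (simp add: lookup_single_mult_add)
  qed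
  have "lookup (\<Sum>s\<in>T. ?q s) ?b = (\<Sum>s\<in>T. lookup (?q s) ?b)" by (rule lookup_sum)
  also have "\<dots> = lookup (?q t) ?b + (\<Sum>s\<in>T - {t}. lookup (?q s) ?b)" using T(1) t(1) by (rule sum.remove)
  also have "(\<Sum>s\<in>T - {t}. lookup (?q s) ?b) = 0" by (rule sum.neutral) (use zero in blast)
  also have "lookup (?q t) ?b = c t * lookup f m" by (rule lookup_single_mult_add)
  finally have "lookup (\<Sum>s\<in>T. ?q s) ?b \<noteq> 0" using T(2)[OF t(1)] m(1) by (simp add: in_keys_iff)
  then have "?b \<in> keys ((\<Sum>t\<in>T. Poly_Mapping.single (Poly_Mapping.single t 1) (c t)) * f)"
    by (simp add: in_keys_iff sum_distrib_right)
  then have "D ?b" by (rule prod)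
  then have "D' m" by (auto simp: D'_def)
  then show False using m(1) by blast
qed

section \<open>Identifying variables\<close>

definition rename_monomial :: "('v \<Rightarrow> 'v) \<Rightarrow> ('v \<Rightarrow>\<^sub>0 nat) \<Rightarrow> ('v \<Rightarrow>\<^sub>0 nat)" where
  "rename_monomial \<pi> m = (\<Sum>v\<in>keys m. Poly_Mapping.single (\<pi> v) (lookup m v))"

definition rename_poly :: "('v \<Rightarrow> 'v) \<Rightarrow> ('v, 'k::field) mpoly \<Rightarrow> ('v, 'k) mpoly" where
  "rename_poly \<pi> f = (\<Sum>m\<in>keys f. Poly_Mapping.single (rename_monomial \<pi> m) (lookup f m))"

lemma rename_monomial_add: "rename_monomial \<pi> (m + n) = rename_monomial \<pi> m + rename_monomial \<pi> n"
  unfolding rename_monomial_def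
  by (rule setsum_keys_plus_distrib[where f = "\<lambda>v. Poly_Mapping.single (\<pi> v)"]) (simp_all add: single_add)

lemma rename_monomial_single: "rename_monomial \<pi> (Poly_Mapping.single v k) = Poly_Mapping.single (\<pi> v) k"
  by (cases "k = 0") (simp_all add: rename_monomial_def)

lemma rename_monomial_zero: "rename_monomial \<pi> 0 = 0"
  by (simp add: rename_monomial_def)

lemma rename_poly_add: "rename_poly \<pi> (f + g) = rename_poly \<pi> f + rename_poly \<pi> g"
  unfolding rename_poly_def
  by (rule setsum_keys_plus_distrib[where f = "\<lambda>m. Poly_Mapping.single (rename_monomial \<pi> m)"])
    (simp_all add: single_add)

lemma rename_poly_zero: "rename_poly \<pi> 0 = 0"
  by (simp add: rename_poly_def)

lemma rename_poly_uminus: "rename_poly \<pi> (- f) = - rename_poly \<pi> f"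
  using rename_poly_add[of \<pi> f "- f"] by (simp add: rename_poly_zero eq_neg_iff_add_eq_0 add.commute)

lemma rename_poly_diff: "rename_poly \<pi> (f - g) = rename_poly \<pi> f - rename_poly \<pi> g"
  using rename_poly_add[of \<pi> f "- g"] by (simp add: rename_poly_uminus)

lemma rename_poly_sum: "rename_poly \<pi> (sum h A) = (\<Sum>a\<in>A. rename_poly \<pi> (h a))"
  by (induction A rule: infinite_finite_induct) (simp_all add: rename_poly_zero rename_poly_add)

lemma rename_poly_single: "rename_poly \<pi> (Poly_Mapping.single m c) = Poly_Mapping.single (rename_monomial \<pi> m) c"
  by (cases "c = 0") (simp_all add: rename_poly_def)

lemma rename_poly_var: "rename_poly \<pi> (var v) = var (\<pi> v)"
  unfolding var_def rename_poly_single rename_monomial_single ..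

lemma rename_poly_mult: "rename_poly \<pi> (f * g) = rename_poly \<pi> f * rename_poly \<pi> g"
proof -
  let ?F = "\<lambda>m. Poly_Mapping.single m (lookup f m)" and ?G = "\<lambda>m. Poly_Mapping.single m (lookup g m)"
  have "f * g = (\<Sum>m\<in>keys f. ?F m) * (\<Sum>m\<in>keys g. ?G m)"
    using poly_eq_sum_single[of f] poly_eq_sum_single[of g] by simp
  also have "\<dots> = (\<Sum>m\<in>keys f. \<Sum>n\<in>keys g. ?F m * ?G n)" by (rule sum_product)
  finally have "rename_poly \<pi> (f * g) = (\<Sum>m\<in>keys f. \<Sum>n\<in>keys g. rename_poly \<pi> (?F m * ?G n))"
    by (simp add: rename_poly_sum)
  also have "\<dots> = rename_poly \<pi> f * rename_poly \<pi> g"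
    unfolding rename_poly_def[of \<pi> f] rename_poly_def[of \<pi> g] sum_product
    by (simp add: mult_single rename_poly_single rename_monomial_add)
  finally show ?thesis .
qed

lemma rename_poly_in_polys:
  fixes f :: "('v, 'k::field) mpoly"
  assumes "f \<in> polys V" "\<And>v. v \<in> V \<Longrightarrow> \<pi> v \<in> V"
  shows "rename_poly \<pi> f \<in> polys V"
  using assms(1)
proof (induction rule: poly_induct)
  case (const c)
  then show ?case by (simp add: rename_poly_single rename_monomial_zero polys_iff)
qed (simp_all add: rename_poly_var rename_poly_add rename_poly_mult polys_closed var_in_poly_ring assms(2))

text \<open>The monomials of the ideal generated by the images of the edges. Two ends of an edge may have the same image, so
this ideal need not be squarefree and divisibility is spelled out.\<close>

definition folded_edge :: "('v \<Rightarrow> 'v) \<Rightarrow> 'v ugraph \<Rightarrow> ('v \<Rightarrow>\<^sub>0 nat) \<Rightarrow> bool" where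
  "folded_edge \<pi> H m \<longleftrightarrow> (\<exists>a b n. {a, b} \<in> edges H \<and>
     m = n + (Poly_Mapping.single (\<pi> a) 1 + Poly_Mapping.single (\<pi> b) 1))"

lemma upward_closed_folded_edge: "upward_closed (folded_edge \<pi> H)"
  unfolding upward_closed_def folded_edge_def by (metis add.assoc)

lemma folded_edgeI:
  assumes "{a, b} \<in> edges H" "\<pi> a \<in> keys m" "\<pi> b \<in> keys m" "\<pi> a \<noteq> \<pi> b"
  shows "folded_edge \<pi> H m"
proof -
  let ?e = "Poly_Mapping.single (\<pi> a) 1 + Poly_Mapping.single (\<pi> b) (1::nat)"
  have "m = (m - ?e) + ?e"
    using assms(2-) by (intro poly_mapping_eqI)
      (auto simp: lookup_add lookup_minus lookup_single when_def in_keys_iff)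
  then show ?thesis unfolding folded_edge_def using assms(1) by blast
qed

text \<open>If multiplication by \<open>t\<close> brings a monomial into the folded ideal then the variable \<open>t\<close> itself takes part in the
generator, provided that it has not been identified with another one.\<close>

lemma folded_edge_single_addD:
  assumes H: "simple_graph H" and t: "\<And>a. \<pi> a = t \<longleftrightarrow> a = t"
    and fe: "folded_edge \<pi> H (Poly_Mapping.single t 1 + m)" and not: "\<not> folded_edge \<pi> H m"
  obtains b where "{t, b} \<in> edges H" "\<pi> b \<in> keys m"
proof -
  obtain a b n where ab: "{a, b} \<in> edges H"
    "Poly_Mapping.single t 1 + m = n + (Poly_Mapping.single (\<pi> a) 1 + Poly_Mapping.single (\<pi> b) 1)"
    using fe unfolding folded_edge_def by blast
  have look: "(if v = t then 1 else 0) + lookup m v =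
      lookup n v + ((if v = \<pi> a then 1 else 0) + (if v = \<pi> b then 1 else 0))" for v
    using arg_cong[OF ab(2), of "\<lambda>m. lookup m v"]
    by (auto simp: lookup_add lookup_single when_def split: if_splits)
  have ne: "a \<noteq> b" using simple_graphD(1)[OF H ab(1)] .
  have "a = t \<or> b = t"
  proof (rule ccontr)
    assume "\<not> ?thesis"
    then have nt: "t \<noteq> \<pi> a" "t \<noteq> \<pi> b" using t by auto
    have "m = (n - Poly_Mapping.single t 1) + (Poly_Mapping.single (\<pi> a) 1 + Poly_Mapping.single (\<pi> b) 1)"
    proof (rule poly_mapping_eqI)
      fix v
      show "lookup m v = lookup ((n - Poly_Mapping.single t 1) +
          (Poly_Mapping.single (\<pi> a) 1 + Poly_Mapping.single (\<pi> b) 1)) v"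
        using look[of v] nt by (auto simp: lookup_add lookup_minus lookup_single when_def split: if_splits)
    qed
    then show False using not ab(1) unfolding folded_edge_def by blast
  qed
  moreover have "\<pi> b \<in> keys m" if "a = t"
  proof -
    have "\<pi> b \<noteq> t" using ne that t by auto
    then show ?thesis using look[of "\<pi> b"] by (auto simp: in_keys_iff)
  qed
  moreover have "\<pi> a \<in> keys m" if "b = t"
  proof -
    have "\<pi> a \<noteq> t" using ne that t by auto
    then show ?thesis using look[of "\<pi> a"] by (auto simp: in_keys_iff)
  qed
  ultimately show ?thesis using that ab(1) by (metis insert_commute)
qed

text \<open>The second element \<open>p x\<close> of each pair is identified with the first element \<open>x\<close>.\<close>

definition fold_pairs :: "('v \<Rightarrow> 'v) \<Rightarrow> 'v set \<Rightarrow> 'v \<Rightarrow> 'v" where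
  "fold_pairs p B w = (if w \<in> p ` B then p w else w)"

text \<open>Dividing out differences of variables amounts to identifying these variables. A polynomial is congruent to its
image under the identification, since this holds for variables and is compatible with sums and products.\<close>

lemma pair_ideal_eq:
  fixes H :: "'v ugraph" and p B
  defines "\<pi> \<equiv> fold_pairs p B"
  assumes H: "simple_graph H" and B: "B \<subseteq> verts H" "p ` B \<subseteq> verts H" "\<And>x. x \<in> B \<Longrightarrow> p (p x) = x" "B \<inter> p ` B = {}"
  shows "Idl\<^bsub>poly_ring (verts H)\<^esub> (edge_ideal H \<union> (\<lambda>x. var x - var (p x)) ` B) =
    {f \<in> (polys (verts H) :: ('v, 'k::field) mpoly set). \<forall>m\<in>keys (rename_poly \<pi> f). folded_edge \<pi> H m}"
    (is "?L = ?K")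
proof
  let ?V = "verts H" and ?I = "edge_ideal H :: ('v, 'k) mpoly set"
  let ?D = "(\<lambda>x. var x - var (p x)) ` B :: ('v, 'k) mpoly set"
  interpret I: rel_ideal "polys ?V" ?I by (rule ideal_imp_rel_ideal[OF ideal_edge_ideal[OF H]])
  have D_sub: "?D \<subseteq> polys ?V" using B(1,2) by (auto intro!: I.diff_C var_in_poly_ring)
  have gens: "?I \<union> ?D \<subseteq> polys ?V" using D_sub I.J_sub by blast
  have \<pi>_B: "\<pi> x = x" "\<pi> (p x) = x" if "x \<in> B" for x using that B(3,4) by (auto simp: \<pi>_def fold_pairs_def)
  have \<pi>_V: "\<pi> v \<in> ?V" if "v \<in> ?V" for v using that B(1,3) by (auto simp: \<pi>_def fold_pairs_def)
  let ?M = "monomial_ideal UNIV (folded_edge \<pi> H) :: ('v, 'k) mpoly set"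
  have K_eq: "?K = {f \<in> polys ?V. rename_poly \<pi> f \<in> ?M}" by (simp add: monomial_ideal_def polys_iff)
  interpret M: rel_ideal "polys UNIV" ?M by (rule rel_ideal_monomial_ideal[OF upward_closed_folded_edge])
  have K: "rel_ideal (polys ?V) ?K" unfolding K_eq
  proof (rule rel_ideal.intro)
    show "0 \<in> {f \<in> polys ?V. rename_poly \<pi> f \<in> ?M}" by (simp add: rename_poly_zero I.zero_C M.zero_J)
    show "a + b \<in> {f \<in> polys ?V. rename_poly \<pi> f \<in> ?M}"
      if "a \<in> {f \<in> polys ?V. rename_poly \<pi> f \<in> ?M}" "b \<in> {f \<in> polys ?V. rename_poly \<pi> f \<in> ?M}" for a b
      using that by (simp add: rename_poly_add I.add_C M.add_J)
    show "a * b \<in> {f \<in> polys ?V. rename_poly \<pi> f \<in> ?M}"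
      if "a \<in> polys ?V" "b \<in> {f \<in> polys ?V. rename_poly \<pi> f \<in> ?M}" for a b
    proof -
      have "rename_poly \<pi> a \<in> polys UNIV" by (simp add: polys_iff)
      then show ?thesis using that by (simp add: rename_poly_mult I.mult_C M.mult_J)
    qed
  qed (blast intro: I.one_C I.add_C I.mult_C I.uminus_C)+
  show "?L \<subseteq> ?K"
  proof (rule genideal_subset_rel_ideal[OF K])
    have "?I \<subseteq> ?K" unfolding edge_ideal_def
    proof (rule genideal_subset_rel_ideal[OF K], rule subsetI)
      fix f :: "('v, 'k) mpoly" assume f: "f \<in> {var u * var v | u v. {u, v} \<in> edges H}"
      then obtain u v where uv: "{u, v} \<in> edges H" "f = var u * var v" by blast
      have "keys (rename_poly \<pi> f) = {Poly_Mapping.single (\<pi> u) 1 + Poly_Mapping.single (\<pi> v) 1}"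
        unfolding uv(2) rename_poly_mult rename_poly_var unfolding var_mult_eq_single by simp
      moreover have "folded_edge \<pi> H (0 + (Poly_Mapping.single (\<pi> u) 1 + Poly_Mapping.single (\<pi> v) 1))"
        unfolding folded_edge_def using uv(1) by blast
      moreover have "f \<in> polys ?V" using f edge_generators_in_polys[OF H] by blast
      ultimately show "f \<in> ?K" by simp
    qed
    moreover have "?D \<subseteq> ?K"
      using D_sub by (auto simp: rename_poly_diff rename_poly_var \<pi>_B)
    ultimately show "?I \<union> ?D \<subseteq> ?K" by blast
  qed
  interpret L: rel_ideal "polys ?V" ?L by (rule rel_ideal_genideal[OF gens])
  have L_sup: "?I \<subseteq> ?L" "?D \<subseteq> ?L" using subset_genideal[OF gens] by blast+
  have diff: "f - rename_poly \<pi> f \<in> ?L" if "f \<in> polys ?V" for f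
  proof -
    have "f \<in> polys ?V \<and> f - rename_poly \<pi> f \<in> ?L" using that
    proof (induction rule: poly_induct)
      case (const c)
      then show ?case by (simp add: rename_poly_single rename_monomial_zero L.zero_J polys_iff)
    next
      case (var v)
      show ?case
      proof (cases "v \<in> p ` B")
        case True
        then obtain x where x: "x \<in> B" "v = p x" by blast
        have "var x - var (p x) \<in> ?L" using L_sup(2) x(1) by blast
        from L.uminus_J[OF this] show ?thesis using var x \<pi>_B(2)[OF x(1)]
          by (simp add: rename_poly_var var_in_poly_ring)
      next
        case False
        then have "\<pi> v = v" by (simp add: \<pi>_def fold_pairs_def)
        then show ?thesis using var by (simp add: rename_poly_var L.zero_J var_in_poly_ring)
      qed
    next
      case (add f g)
      then show ?case using L.add_J[of "f - rename_poly \<pi> f" "g - rename_poly \<pi> g"]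
        by (simp add: rename_poly_add I.add_C algebra_simps)
    next
      case (mult f g)
      have "rename_poly \<pi> g \<in> polys ?V" using mult by (intro rename_poly_in_polys \<pi>_V) auto
      then have "f * (g - rename_poly \<pi> g) + rename_poly \<pi> g * (f - rename_poly \<pi> f) \<in> ?L"
        using mult by (intro L.add_J L.mult_J) auto
      then show ?case using mult by (simp add: rename_poly_mult I.mult_C algebra_simps)
    qed
    then show ?thesis by blast
  qed
  have "monomial_ideal ?V (folded_edge \<pi> H) \<subseteq> ?L"
  proof (rule monomial_ideal_subset[OF L.rel_ideal_axioms])
    fix m assume "folded_edge \<pi> H m"
    then obtain a b n where ab: "{a, b} \<in> edges H"
      "m = n + (Poly_Mapping.single (\<pi> a) 1 + Poly_Mapping.single (\<pi> b) 1)"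
      unfolding folded_edge_def by blast
    let ?f = "var a * var b :: ('v, 'k) mpoly"
    have fI: "?f \<in> ?I" using ab(1) subset_genideal[OF edge_generators_in_polys[OF H]] unfolding edge_ideal_def by blast
    then have "?f - (?f - rename_poly \<pi> ?f) \<in> ?L"
      using L_sup(1) I.J_sub by (intro L.diff_J diff) auto
    moreover have "?f - (?f - rename_poly \<pi> ?f) = var (\<pi> a) * var (\<pi> b)"
      by (simp add: rename_poly_mult rename_poly_var)
    ultimately have "Poly_Mapping.single (Poly_Mapping.single (\<pi> a) 1 + Poly_Mapping.single (\<pi> b) 1) 1 \<in> ?L"
      by (simp only: var_mult_eq_single)
    then show "\<exists>a b. m = a + b \<and> Poly_Mapping.single b 1 \<in> ?L" using ab(2) by blast
  qed
  moreover have "rename_poly \<pi> f \<in> monomial_ideal ?V (folded_edge \<pi> H)" if "f \<in> ?K" for f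
    using that rename_poly_in_polys[of f ?V \<pi>, OF _ \<pi>_V] by (simp add: monomial_ideal_def)
  ultimately show "?K \<subseteq> ?L"
  proof (intro subsetI)
    fix f assume f: "f \<in> ?K" and sub: "monomial_ideal ?V (folded_edge \<pi> H) \<subseteq> ?L"
      and mon: "\<And>f. f \<in> ?K \<Longrightarrow> rename_poly \<pi> f \<in> monomial_ideal ?V (folded_edge \<pi> H)"
    have "rename_poly \<pi> f \<in> ?L" using mon[OF f] sub by blast
    then have "(f - rename_poly \<pi> f) + rename_poly \<pi> f \<in> ?L" using f by (intro L.add_J diff) auto
    then show "f \<in> ?L" by simp
  qed
qed

section \<open>A lower bound for the depth\<close>

text \<open>After some pairs have been identified, suppose that the two variables of the next pair \<open>x, p x\<close> both multiply a
monomial \<open>m\<close> into the ideal, but \<open>m\<close> is not in it. Then \<open>m\<close> is divisible by the images of a neighbour \<open>b\<close> of \<open>x\<close>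
and of a neighbour \<open>b'\<close> of \<open>p x\<close>. These two are adjacent by the condition \<open>pair\<close>, so \<open>m\<close> lies in the
ideal unless they have been identified, and the condition \<open>anti\<close> excludes that. At the end, if \<open>u\<close> multiplies
\<open>m\<close> into the ideal then \<open>m\<close> is divisible by a neighbour \<open>v1\<close> or \<open>v2\<close>, which has not been identified
with any vertex and hence occurs in the generators with exponent at most one. Multiplying \<open>m\<close> by that
variable therefore does not bring it into the ideal.\<close>

lemma depth_ge_pairs_and_star:
  fixes H :: "'v ugraph"
  assumes H: "simple_graph H" and dist: "distinct xs"
    and xs: "\<And>x. x \<in> set xs \<Longrightarrow> x \<in> verts H \<and> p x \<in> verts H \<and> p (p x) = x \<and> p x \<notin> set xs"
    and pair: "\<And>x w w'. x \<in> set xs \<Longrightarrow> {x, w} \<in> edges H \<Longrightarrow> {p x, w'} \<in> edges H \<Longrightarrow> {w, w'} \<in> edges H"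
    and anti: "\<And>x w. x \<in> set xs \<Longrightarrow> w \<in> set xs \<union> p ` set xs \<Longrightarrow>
      {x, w} \<in> edges H \<Longrightarrow> {p x, p w} \<in> edges H \<Longrightarrow> w = p x"
    and u: "u \<in> verts H" "u \<notin> set xs \<union> p ` set xs"
    and nbrs: "\<And>w. {u, w} \<in> edges H \<longleftrightarrow> w = v1 \<or> w = v2" "v1 \<noteq> v2"
      "v1 \<notin> set xs \<union> p ` set xs" "v2 \<notin> set xs \<union> p ` set xs"
  shows "enat (length xs + 1) \<le> edge_ring_depth TYPE('k::field) H"
proof -
  let ?V = "verts H" and ?I = "edge_ideal H :: ('v, 'k) mpoly set"
  interpret R: cring "poly_ring ?V :: ('v, 'k) mpoly ring" by (rule cring_poly_ring)
  have I: "ideal ?I (poly_ring ?V)" by (rule ideal_edge_ideal[OF H])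
  interpret I: rel_ideal "polys ?V" ?I by (rule ideal_imp_rel_ideal[OF I])
  have v12: "u \<noteq> v1" "u \<noteq> v2" "v1 \<in> ?V" "v2 \<in> ?V"
    using simple_graphD[OF H] nbrs(1) by blast+
  define d where "d x = (var x - var (p x) :: ('v, 'k) mpoly)" for x
  define l where "l = (var u + var v1 + var v2 :: ('v, 'k) mpoly)"
  define fs where "fs = map d xs @ [l]"
  have vars: "var ` ?V \<subseteq> (polys ?V :: ('v, 'k) mpoly set)" by (auto intro: var_in_poly_ring)
  have V_sub: "?I \<union> var ` ?V \<subseteq> polys ?V" using vars I.J_sub by blast
  interpret m: rel_ideal "polys ?V" "Idl\<^bsub>poly_ring ?V\<^esub> (?I \<union> var ` ?V)" by (rule rel_ideal_genideal[OF V_sub])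
  have var_m: "var v \<in> Idl\<^bsub>poly_ring ?V\<^esub> (?I \<union> var ` ?V)" if "v \<in> ?V" for v
    using subset_genideal[OF V_sub] that by blast
  have fs_m: "set fs \<subseteq> Idl\<^bsub>poly_ring ?V\<^esub> (?I \<union> var ` ?V)"
    using xs u(1) v12(3,4) by (auto simp: fs_def d_def l_def intro!: m.diff_J m.add_J var_m)
  then have fs_V: "set fs \<subseteq> polys ?V" using m.J_sub by blast
  have member: "Idl\<^bsub>poly_ring ?V\<^esub> (?I \<union> d ` B) =
      {f \<in> polys ?V. \<forall>m\<in>keys (rename_poly (fold_pairs p B) f). folded_edge (fold_pairs p B) H m}"
    if "B \<subseteq> set xs" for B
    unfolding d_def by (rule pair_ideal_eq[OF H]) (use that xs in blast)+
  have fold_fix: "fold_pairs p B a = t \<longleftrightarrow> a = t" if "B \<subseteq> set xs" "t \<notin> B \<union> p ` B" for B a t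
    using that xs by (auto simp: fold_pairs_def)
  have step_nzd: "r \<in> Idl\<^bsub>poly_ring ?V\<^esub> (?I \<union> d ` B)"
    if B: "B \<subseteq> set xs" and r: "r \<in> polys ?V" and g: "g = (\<Sum>t\<in>T. Poly_Mapping.single (Poly_Mapping.single t 1) (c t))"
      and T: "finite T" "\<And>t. t \<in> T \<Longrightarrow> c t \<noteq> 0" "rename_poly (fold_pairs p B) g = g"
      and step: "\<And>m. \<not> folded_edge (fold_pairs p B) H m \<Longrightarrow>
        \<exists>t\<in>T. \<not> folded_edge (fold_pairs p B) H (Poly_Mapping.single t 1 + m)"
      and gr: "g * r \<in> Idl\<^bsub>poly_ring ?V\<^esub> (?I \<union> d ` B)"
    for B r T c g
  proof -
    let ?\<pi> = "fold_pairs p B"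
    have "folded_edge ?\<pi> H m" if m: "m \<in> keys (rename_poly ?\<pi> r)" for m
    proof (rule linear_form_nonzerodivisor[OF upward_closed_folded_edge T(1,2) step _ m])
      fix n assume "n \<in> keys ((\<Sum>t\<in>T. Poly_Mapping.single (Poly_Mapping.single t 1) (c t)) * rename_poly ?\<pi> r)"
      then have "n \<in> keys (rename_poly ?\<pi> (g * r))" unfolding rename_poly_mult T(3) unfolding g .
      then show "folded_edge ?\<pi> H n" using gr unfolding member[OF B] by blast
    qed
    then show ?thesis unfolding member[OF B] using r by blast
  qed
  have nzd_pair: "r \<in> Idl\<^bsub>poly_ring ?V\<^esub> (?I \<union> d ` B)"
    if B: "B \<subseteq> set xs" and x: "x \<in> set xs" "x \<notin> B" and r: "r \<in> polys ?V"
      and dr: "d x * r \<in> Idl\<^bsub>poly_ring ?V\<^esub> (?I \<union> d ` B)" for B x r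
  proof -
    let ?\<pi> = "fold_pairs p B"
    have pB: "p x \<notin> B \<union> p ` B"
    proof -
      have "p x \<noteq> p y" if "y \<in> B" for y
      proof
        assume "p x = p y"
        then have "x = y" using xs[OF x(1)] xs[of y] B that by (metis subsetD)
        then show False using x(2) that by simp
      qed
      then show ?thesis using xs[OF x(1)] B by blast
    qed
    have xB: "x \<notin> B \<union> p ` B" using x xs B by blast
    have pp: "p (p z) = z" if "z \<in> B" for z using that xs B by blast
    have ne: "x \<noteq> p x" using xs[OF x(1)] x(1) by metis
    show ?thesis
    proof (rule step_nzd[where T = "{x, p x}" and c = "\<lambda>t. if t = x then 1 else - 1", OF B r _ _ _ _ _ dr])
      show "d x = (\<Sum>t\<in>{x, p x}. Poly_Mapping.single (Poly_Mapping.single t 1) (if t = x then 1 else - 1))"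
        using ne by (simp add: d_def var_def single_uminus)
      show "rename_poly ?\<pi> (d x) = d x"
        using fold_fix[OF B xB, of x] fold_fix[OF B pB, of "p x"] by (simp add: d_def rename_poly_diff rename_poly_var)
      fix m assume not: "\<not> folded_edge ?\<pi> H m"
      show "\<exists>t\<in>{x, p x}. \<not> folded_edge ?\<pi> H (Poly_Mapping.single t 1 + m)"
      proof (rule ccontr)
        assume "\<not> ?thesis"
        then have fe: "folded_edge ?\<pi> H (Poly_Mapping.single x 1 + m)"
          "folded_edge ?\<pi> H (Poly_Mapping.single (p x) 1 + m)" by auto
        obtain b where b: "{x, b} \<in> edges H" "?\<pi> b \<in> keys m"
          by (rule folded_edge_single_addD[OF H fold_fix[OF B xB] fe(1) not])
        obtain b' where b': "{p x, b'} \<in> edges H" "?\<pi> b' \<in> keys m"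
          by (rule folded_edge_single_addD[OF H fold_fix[OF B pB] fe(2) not])
        have e: "{b, b'} \<in> edges H" by (rule pair[OF x(1) b(1) b'(1)])
        have "?\<pi> b = ?\<pi> b'"
          using folded_edgeI[where \<pi> = ?\<pi> and m = m, OF e b(2) b'(2)] not by blast
        moreover have "b \<noteq> b'" by (rule simple_graphD(1)[OF H e])
        ultimately consider y where "y \<in> B" "b = p y" "b' = y" | y where "y \<in> B" "b = y" "b' = p y"
          unfolding fold_pairs_def by (auto simp: pp split: if_splits)
        then show False
        proof cases
          case 1
          then have y: "y \<in> set xs" "p b = b'" using B xs by auto
          have "b = p x" using anti[OF x(1), of b] b(1) b'(1) 1 y by auto
          then have "y = x" using 1 xs[OF y(1)] xs[OF x(1)] by metis
          then show False using 1 x(2) by simp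
        next
          case 2
          then have y: "y \<in> set xs" using B by auto
          have "b = p x" using anti[OF x(1), of b] b(1) b'(1) 2 y by auto
          then show False using 2 y xs[OF x(1)] by simp
        qed
      qed
    qed auto
  qed
  have nzd_star: "r \<in> Idl\<^bsub>poly_ring ?V\<^esub> (?I \<union> d ` set xs)"
    if r: "r \<in> polys ?V" and lr: "l * r \<in> Idl\<^bsub>poly_ring ?V\<^esub> (?I \<union> d ` set xs)" for r
  proof -
    let ?\<pi> = "fold_pairs p (set xs)"
    have fix_u: "?\<pi> a = u \<longleftrightarrow> a = u" and fix_v1: "?\<pi> a = v1 \<longleftrightarrow> a = v1" and fix_v2: "?\<pi> a = v2 \<longleftrightarrow> a = v2" for a
      using fold_fix[OF order_refl] u(2) nbrs(3,4) by blast+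
    show ?thesis
    proof (rule step_nzd[where T = "{u, v1, v2}" and c = "\<lambda>_. 1", OF order_refl r _ _ _ _ _ lr])
      show "l = (\<Sum>t\<in>{u, v1, v2}. Poly_Mapping.single (Poly_Mapping.single t 1) 1)"
        using v12(1,2) nbrs(2) by (simp add: l_def var_def add.assoc)
      show "rename_poly ?\<pi> l = l"
        using fix_u[of u] fix_v1[of v1] fix_v2[of v2] by (simp add: l_def rename_poly_add rename_poly_var)
      fix m assume not: "\<not> folded_edge ?\<pi> H m"
      show "\<exists>t\<in>{u, v1, v2}. \<not> folded_edge ?\<pi> H (Poly_Mapping.single t 1 + m)"
      proof (rule ccontr)
        assume "\<not> ?thesis"
        then have fe: "folded_edge ?\<pi> H (Poly_Mapping.single u 1 + m)"
          "folded_edge ?\<pi> H (Poly_Mapping.single v1 1 + m)" "folded_edge ?\<pi> H (Poly_Mapping.single v2 1 + m)" by auto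
        obtain b where b: "{u, b} \<in> edges H" "?\<pi> b \<in> keys m"
          by (rule folded_edge_single_addD[OF H fix_u fe(1) not])
        have bv: "b = v1 \<or> b = v2" using nbrs(1) b(1) by blast
        then have fix_b: "?\<pi> a = b \<longleftrightarrow> a = b" for a using fix_v1 fix_v2 by blast
        have fb: "folded_edge ?\<pi> H (Poly_Mapping.single b 1 + m)" using bv fe by blast
        obtain b' where b': "{b, b'} \<in> edges H" "?\<pi> b' \<in> keys m"
          by (rule folded_edge_single_addD[OF H fix_b fb not])
        have "b \<noteq> b'" by (rule simple_graphD(1)[OF H b'(1)])
        then have "?\<pi> b \<noteq> ?\<pi> b'" using fix_b by metis
        then show False using folded_edgeI[where \<pi> = ?\<pi> and m = m, OF b'(1) b(2) b'(2)] not by blast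
      qed
    qed auto
  qed
  have reg: "r \<in> Idl\<^bsub>poly_ring ?V\<^esub> (?I \<union> set (take i fs))"
    if i: "i < length fs" and r: "r \<in> polys ?V" and fr: "fs ! i * r \<in> Idl\<^bsub>poly_ring ?V\<^esub> (?I \<union> set (take i fs))" for i r
  proof (cases "i < length xs")
    case True
    then have t: "set (take i fs) = d ` set (take i xs)" "fs ! i = d (xs ! i)"
      by (simp_all add: fs_def nth_append take_map)
    have "xs ! i \<notin> set (take i xs)"
      using dist True by (auto simp: in_set_conv_nth nth_eq_iff_index_eq)
    then show ?thesis
      using nzd_pair[OF set_take_subset nth_mem[OF True] _ r] fr unfolding t by blast
  next
    case False
    then have "i = length xs" using i by (simp add: fs_def)
    then have t: "set (take i fs) = d ` set xs" "fs ! i = l" by (simp_all add: fs_def nth_append)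
    show ?thesis using nzd_star[OF r] fr unfolding t by blast
  qed
  have proper: "Idl\<^bsub>poly_ring ?V\<^esub> (?I \<union> set fs) \<noteq> polys ?V"
  proof
    assume eq: "Idl\<^bsub>poly_ring ?V\<^esub> (?I \<union> set fs) = polys ?V"
    \<comment> \<open>The graded maximal ideal contains the whole sequence.\<close>
    let ?M = "monomial_ideal ?V (\<lambda>m. m \<noteq> 0) :: ('v, 'k) mpoly set"
    have "upward_closed (\<lambda>m :: 'v \<Rightarrow>\<^sub>0 nat. m \<noteq> 0)"
      unfolding upward_closed_def using keys_monomial_add by (metis Un_empty keys_eq_empty keys_zero)
    then interpret M: rel_ideal "polys ?V" ?M by (rule rel_ideal_monomial_ideal)
    have IM: "?I \<subseteq> ?M" unfolding edge_ideal_eq[OF H] by (auto simp: monomial_ideal_def edge_monomial_def)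
    have vM: "var v \<in> ?M" if "v \<in> ?V" for v
    proof -
      have "Poly_Mapping.single v (1::nat) \<noteq> 0" by (metis lookup_single_eq lookup_zero one_neq_zero)
      then show ?thesis using that var_in_poly_ring[OF that] by (simp add: monomial_ideal_def var_def)
    qed
    have "set fs \<subseteq> ?M"
      using xs u(1) v12(3,4) by (auto simp: fs_def d_def l_def intro!: M.diff_J M.add_J vM)
    then have "Idl\<^bsub>poly_ring ?V\<^esub> (?I \<union> set fs) \<subseteq> ?M"
      using IM by (intro genideal_subset_rel_ideal[OF M.rel_ideal_axioms]) blast
    then have "1 \<in> ?M" using eq I.one_C by blast
    then show False by (simp add: monomial_ideal_def)
  qed
  let ?q = "(+>\<^bsub>poly_ring ?V\<^esub>) ?I"
  have rs: "regular_sequence (edge_ring H) (map ?q fs)"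
    unfolding edge_ring_def R.regular_sequence_quot_iff[OF I fs_V] using reg proper by simp
  have "set (map ?q fs) \<subseteq> irrelevant_ideal H"
  proof -
    have irr: "irrelevant_ideal H = Idl\<^bsub>poly_ring ?V Quot ?I\<^esub> (?q ` (var ` ?V))"
      by (simp add: irrelevant_ideal_def edge_ring_def image_image)
    have "?q f \<in> irrelevant_ideal H" if "f \<in> set fs" for f
      unfolding irr using R.rcos_mem_genideal_iff[OF I vars] fs_m fs_V that by blast
    then show ?thesis by auto
  qed
  then have "enat (length (map ?q fs)) \<le> edge_ring_depth TYPE('k) H"
    unfolding edge_ring_depth_def grade_def using rs by (intro SUP_upper) blast
  then show ?thesis by (simp add: fs_def)
qed

section \<open>Joining two graphs at a leaf\<close>

lemma neighborhood_singletonD: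
  assumes "neighborhood H u = {v}"
  shows "{u, w} \<in> edges H \<longleftrightarrow> w = v" "{w, u} \<in> edges H \<longleftrightarrow> w = v"
proof -
  have "w \<in> neighborhood H u \<longleftrightarrow> w = v" using assms by simp
  then show "{w, u} \<in> edges H \<longleftrightarrow> w = v" by (simp add: neighborhood_def)
  then show "{u, w} \<in> edges H \<longleftrightarrow> w = v" by (simp add: insert_commute)
qed

lemma star_graph_verts:
  assumes "u1 \<in> verts G1" "u2 \<in> verts G2" "verts G1 \<inter> verts G2 = {}"
  shows "verts (star_graph G1 u1 G2 u2) = verts G1 \<union> (verts G2 - {u2})"
proof -
  have "verts (star_graph G1 u1 G2 u2) = insert u1 (verts G1 \<union> verts G2 - {u2})"
    using assms(2) by (simp add: star_graph_def Let_def fun_upd_image) blast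
  moreover have "u2 \<notin> verts G1" using assms(2,3) by blast
  ultimately show ?thesis using assms(1) by auto
qed

lemma star_graph_edges:
  assumes G: "simple_graph G1" "simple_graph G2" and disj: "verts G1 \<inter> verts G2 = {}"
    and u: "u1 \<in> verts G1" "u2 \<in> verts G2" and nb: "neighborhood G2 u2 = {v2}"
  shows "edges (star_graph G1 u1 G2 u2) = edges G1 \<union> {e \<in> edges G2. u2 \<notin> e} \<union> {{u1, v2}}"
proof -
  let ?i = "id(u2 := u1)"
  have ident: "?i ` e = e" if "u2 \<notin> e" for e using that by (auto simp: image_def)
  have 1: "u2 \<notin> e" if "e \<in> edges G1" for e
    using G(1) that disj u(2) unfolding simple_graph_def by blast
  have e0: "{u2, v2} \<in> edges G2" using neighborhood_singletonD[OF nb] by blast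
  then have ne: "u2 \<noteq> v2" by (rule simple_graphD(1)[OF G(2)])
  have 2: "e = {u2, v2}" if e: "e \<in> edges G2" "u2 \<in> e" for e
  proof -
    have "card e = 2" using G(2) e(1) by (simp add: simple_graph_def)
    then obtain a b where "e = {a, b}" by (auto simp: card_2_iff)
    then show ?thesis using e neighborhood_singletonD[OF nb] by auto
  qed
  have "(`) ?i ` edges G1 = edges G1" using ident 1 by (auto simp: image_iff)
  moreover have "(`) ?i ` edges G2 = {e \<in> edges G2. u2 \<notin> e} \<union> {{u1, v2}}"
  proof -
    have "edges G2 = {e \<in> edges G2. u2 \<notin> e} \<union> {{u2, v2}}" using 2 e0 by blast
    then have "(`) ?i ` edges G2 = (`) ?i ` {e \<in> edges G2. u2 \<notin> e} \<union> (`) ?i ` {{u2, v2}}"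
      by (metis image_Un)
    moreover have "(`) ?i ` {e \<in> edges G2. u2 \<notin> e} = {e \<in> edges G2. u2 \<notin> e}"
      using ident by (auto simp: image_iff)
    moreover have "(`) ?i ` {{u2, v2}} = {{u1, v2}}" using ne by auto
    ultimately show ?thesis by simp
  qed
  ultimately show ?thesis by (simp add: star_graph_def Let_def image_Un Un_assoc)
qed

text \<open>The partner of a leaf is its only neighbour, so exactly one of the two lies in \<open>X\<close>.\<close>

lemma herzog_hibi_leaf:
  assumes H: "simple_graph H" and hh: "herzog_hibi H X p" and u: "u \<in> verts H" and nb: "neighborhood H u = {v}"
  shows "Suc (card (X - {u, v})) = card X"
    and "\<And>x. x \<in> X - {u, v} \<Longrightarrow> x \<in> verts H \<and> p x \<in> verts H \<and> p (p x) = x \<and> p x \<notin> X \<and> p x \<noteq> u \<and> p x \<noteq> v"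
proof -
  have XV: "X \<union> p ` X = verts H" "X \<inter> p ` X = {}" and inv: "\<And>v. v \<in> verts H \<Longrightarrow> p v \<in> verts H \<and> p (p v) = v \<and> {v, p v} \<in> edges H"
    using hh unfolding herzog_hibi_def by auto
  have pu: "p u = v" using inv[OF u] neighborhood_singletonD[OF nb] by blast
  have pv: "p v = u" using inv[OF u] pu by simp
  have finX: "finite X" using H XV(1) unfolding simple_graph_def by (metis finite_Un)
  have "(u \<in> X \<and> v \<notin> X) \<or> (v \<in> X \<and> u \<notin> X)"
  proof (cases "u \<in> X")
    case True then show ?thesis using pu XV(2) by blast
  next
    case False
    then obtain x where "x \<in> X" "u = p x" using u XV(1) by blast
    then have "v = x" using pu inv[of x] XV(1) by auto
    then show ?thesis using False \<open>x \<in> X\<close> by blast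
  qed
  then have "X - {u, v} = X - {u} \<and> u \<in> X \<or> X - {u, v} = X - {v} \<and> v \<in> X" by auto
  then show "Suc (card (X - {u, v})) = card X" using card_Suc_Diff1[OF finX] by metis
  fix x assume x: "x \<in> X - {u, v}"
  then have xV: "x \<in> verts H" using XV(1) by blast
  have "p x \<notin> X" using x XV(2) by blast
  moreover have "p x \<noteq> u" "p x \<noteq> v" using inv[OF xV] pu pv x by auto
  ultimately show "x \<in> verts H \<and> p x \<in> verts H \<and> p (p x) = x \<and> p x \<notin> X \<and> p x \<noteq> u \<and> p x \<noteq> v"
    using inv[OF xV] xV by blast
qed

theorem theorem4p7:
  fixes G1 G2 :: "'v ugraph" and u1 v1 u2 v2 :: 'v
  assumes "simple_graph G1" and "simple_graph G2"
    and "no_isolated_vertices G1" and "no_isolated_vertices G2"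
    and "verts G1 \<inter> verts G2 = {}"
    and "bipartite G1" and "bipartite G2"
    and "cohen_macaulay TYPE('k::field) G1" and "cohen_macaulay TYPE('k) G2"
    and "leaf G1 u1" and "neighborhood G1 u1 = {v1}"
    and "leaf G2 u2" and "neighborhood G2 u2 = {v2}"
  shows "ereal_of_enat (edge_ring_depth TYPE('k) (star_graph G1 u1 G2 u2)) =
         ereal_of_enat (edge_ring_depth TYPE('k) G1) +
         ereal_of_enat (edge_ring_depth TYPE('k) G2) - 1"
proof -
  let ?G = "star_graph G1 u1 G2 u2"
  have G1: "simple_graph G1" and G2: "simple_graph G2" and disj: "verts G1 \<inter> verts G2 = {}" by fact+
  have u: "u1 \<in> verts G1" "u2 \<in> verts G2" using \<open>leaf G1 u1\<close> \<open>leaf G2 u2\<close> by (auto simp: leaf_def)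
  note nb1 = neighborhood_singletonD[OF \<open>neighborhood G1 u1 = {v1}\<close>]
    and nb2 = neighborhood_singletonD[OF \<open>neighborhood G2 u2 = {v2}\<close>]
  have v: "v1 \<in> verts G1" "v2 \<in> verts G2" "u1 \<noteq> v1" "u2 \<noteq> v2"
    using simple_graphD[OF G1, of u1 v1] simple_graphD[OF G2, of u2 v2] nb1(1)[of v1] nb2(1)[of v2] by blast+
  have disjD: "x \<in> verts G1 \<Longrightarrow> x \<notin> verts G2" for x using disj by blast
  have verts: "verts ?G = verts G1 \<union> (verts G2 - {u2})" by (rule star_graph_verts[OF u disj])
  have edges: "edges ?G = edges G1 \<union> {e \<in> edges G2. u2 \<notin> e} \<union> {{u1, v2}}"
    by (rule star_graph_edges[OF G1 G2 disj u \<open>neighborhood G2 u2 = {v2}\<close>])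
  have E: "{a, b} \<in> edges ?G \<longleftrightarrow> {a, b} \<in> edges G1 \<or> {a, b} \<in> edges G2 \<and> a \<noteq> u2 \<and> b \<noteq> u2 \<or>
      a = u1 \<and> b = v2 \<or> a = v2 \<and> b = u1" for a b
    unfolding edges by (auto simp: doubleton_eq_iff)
  have G: "simple_graph ?G"
  proof -
    have "card e = 2" if "e \<in> edges ?G" for e
      using that G1 G2 u(1) disjD v(2) unfolding edges simple_graph_def by (auto simp: card_insert_if)
    moreover have "e \<subseteq> verts ?G" if "e \<in> edges ?G" for e
      using that G1 G2 u(1) v(2,4) unfolding edges verts simple_graph_def by blast
    moreover have "finite (verts ?G)" using G1 G2 unfolding verts simple_graph_def by simp
    ultimately show ?thesis unfolding simple_graph_def by blast
  qed
  have E1: "a \<in> verts G1" "b \<in> verts G1" if "{a, b} \<in> edges G1" for a b using simple_graphD[OF G1 that] by blast+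
  have E2: "a \<in> verts G2" "b \<in> verts G2" if "{a, b} \<in> edges G2" for a b using simple_graphD[OF G2 that] by blast+
  have EG1: "{x, w} \<in> edges ?G \<longleftrightarrow> {x, w} \<in> edges G1" if "x \<in> verts G1" "x \<noteq> u1" for x w
    unfolding E using that disjD E2 v(2) by blast
  have EG2: "{x, w} \<in> edges ?G \<longleftrightarrow> {x, w} \<in> edges G2" if "x \<in> verts G2" "x \<noteq> u2" "x \<noteq> v2" for x w
    unfolding E using that disjD E1 u(1) nb2 by blast
  obtain X1 p1 where hh1: "herzog_hibi G1 X1 p1" and d1: "edge_ring_depth TYPE('k) G1 = enat (card X1)"
    by (rule cohen_macaulay_bipartite_structure[OF G1 \<open>no_isolated_vertices G1\<close> \<open>bipartite G1\<close>
        \<open>cohen_macaulay TYPE('k) G1\<close>])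
  obtain X2 p2 where hh2: "herzog_hibi G2 X2 p2" and d2: "edge_ring_depth TYPE('k) G2 = enat (card X2)"
    by (rule cohen_macaulay_bipartite_structure[OF G2 \<open>no_isolated_vertices G2\<close> \<open>bipartite G2\<close>
        \<open>cohen_macaulay TYPE('k) G2\<close>])
  note leaf1 = herzog_hibi_leaf[OF G1 hh1 u(1) \<open>neighborhood G1 u1 = {v1}\<close>]
  note leaf2 = herzog_hibi_leaf[OF G2 hh2 u(2) \<open>neighborhood G2 u2 = {v2}\<close>]
  have "edge_ring_depth TYPE('k) ?G \<le> enat (card X1 + card X2 - 1)"
  proof -
    have "independent G1 {u1}" "independent G2 {u2}"
      unfolding independent_def using u nb1(1)[of u1] nb2(1)[of u2] v(3,4) by simp_all
    then obtain F1 F2 where F1: "{u1} \<subseteq> F1" "maximal_independent G1 F1"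
      and F2: "{u2} \<subseteq> F2" "maximal_independent G2 F2"
      by (elim independent_extend[OF G1] independent_extend[OF G2]) (rule that)
    have ind: "independent G1 F1" "independent G2 F2" using F1 F2 by (auto simp: maximal_independent_def)
    have FV: "F1 \<subseteq> verts G1" "F2 \<subseteq> verts G2" using ind by (auto simp: independent_def)
    have no1: "{a, b} \<notin> edges G1" if "a \<in> F1" "b \<in> F1" for a b using ind(1) that by (auto simp: independent_def)
    have no2: "{a, b} \<notin> edges G2" if "a \<in> F2" "b \<in> F2" for a b using ind(2) that by (auto simp: independent_def)
    have v2F: "v2 \<notin> F2" using no2[of u2 v2] nb2 F2(1) by auto
    \<comment> \<open>The vertex \<open>u1\<close> of \<open>F1\<close> represents the glued vertex, so \<open>u2\<close> is left out.\<close>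
    let ?F = "F1 \<union> (F2 - {u2})"
    have c: "card F1 = card X1" "card F2 = card X2"
      using depth_eq_card_maximal_independent[OF G1 \<open>cohen_macaulay TYPE('k) G1\<close> F1(2)] d1
        depth_eq_card_maximal_independent[OF G2 \<open>cohen_macaulay TYPE('k) G2\<close> F2(2)] d2 by simp_all
    have fin: "finite F1" "finite F2" using independent_finite[OF G1 ind(1)] independent_finite[OF G2 ind(2)] by auto
    have "card ?F = card F1 + card (F2 - {u2})"
      using fin FV disj by (intro card_Un_disjoint) auto
    also have "card (F2 - {u2}) = card F2 - 1" using F2(1) fin(2) by simp
    finally have cF: "card ?F = card F1 + (card F2 - 1)" .
    have "1 \<le> card F2" using F2(1) fin(2) by (metis Suc_leI One_nat_def card_gt_0_iff empty_iff insert_subset)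
    then have cF': "card ?F = card X1 + card X2 - 1" using cF c by simp
    have "edge_ring_depth TYPE('k) ?G \<le> enat (card ?F)"
    proof (rule depth_le_card_maximal_independent[OF G])
      have "{a, b} \<notin> edges ?G" if ab: "a \<in> ?F" "b \<in> ?F" for a b
      proof
        assume "{a, b} \<in> edges ?G"
        then consider "{a, b} \<in> edges G1" | "{a, b} \<in> edges G2" | "a = v2 \<or> b = v2" unfolding E by blast
        then show False
        proof cases
          case 1 then show False using ab E1[OF 1] disjD FV no1 by blast
        next
          case 2 then show False using ab E2[OF 2] disjD FV no2 by blast
        next
          case 3 then show False using ab v2F v(2) disjD FV(1) by blast
        qed
      qed
      then show "independent ?G ?F" unfolding independent_def verts using FV by blast
      fix w assume w: "w \<in> verts ?G - ?F"
      show "\<exists>z\<in>?F. {w, z} \<in> edges ?G"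
      proof (cases "w \<in> verts G1")
        case True
        then obtain z where "z \<in> F1" "{w, z} \<in> edges G1" using F1(2) w unfolding maximal_independent_def by blast
        then show ?thesis unfolding E by blast
      next
        case False
        then have w2: "w \<in> verts G2 - F2" "w \<noteq> u2" using w verts by auto
        then obtain z where z: "z \<in> F2" "{w, z} \<in> edges G2" using F2(2) unfolding maximal_independent_def by blast
        show ?thesis
        proof (cases "z = u2")
          case True
          then have "w = v2" using z(2) nb2 by simp
          then have "{w, u1} \<in> edges ?G" unfolding E by blast
          then show ?thesis using F1(1) by blast
        next
          case False
          then show ?thesis unfolding E using z w2 by blast
        qed
      qed
    qed
    then show ?thesis unfolding cF' .
  qed
  moreover have "enat (card X1 + card X2 - 1) \<le> edge_ring_depth TYPE('k) ?G"
  proof -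
    let ?X1 = "X1 - {u1, v1}" and ?X2 = "X2 - {u2, v2}"
    define p where "p w = (if w \<in> verts G1 then p1 w else p2 w)" for w
    have X1V: "?X1 \<subseteq> verts G1" "?X2 \<subseteq> verts G2" using leaf1(2) leaf2(2) by blast+
    have p1: "p x = p1 x" if "x \<in> verts G1" for x using that by (simp add: p_def)
    have p2: "p x = p2 x" if "x \<in> verts G2" for x using that disjD by (auto simp: p_def)
    have T1: "{w, w'} \<in> edges G1" if "x \<in> verts G1" "{x, w} \<in> edges G1" "{p1 x, w'} \<in> edges G1" for x w w'
      using hh1 that unfolding herzog_hibi_def by blast
    have T2: "{w, w'} \<in> edges G2" if "x \<in> verts G2" "{x, w} \<in> edges G2" "{p2 x, w'} \<in> edges G2" for x w w'
      using hh2 that unfolding herzog_hibi_def by blast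
    have A1: "w = p1 x" if "x \<in> verts G1" "{x, w} \<in> edges G1" "{p1 x, p1 w} \<in> edges G1" for x w
      using hh1 that unfolding herzog_hibi_def by blast
    have A2: "w = p2 x" if "x \<in> verts G2" "{x, w} \<in> edges G2" "{p2 x, p2 w} \<in> edges G2" for x w
      using hh2 that unfolding herzog_hibi_def by blast
    have fin: "finite ?X1" "finite ?X2"
      using finite_subset[OF X1V(1)] finite_subset[OF X1V(2)] G1 G2 unfolding simple_graph_def by blast+
    obtain xs where xs: "distinct xs" "set xs = ?X1 \<union> ?X2" using finite_distinct_list[of "?X1 \<union> ?X2"] fin by blast
    have "length xs = card (?X1 \<union> ?X2)" using distinct_card[OF xs(1)] xs(2) by simp
    also have "\<dots> = card ?X1 + card ?X2" using fin X1V disj by (intro card_Un_disjoint) auto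
    finally have len: "length xs + 1 = card X1 + card X2 - 1" using leaf1(1) leaf2(1) by simp
    have set_cases: "(x \<in> ?X1 \<and> x \<in> verts G1 \<and> p x = p1 x \<and> p x \<in> verts G1) \<or>
        (x \<in> ?X2 \<and> x \<in> verts G2 \<and> p x = p2 x \<and> p x \<in> verts G2)" if "x \<in> set xs" for x
      using that leaf1(2)[of x] leaf2(2)[of x] p1[of x] p2[of x] unfolding xs(2) by auto
    have props1: "x \<noteq> u1 \<and> p1 (p1 x) = x \<and> p1 x \<notin> X1 \<and> p1 x \<noteq> u1 \<and> p1 x \<noteq> v1" if "x \<in> ?X1" for x
      using leaf1(2)[OF that] that by blast
    have props2: "x \<noteq> u2 \<and> x \<noteq> v2 \<and> p2 (p2 x) = x \<and> p2 x \<notin> X2 \<and> p2 x \<noteq> u2 \<and> p2 x \<noteq> v2" if "x \<in> ?X2" for x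
      using leaf2(2)[OF that] that by blast
    have "enat (length xs + 1) \<le> edge_ring_depth TYPE('k) ?G"
    proof (rule depth_ge_pairs_and_star[OF G xs(1), of p u1 v1 v2])
      fix x assume "x \<in> set xs"
      from set_cases[OF this] show "x \<in> verts ?G \<and> p x \<in> verts ?G \<and> p (p x) = x \<and> p x \<notin> set xs"
      proof (elim disjE conjE)
        assume x: "x \<in> ?X1" "x \<in> verts G1" "p x = p1 x" "p x \<in> verts G1"
        have "p (p x) = x" using p1[OF x(4)] x(3) props1[OF x(1)] by simp
        moreover have "p x \<notin> set xs" unfolding xs(2) using x(3,4) props1[OF x(1)] X1V(2) disjD by auto
        ultimately show ?thesis unfolding verts using x by blast
      next
        assume x: "x \<in> ?X2" "x \<in> verts G2" "p x = p2 x" "p x \<in> verts G2"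
        have "p (p x) = x" using p2[OF x(4)] x(3) props2[OF x(1)] by simp
        moreover have "p x \<notin> set xs" unfolding xs(2) using x(3,4) props2[OF x(1)] X1V(1) disjD by auto
        ultimately show ?thesis unfolding verts using x props2[OF x(1)] by auto
      qed
    next
      fix x w w' assume "x \<in> set xs" and e: "{x, w} \<in> edges ?G" "{p x, w'} \<in> edges ?G"
      from set_cases[OF this(1)] show "{w, w'} \<in> edges ?G"
      proof (elim disjE conjE)
        assume x: "x \<in> ?X1" "x \<in> verts G1" "p x = p1 x" "p x \<in> verts G1"
        have "{x, w} \<in> edges G1" "{p1 x, w'} \<in> edges G1"
          using e EG1[of x] EG1[of "p x"] x props1[OF x(1)] by auto
        then show ?thesis unfolding E using T1[OF x(2)] by blast
      next
        assume x: "x \<in> ?X2" "x \<in> verts G2" "p x = p2 x" "p x \<in> verts G2"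
        have ww: "{x, w} \<in> edges G2" "{p2 x, w'} \<in> edges G2"
          using e EG2[of x] EG2[of "p x"] x props2[OF x(1)] by auto
        then have "w \<noteq> u2" "w' \<noteq> u2" using nb2 props2[OF x(1)] by blast+
        then show ?thesis unfolding E using T2[OF x(2)] ww by blast
      qed
    next
      fix x w assume "x \<in> set xs" and w: "w \<in> set xs \<union> p ` set xs"
        and e: "{x, w} \<in> edges ?G" "{p x, p w} \<in> edges ?G"
      from set_cases[OF this(1)] show "w = p x"
      proof (elim disjE conjE)
        assume x: "x \<in> ?X1" "x \<in> verts G1" "p x = p1 x" "p x \<in> verts G1"
        have xw: "{x, w} \<in> edges G1" using e(1) EG1[of x] x props1[OF x(1)] by auto
        then have "p w = p1 w" using p1 E1 by blast
        then have "{p1 x, p1 w} \<in> edges G1" using e(2) EG1[of "p x"] x props1[OF x(1)] by auto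
        then show ?thesis using A1[OF x(2) xw] x(3) by simp
      next
        assume x: "x \<in> ?X2" "x \<in> verts G2" "p x = p2 x" "p x \<in> verts G2"
        have xw: "{x, w} \<in> edges G2" using e(1) EG2[of x] x props2[OF x(1)] by auto
        then have "p w = p2 w" using p2 E2 by blast
        then have "{p2 x, p2 w} \<in> edges G2" using e(2) EG2[of "p x"] x props2[OF x(1)] by auto
        then show ?thesis using A2[OF x(2) xw] x(3) by simp
      qed
    next
      show "u1 \<in> verts ?G" unfolding verts using u(1) by blast
      have notin: "z \<notin> set xs \<union> p ` set xs" if "z = u1 \<or> z = v1 \<or> z = v2" for z
      proof -
        have "z \<noteq> x \<and> z \<noteq> p x" if "x \<in> set xs" for x
          using set_cases[OF that]
        proof (elim disjE conjE)
          assume x: "x \<in> ?X1" "x \<in> verts G1" "p x = p1 x" "p x \<in> verts G1"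
          then show ?thesis using props1[OF x(1)] \<open>z = u1 \<or> z = v1 \<or> z = v2\<close> v(2) disjD by auto
        next
          assume x: "x \<in> ?X2" "x \<in> verts G2" "p x = p2 x" "p x \<in> verts G2"
          then show ?thesis using props2[OF x(1)] \<open>z = u1 \<or> z = v1 \<or> z = v2\<close> v(1) u(1) disjD by auto
        qed
        then show ?thesis by blast
      qed
      show "u1 \<notin> set xs \<union> p ` set xs" "v1 \<notin> set xs \<union> p ` set xs" "v2 \<notin> set xs \<union> p ` set xs"
        using notin by blast+
      show "v1 \<noteq> v2" using v(1,2) disjD by blast
      show "{u1, w} \<in> edges ?G \<longleftrightarrow> w = v1 \<or> w = v2" for w
        unfolding E using nb1 u(1) v(2) disjD E2 by blast
    qed
    then show ?thesis unfolding len .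
  qed
  ultimately have d: "edge_ring_depth TYPE('k) ?G = enat (card X1 + card X2 - 1)" by (rule antisym)
  have "1 \<le> card X1" "1 \<le> card X2" using leaf1(1) leaf2(1) by linarith+
  then show ?thesis unfolding d d1 d2 by (simp add: one_ereal_def)
qed

end
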